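(* Assume that, in addition, $\mathcal N''(s)\le0$ for $s\in[0,1]$. Let $0\le c<1$, $\theta=-\frac12\arcsin c$, and let $b_{c,0}=(u_*,v_* )$ be the kink of speed $c$: $u_*'=\frac{u_*\,\mathcal N(u_*^2+v_*^2)}{\sqrt{1-c^2}}$, $v_*=u_*\tan\theta$, $u_*>0$, $u_*^2+v_*^2=\tfrac14$ at $x=0$. It connects $(0,0)$ at $x=-\infty$ to $(\cos\theta,\sin\theta)$ at $x=+\infty$. Let $W_c=e^{w_c}$ be smooth with $w_c(x)=0$ for $x\le-1$ and $w_c(x)=\frac{K}{\sqrt{1-c^2}}x$ for $x\ge1$. Then: 1. $b_{c,0}$ is spectrally stable in $L^2(\mathbb R,W_c\,dx)$, i.e. the spectrum of $L_{*,w_c}=\Sigma(\partial_x-w_c'(x))+A_*(x)$ on $L^2(\mathbb R;\mathbb C^2)$ lies in the closed left half plane $\{\operatorname{Re}z\le0\}$. 2. $0\in\sigma_{\rm d}(L_{*,w_c})$, and the corresponding zero-eigenspace is spanned by the translation mode: $\partial_xb_{c,0}$ as an eigenfunction of $L_*$ in $L^2(\mathbb R,W_c\,dx)$, equivalently $e^{w_c}\partial_xb_{c,0}$ for $L_{*,w_c}$. This mode arises from the translation invariance of the moving-frame system.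
   Context: Nonlinearity: $\mathcal N:[0,\infty)\to\mathbb R$ is smooth, $\mathcal N'(s)<0$ for $s>0$, $\mathcal N(0)=1$, $\mathcal N(1)=0$, $\lim_{s\to\infty}\mathcal N(s)\in[-\infty,0)$, and $K:=-\mathcal N'(1)>0$. Moving-frame system ($x=y-ct$): $u_t=cu_x+v_x+\mathcal N(u^2+v^2)v$, $v_t=u_x+cv_x-\mathcal N(u^2+v^2)u$. Linearization about a profile $b_*=(u_*,v_* )$: with $r_*^2=u_*^2+v_*^2$, $\Sigma=\begin{bmatrix}c&1\\1&c\end{bmatrix}$ and $A_*=\begin{bmatrix}2\mathcal N'(r_*^2)u_*v_*&\mathcal N(r_*^2)+2\mathcal N'(r_*^2)v_*^2\\-\mathcal N(r_*^2)-2\mathcal N'(r_*^2)u_*^2&-2\mathcal N'(r_*^2)u_*v_*\end{bmatrix}$, we have $L_*=\Sigma\partial_x+A_*$ and $L_{*,w}=e^{w}L_*e^{-w}$ with domain $H^1$. $\sigma_{\rm d}$ denotes the discrete spectrum (isolated eigenvalues of finite multiplicity). *)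

theory Defs
  imports "HOL-Analysis.Analysis"
begin

text \<open>C^2-valued functions on the real line, represented as pairs of component functions.\<close>
type_synonym cfun2 = "(real \<Rightarrow> complex) \<times> (real \<Rightarrow> complex)"

text \<open>Square integrability (membership in L^2(R;C)).\<close>
definition L2 :: "(real \<Rightarrow> complex) \<Rightarrow> bool" where
  "L2 f \<longleftrightarrow> f \<in> borel_measurable lborel \<and> integrable lborel (\<lambda>x. (cmod (f x))\<^sup>2)"

text \<open>H^1 function f (continuous representative) with (weak) derivative g in L^2.\<close>
definition weak_deriv :: "(real \<Rightarrow> complex) \<Rightarrow> (real \<Rightarrow> complex) \<Rightarrow> bool" where
  "weak_deriv f g \<longleftrightarrow> L2 f \<and> L2 g \<and> (\<forall>a b. a \<le> b \<longrightarrow> (g has_integral (f b - f a)) {a..b})"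

definition L2v :: "cfun2 \<Rightarrow> bool" where
  "L2v \<phi> \<longleftrightarrow> L2 (fst \<phi>) \<and> L2 (snd \<phi>)"

definition H1v :: "cfun2 \<Rightarrow> cfun2 \<Rightarrow> bool" where
  "H1v \<phi> g \<longleftrightarrow> weak_deriv (fst \<phi>) (fst g) \<and> weak_deriv (snd \<phi>) (snd g)"

text \<open>Equality almost everywhere (equality in L^2).\<close>
definition ae2 :: "cfun2 \<Rightarrow> cfun2 \<Rightarrow> bool" where
  "ae2 \<phi> \<psi> \<longleftrightarrow> (AE x in lborel. fst \<phi> x = fst \<psi> x \<and> snd \<phi> x = snd \<psi> x)"

definition zero2 :: cfun2 where "zero2 = ((\<lambda>x. 0), (\<lambda>x. 0))"

definition norm2 :: "cfun2 \<Rightarrow> real" where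
  "norm2 \<phi> = sqrt (\<integral>x. (cmod (fst \<phi> x))\<^sup>2 + (cmod (snd \<phi> x))\<^sup>2 \<partial>lborel)"

definition scale2 :: "complex \<Rightarrow> cfun2 \<Rightarrow> cfun2" where
  "scale2 a \<phi> = ((\<lambda>x. a * fst \<phi> x), (\<lambda>x. a * snd \<phi> x))"

definition comb2 :: "(cfun2 \<Rightarrow> complex) \<Rightarrow> cfun2 set \<Rightarrow> cfun2" where
  "comb2 a B = ((\<lambda>x. \<Sum>b\<in>B. a b * fst b x), (\<lambda>x. \<Sum>b\<in>B. a b * snd b x))"

text \<open>An operator on the domain H^1 is given by its action on a pair (phi, phi'),
  phi' being the weak derivative of phi.  Op - z:\<close>
definition shift2 :: "(cfun2 \<Rightarrow> cfun2 \<Rightarrow> cfun2) \<Rightarrow> complex \<Rightarrow> cfun2 \<Rightarrow> cfun2 \<Rightarrow> cfun2" where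
  "shift2 Op z \<phi> g = ((\<lambda>x. fst (Op \<phi> g) x - z * fst \<phi> x), (\<lambda>x. snd (Op \<phi> g) x - z * snd \<phi> x))"

text \<open>Resolvent set of an operator with domain H^1 in L^2(R;C^2): Op - z is onto L^2
  and has a bounded inverse.\<close>
definition resolvent_set :: "(cfun2 \<Rightarrow> cfun2 \<Rightarrow> cfun2) \<Rightarrow> complex set" where
  "resolvent_set Op = {z.
     (\<forall>f. L2v f \<longrightarrow> (\<exists>\<phi> g. H1v \<phi> g \<and> ae2 (shift2 Op z \<phi> g) f)) \<and>
     (\<exists>C. \<forall>\<phi> g. H1v \<phi> g \<longrightarrow> norm2 \<phi> \<le> C * norm2 (shift2 Op z \<phi> g))}"

definition spectrum_op :: "(cfun2 \<Rightarrow> cfun2 \<Rightarrow> cfun2) \<Rightarrow> complex set" where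
  "spectrum_op Op = UNIV - resolvent_set Op"

text \<open>gen_eig Op z k phi: phi lies (up to a.e. equality) in ker (Op - z)^k.\<close>
fun gen_eig :: "(cfun2 \<Rightarrow> cfun2 \<Rightarrow> cfun2) \<Rightarrow> complex \<Rightarrow> nat \<Rightarrow> cfun2 \<Rightarrow> bool" where
  "gen_eig Op z 0 \<phi> = ae2 \<phi> zero2"
| "gen_eig Op z (Suc k) \<phi> = (\<exists>\<psi> g. H1v \<psi> g \<and> ae2 \<psi> \<phi> \<and> gen_eig Op z k (shift2 Op z \<psi> g))"

text \<open>Eigenvectors (kernel of Op - z).\<close>
definition eigvec :: "(cfun2 \<Rightarrow> cfun2 \<Rightarrow> cfun2) \<Rightarrow> complex \<Rightarrow> cfun2 \<Rightarrow> bool" where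
  "eigvec Op z \<phi> \<longleftrightarrow> gen_eig Op z 1 \<phi>"

text \<open>Discrete spectrum: isolated eigenvalues of finite (algebraic) multiplicity.\<close>
definition disc_spectrum :: "(cfun2 \<Rightarrow> cfun2 \<Rightarrow> cfun2) \<Rightarrow> complex set" where
  "disc_spectrum Op = {z \<in> spectrum_op Op.
     \<not> z islimpt spectrum_op Op \<and>
     (\<exists>\<phi>. eigvec Op z \<phi> \<and> \<not> ae2 \<phi> zero2) \<and>
     (\<exists>B. finite B \<and> (\<forall>\<phi>. (\<exists>k. gen_eig Op z k \<phi>) \<longrightarrow> (\<exists>a. ae2 \<phi> (comb2 a B))))}"

text \<open>Linearization A_* about the profile (u,v); N1 is N'.\<close>
definition A11 :: "(real \<Rightarrow> real) \<Rightarrow> (real \<Rightarrow> real) \<Rightarrow> (real \<Rightarrow> real) \<Rightarrow> (real \<Rightarrow> real) \<Rightarrow> real \<Rightarrow> real" where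
  "A11 N N1 u v x = 2 * N1 ((u x)\<^sup>2 + (v x)\<^sup>2) * u x * v x"
definition A12 :: "(real \<Rightarrow> real) \<Rightarrow> (real \<Rightarrow> real) \<Rightarrow> (real \<Rightarrow> real) \<Rightarrow> (real \<Rightarrow> real) \<Rightarrow> real \<Rightarrow> real" where
  "A12 N N1 u v x = N ((u x)\<^sup>2 + (v x)\<^sup>2) + 2 * N1 ((u x)\<^sup>2 + (v x)\<^sup>2) * (v x)\<^sup>2"
definition A21 :: "(real \<Rightarrow> real) \<Rightarrow> (real \<Rightarrow> real) \<Rightarrow> (real \<Rightarrow> real) \<Rightarrow> (real \<Rightarrow> real) \<Rightarrow> real \<Rightarrow> real" where
  "A21 N N1 u v x = - N ((u x)\<^sup>2 + (v x)\<^sup>2) - 2 * N1 ((u x)\<^sup>2 + (v x)\<^sup>2) * (u x)\<^sup>2"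
definition A22 :: "(real \<Rightarrow> real) \<Rightarrow> (real \<Rightarrow> real) \<Rightarrow> (real \<Rightarrow> real) \<Rightarrow> (real \<Rightarrow> real) \<Rightarrow> real \<Rightarrow> real" where
  "A22 N N1 u v x = - 2 * N1 ((u x)\<^sup>2 + (v x)\<^sup>2) * u x * v x"

text \<open>Weighted operator L_{*,w} = Sigma (d/dx - w'(x)) + A_*(x), acting on (phi, phi');
  w1 is w'.\<close>
definition Lw :: "real \<Rightarrow> (real \<Rightarrow> real) \<Rightarrow> (real \<Rightarrow> real) \<Rightarrow> (real \<Rightarrow> real) \<Rightarrow> (real \<Rightarrow> real)
     \<Rightarrow> (real \<Rightarrow> real) \<Rightarrow> cfun2 \<Rightarrow> cfun2 \<Rightarrow> cfun2" where
  "Lw c N N1 u v w1 \<phi> g =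
    ((\<lambda>x. complex_of_real c * (fst g x - complex_of_real (w1 x) * fst \<phi> x)
          + (snd g x - complex_of_real (w1 x) * snd \<phi> x)
          + complex_of_real (A11 N N1 u v x) * fst \<phi> x + complex_of_real (A12 N N1 u v x) * snd \<phi> x),
     (\<lambda>x. (fst g x - complex_of_real (w1 x) * fst \<phi> x)
          + complex_of_real c * (snd g x - complex_of_real (w1 x) * snd \<phi> x)
          + complex_of_real (A21 N N1 u v x) * fst \<phi> x + complex_of_real (A22 N N1 u v x) * snd \<phi> x))"

end

theory Submission
  imports Defs
begin

text \<open>
  Write \<open>r\<^sup>2 = u\<^sup>2 + v\<^sup>2\<close>, \<open>n = N(r\<^sup>2)\<close>, \<open>m = - N'(r\<^sup>2) r\<^sup>2\<close>, \<open>h = n - m\<close>, \<open>s = sqrt (1 - c\<^sup>2)\<close> and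
  \<open>\<kappa> = (1 - c) / s\<close>. The weight \<open>e\<^sup>w sqrt n\<close> is bounded above and below, so one may pass to
  characteristic variables \<open>p, q\<close> with \<open>\<phi> = e\<^sup>w sqrt n (p + q, p - q)\<close>, in which the operator becomes
  \<open>M(p, q) = ((1 + c) p' - (c m / \<kappa>) p - (h - c m) q, - (1 - c) q' + (h + c m) p - \<kappa> c m q)\<close>.
  It is dissipative: \<open>Re \<langle>M(p, q), (p, q)\<rangle> = - \<integral> (c m / \<kappa>) |p - \<kappa> q|\<^sup>2\<close>. At \<open>z = 0\<close> the system is
  triangular in \<open>D = p / \<kappa> - q\<close> and \<open>P = p / \<kappa>\<close>, namely \<open>s D' + h D = F\<close> and \<open>s P' - h P = G\<close>, and is solved
  explicitly with \<open>E = r sqrt n\<close>, \<open>s E' = h E\<close>. Hence the kernel and the cokernel of \<open>M\<close> are both spanned by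
  \<open>(\<kappa> E, E)\<close>, the translation mode, and \<open>M\<close> is invertible on its orthogonal complement. A Neumann series
  there yields the resolvent in a punctured neighbourhood of \<open>0\<close>; since dissipativity gives the bound \<open>1 / z\<close>
  on the resolvent at \<open>z > 0\<close>, Neumann series around positive reals then exhaust the right half plane.
  A generalized eigenvector would put a multiple of \<open>(\<kappa> E, E)\<close> in the range, which is orthogonal to it.
\<close>

section \<open>Square-integrable functions\<close>

text \<open>The factor sqrt n is forced. For a scalar weight with drift \<omega> the symmetric part
  of A - \<omega> \<Sigma> has determinant -(s \<omega> - m)^2, so it is semidefinite exactly for
  \<omega> = m / s, the drift of 1 / sqrt n; it then has rank one and trace -2 c m / s. For c = 0 it
  vanishes, so there is no damping to rely on. Dissipativity bounds inverses but produces no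
  solutions: a first point of the resolvent set has to be constructed, and the explicit solution at
  z = 0 provides it. What isolates 0 is the change of sign of h, from 1 at the left end to -K at the
  right: E decays at both ends and 1 / E grows at both, so each scalar equation is either always
  solvable or solvable under one linear condition. Concavity enters as N(\<sigma>) \<ge> 1 -
  \<sigma>, that is, 1 - r^2 \<le> n. It bounds the two tail integrals of E^2 by multiples of the
  two factors r^2 and n of E^2, and it bounds K - m by a multiple of n = s (ln r)', whence the
  bounds on the weight.\<close>

definition l2 :: "(real \<Rightarrow> 'a::euclidean_space) \<Rightarrow> bool" where
  "l2 f \<longleftrightarrow> f \<in> borel_measurable borel \<and> integrable lborel (\<lambda>x. (norm (f x))\<^sup>2)"

definition l2norm :: "(real \<Rightarrow> 'a::euclidean_space) \<Rightarrow> real" where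
  "l2norm f = sqrt (\<integral>x. (norm (f x))\<^sup>2 \<partial>lborel)"

lemma l2D: assumes "l2 f" shows "f \<in> borel_measurable borel" "integrable lborel (\<lambda>x. (norm (f x))\<^sup>2)"
  using assms by (auto simp: l2_def)

lemma l2norm_nonneg [simp]: "0 \<le> l2norm f"
  by (simp add: l2norm_def)

lemma l2norm_power2: "(l2norm f)\<^sup>2 = (\<integral>x. (norm (f x))\<^sup>2 \<partial>lborel)"
  by (simp add: l2norm_def)

lemma l2_bound:
  fixes f :: "real \<Rightarrow> 'a::euclidean_space" and g :: "real \<Rightarrow> 'b::euclidean_space"
  assumes f: "l2 f" and g[measurable]: "g \<in> borel_measurable borel"
    and le: "AE x in lborel. norm (g x) \<le> C * norm (f x)" and C: "0 \<le> C"
  shows "l2 g" "l2norm g \<le> C * l2norm f"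
proof -
  have le2: "AE x in lborel. (norm (g x))\<^sup>2 \<le> C\<^sup>2 * (norm (f x))\<^sup>2"
    using le
  proof eventually_elim
    case (elim x)
    have "(norm (g x))\<^sup>2 \<le> (C * norm (f x))\<^sup>2" by (rule power_mono[OF elim]) simp
    then show ?case by (simp add: power_mult_distrib)
  qed
  have i: "integrable lborel (\<lambda>x. C\<^sup>2 * (norm (f x))\<^sup>2)" using l2D(2)[OF f] by simp
  show "l2 g" unfolding l2_def
  proof (intro conjI g)
    show "integrable lborel (\<lambda>x. (norm (g x))\<^sup>2)"
      by (rule Bochner_Integration.integrable_bound[OF i]) (use le2 in auto)
  qed
  then have "(\<integral>x. (norm (g x))\<^sup>2 \<partial>lborel) \<le> (\<integral>x. C\<^sup>2 * (norm (f x))\<^sup>2 \<partial>lborel)"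
    by (intro integral_mono_AE i le2 l2D)
  then have "(l2norm g)\<^sup>2 \<le> (C * l2norm f)\<^sup>2"
    by (simp add: l2norm_power2 power_mult_distrib)
  then show "l2norm g \<le> C * l2norm f"
    by (rule power2_le_imp_le) (simp add: C)
qed

lemma l2_norm_cong:
  assumes "l2 f" "g \<in> borel_measurable borel" "AE x in lborel. norm (g x) = norm (f x)"
  shows "l2 g" "l2norm g = l2norm f"
proof -
  have a: "AE x in lborel. norm (g x) \<le> 1 * norm (f x)" "AE x in lborel. norm (f x) \<le> 1 * norm (g x)"
    using assms(3) by (eventually_elim; simp)+
  show g: "l2 g" using l2_bound[OF assms(1,2) a(1)] by simp
  show "l2norm g = l2norm f"
    using l2_bound(2)[OF assms(1,2) a(1)] l2_bound(2)[OF g l2D(1)[OF assms(1)] a(2)] by simp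
qed

lemma l2norm_cong_AE:
  assumes "l2 f" "g \<in> borel_measurable borel" "AE x in lborel. f x = g x"
  shows "l2norm f = l2norm g"
proof -
  have "AE x in lborel. norm (g x) = norm (f x)" using assms(3) by eventually_elim simp
  then show ?thesis by (rule l2_norm_cong(2)[OF assms(1,2), symmetric])
qed

lemma l2_plus: assumes f: "l2 f" and g: "l2 g" shows "l2 (\<lambda>x. f x + g x)"
  unfolding l2_def
proof
  note [measurable] = l2D(1)[OF f] l2D(1)[OF g]
  show "(\<lambda>x. f x + g x) \<in> borel_measurable borel" by measurable
  have i: "integrable lborel (\<lambda>x. 2 * (norm (f x))\<^sup>2 + 2 * (norm (g x))\<^sup>2)"
    using l2D(2)[OF f] l2D(2)[OF g] by auto
  have "(norm (f x + g x))\<^sup>2 \<le> 2 * (norm (f x))\<^sup>2 + 2 * (norm (g x))\<^sup>2" for x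
  proof -
    have "(norm (f x + g x))\<^sup>2 \<le> (norm (f x) + norm (g x))\<^sup>2"
      by (intro power_mono norm_triangle_ineq) simp
    also have "\<dots> \<le> 2 * (norm (f x))\<^sup>2 + 2 * (norm (g x))\<^sup>2"
      using zero_le_power2[of "norm (f x) - norm (g x)"] by (simp add: power2_diff power2_sum)
    finally show ?thesis .
  qed
  then show "integrable lborel (\<lambda>x. (norm (f x + g x))\<^sup>2)"
    by (intro Bochner_Integration.integrable_bound[OF i]) (auto intro!: AE_I2)
qed

lemma l2_linear:
  assumes T: "bounded_linear T" and f: "l2 f" shows "l2 (\<lambda>x. T (f x))"
proof -
  obtain K where K: "0 \<le> K" "\<And>x. norm (T x) \<le> K * norm x"
    using bounded_linear.nonneg_bounded[OF T] by (metis mult.commute)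
  have "(\<lambda>x. T (f x)) \<in> borel_measurable borel"
    by (rule measurable_compose[OF l2D(1)[OF f] borel_measurable_continuous_onI[OF linear_continuous_on[OF T]]])
  then show ?thesis by (rule l2_bound(1)[OF f _ _ K(1)]) (rule AE_I2, rule K(2))
qed

lemma l2_minus: "l2 f \<Longrightarrow> l2 (\<lambda>x. - f x)"
  by (simp add: l2_def)

lemma l2_diff: "l2 f \<Longrightarrow> l2 g \<Longrightarrow> l2 (\<lambda>x. f x - g x)"
  using l2_plus[of f "\<lambda>x. - g x"] l2_minus[of g] by simp

text \<open>Cauchy-Schwarz for any function dominated by a product of norms, so that inner products,
  scalar multiples and products with truncated functions are all instances. The inequality 2 a b
  \<le> t a^2 + b^2 / t is integrated and t optimized.\<close>

lemma l2_mult_integrable: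
  fixes h :: "real \<Rightarrow> 'c::{banach,second_countable_topology}"
  assumes f: "l2 f" and g: "l2 g" and h[measurable]: "h \<in> borel_measurable borel"
    and le: "\<And>x. norm (h x) \<le> K * (norm (f x) * norm (g x))" and K: "0 \<le> K"
  shows "integrable lborel h" "norm (\<integral>x. h x \<partial>lborel) \<le> K * (l2norm f * l2norm g)"
proof -
  note iF = l2D(2)[OF f] and iG = l2D(2)[OF g]
  have amgm: "norm (h x) \<le> K * (t * (norm (f x))\<^sup>2 + (norm (g x))\<^sup>2 / t) / 2" if "t > 0" for x t
  proof -
    have "0 \<le> (t * norm (f x) - norm (g x))\<^sup>2 / t" using that by simp
    also have "\<dots> = t * (norm (f x))\<^sup>2 + (norm (g x))\<^sup>2 / t - 2 * (norm (f x) * norm (g x))"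
      using that by (simp add: field_simps power2_eq_square)
    finally have "K * (norm (f x) * norm (g x)) \<le> K * ((t * (norm (f x))\<^sup>2 + (norm (g x))\<^sup>2 / t) / 2)"
      by (intro mult_left_mono K) simp
    with le[of x] show ?thesis by simp
  qed
  have iB: "integrable lborel (\<lambda>x. K * (t * (norm (f x))\<^sup>2 + (norm (g x))\<^sup>2 / t) / 2)" for t
    using iF iG by auto
  show ih: "integrable lborel h"
    by (rule Bochner_Integration.integrable_bound[OF iB[of 1]])
       (use amgm[of 1] in \<open>auto intro: order_trans[OF _ abs_ge_self]\<close>)
  define a b where "a = l2norm f" and "b = l2norm g"
  have *: "norm (\<integral>x. h x \<partial>lborel) \<le> K * (t * a\<^sup>2 + b\<^sup>2 / t) / 2" if "t > 0" for t
  proof -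
    have "norm (\<integral>x. h x \<partial>lborel) \<le> (\<integral>x. K * (t * (norm (f x))\<^sup>2 + (norm (g x))\<^sup>2 / t) / 2 \<partial>lborel)"
      by (rule Bochner_Integration.integral_norm_bound_integral[OF ih iB]) (use amgm[OF that] in auto)
    also have "\<dots> = K * (t * a\<^sup>2 + b\<^sup>2 / t) / 2"
      unfolding a_def b_def l2norm_power2 using iF iG by simp
    finally show ?thesis .
  qed
  have ab: "0 \<le> a" "0 \<le> b" by (auto simp: a_def b_def)
  \<comment> \<open>The optimal weight is t = b / a; the shift by \<open>e\<close> keeps it positive
    and finite when a norm vanishes, and is removed by a limit.\<close>
  have key: "norm (\<integral>x. h x \<partial>lborel) \<le> K * ((a + e) * (b + e))" if "e > 0" for e
  proof -
    have p: "a + e > 0" "b + e > 0" using ab that by auto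
    have "norm (\<integral>x. h x \<partial>lborel) \<le> K * ((b + e) / (a + e) * a\<^sup>2 + b\<^sup>2 / ((b + e) / (a + e))) / 2"
      by (rule *) (use p in simp)
    also have "\<dots> \<le> K * ((b + e) / (a + e) * (a + e)\<^sup>2 + (b + e)\<^sup>2 / ((b + e) / (a + e))) / 2"
      using p ab that K by (intro divide_right_mono mult_left_mono add_mono power_mono) auto
    also have "\<dots> = K * ((a + e) * (b + e))"
    proof -
      have "v / u * u\<^sup>2 + v\<^sup>2 / (v / u) = 2 * (u * v)" if "u > 0" "v > 0" for u v :: real
        using that by (simp add: field_simps power2_eq_square)
      from this[OF p] show ?thesis by simp
    qed
    finally show ?thesis .
  qed
  have "((\<lambda>e. K * ((a + e) * (b + e))) \<longlongrightarrow> K * ((a + 0) * (b + 0))) (at_right 0)"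
    by (intro tendsto_intros)
  then have "norm (\<integral>x. h x \<partial>lborel) \<le> K * ((a + 0) * (b + 0))"
    by (rule tendsto_lowerbound) (auto intro!: eventually_at_rightI[of 0 1] key)
  then show "norm (\<integral>x. h x \<partial>lborel) \<le> K * (l2norm f * l2norm g)"
    by (simp add: a_def b_def)
qed

lemma l2_inner_integrable:
  assumes "l2 f" "l2 g"
  shows "integrable lborel (\<lambda>x. f x \<bullet> g x)" "\<bar>\<integral>x. f x \<bullet> g x \<partial>lborel\<bar> \<le> l2norm f * l2norm g"
proof -
  note [measurable] = l2D(1)[OF assms(1)] l2D(1)[OF assms(2)]
  note L = l2_mult_integrable[OF assms, of "\<lambda>x. f x \<bullet> g x" 1]
  show "integrable lborel (\<lambda>x. f x \<bullet> g x)" by (rule L(1)) (auto simp: Cauchy_Schwarz_ineq2)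
  show "\<bar>\<integral>x. f x \<bullet> g x \<partial>lborel\<bar> \<le> l2norm f * l2norm g"
    using L(2) by (auto simp: Cauchy_Schwarz_ineq2)
qed

lemma l2norm_triangle:
  assumes f: "l2 f" and g: "l2 g"
  shows "l2norm (\<lambda>x. f x + g x) \<le> l2norm f + l2norm g"
proof (rule power2_le_imp_le)
  have "(l2norm (\<lambda>x. f x + g x))\<^sup>2 = (\<integral>x. (norm (f x))\<^sup>2 + (norm (g x))\<^sup>2 + 2 * (f x \<bullet> g x) \<partial>lborel)"
    unfolding l2norm_power2 by (rule Bochner_Integration.integral_cong) (auto simp: power2_norm_eq_inner inner_simps inner_commute)
  also have "\<dots> = (l2norm f)\<^sup>2 + (l2norm g)\<^sup>2 + 2 * (\<integral>x. f x \<bullet> g x \<partial>lborel)"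
    unfolding l2norm_power2 using l2D(2)[OF f] l2D(2)[OF g] l2_inner_integrable(1)[OF f g] by simp
  also have "\<dots> \<le> (l2norm f + l2norm g)\<^sup>2"
    using l2_inner_integrable(2)[OF f g] by (simp add: power2_sum)
  finally show "(l2norm (\<lambda>x. f x + g x))\<^sup>2 \<le> (l2norm f + l2norm g)\<^sup>2" .
qed simp

lemma l2norm_minus: "l2norm (\<lambda>x. - f x) = l2norm f"
  by (simp add: l2norm_def)

lemma l2norm_triangle_diff:
  assumes f: "l2 f" and g: "l2 g"
  shows "l2norm (\<lambda>x. f x - g x) \<le> l2norm f + l2norm g"
  using l2norm_triangle[OF f l2_minus[OF g]] by (simp add: l2norm_minus)

lemma l2norm_eq_0_iff:
  assumes "l2 f" shows "l2norm f = 0 \<longleftrightarrow> (AE x in lborel. f x = 0)"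
  using integral_nonneg_eq_0_iff_AE[OF l2D(2)[OF assms]] by (simp add: l2norm_def)

text \<open>Fatou's lemma: a uniform L^2 bound survives pointwise limits. It turns bounds on
  truncations into global ones and puts the limit of the Neumann iterates into L^2.\<close>

lemma l2_Fatou:
  fixes f :: "nat \<Rightarrow> real \<Rightarrow> 'a::euclidean_space"
  assumes f: "\<And>k. l2 (f k)" and C: "\<And>k. l2norm (f k) \<le> C"
    and lim: "\<And>x. (\<lambda>k. f k x) \<longlonglongrightarrow> F x"
  shows "l2 F" "l2norm F \<le> C"
proof -
  have C0: "0 \<le> C" using C[of 0] l2norm_nonneg[of "f 0"] by linarith
  have [measurable]: "f k \<in> borel_measurable borel" for k using l2D(1)[OF f] .
  have F[measurable]: "F \<in> borel_measurable borel"
    by (rule borel_measurable_LIMSEQ_metric[of f]) (use lim in auto)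
  have eq: "(\<integral>\<^sup>+x. ennreal ((norm (f k x))\<^sup>2) \<partial>lborel) = ennreal ((l2norm (f k))\<^sup>2)" for k
    unfolding l2norm_power2 by (rule nn_integral_eq_integral[OF l2D(2)[OF f]]) auto
  have "(\<integral>\<^sup>+x. ennreal ((norm (F x))\<^sup>2) \<partial>lborel) = (\<integral>\<^sup>+x. liminf (\<lambda>k. ennreal ((norm (f k x))\<^sup>2)) \<partial>lborel)"
  proof (rule nn_integral_cong)
    fix x
    have "(\<lambda>k. ennreal ((norm (f k x))\<^sup>2)) \<longlonglongrightarrow> ennreal ((norm (F x))\<^sup>2)"
      by (intro tendsto_ennrealI tendsto_intros lim)
    then show "ennreal ((norm (F x))\<^sup>2) = liminf (\<lambda>k. ennreal ((norm (f k x))\<^sup>2))"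
      by (intro lim_imp_Liminf[symmetric]) auto
  qed
  also have "\<dots> \<le> liminf (\<lambda>k. \<integral>\<^sup>+x. ennreal ((norm (f k x))\<^sup>2) \<partial>lborel)"
    by (rule nn_integral_liminf) measurable
  also have "\<dots> \<le> liminf (\<lambda>k. ennreal (C\<^sup>2))"
    unfolding eq using C by (intro Liminf_mono always_eventually allI ennreal_leI power_mono) auto
  also have "\<dots> = ennreal (C\<^sup>2)" by (simp add: Liminf_const)
  finally have le: "(\<integral>\<^sup>+x. ennreal ((norm (F x))\<^sup>2) \<partial>lborel) \<le> ennreal (C\<^sup>2)" .
  have "integrable lborel (\<lambda>x. (norm (F x))\<^sup>2)"
    by (rule integrableI_bounded) (use le in \<open>auto simp: le_less_trans[OF le]\<close>)
  then show l: "l2 F" by (simp add: l2_def)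
  have "ennreal ((l2norm F)\<^sup>2) \<le> ennreal (C\<^sup>2)"
    unfolding l2norm_power2 using le nn_integral_eq_integral[OF l2D(2)[OF l]] by simp
  then show "l2norm F \<le> C" using C0 by (auto simp: ennreal_le_iff intro: power2_le_imp_le)
qed

lemma l2_indicator_Icc: 
  shows "l2 (\<lambda>x. indicator {a..b} x :: real)" "a \<le> b \<Longrightarrow> l2norm (\<lambda>x. indicator {a..b} x :: real) = sqrt (b - a)"
proof -
  have *: "(\<lambda>x. (norm (indicator {a..b} x :: real))\<^sup>2) = indicator {a..b}" by (auto simp: indicator_def)
  show "l2 (\<lambda>x. indicator {a..b} x :: real)" unfolding l2_def * by (auto intro!: integrable_real_indicator simp: emeasure_lborel_Icc_eq)
  show "a \<le> b \<Longrightarrow> l2norm (\<lambda>x. indicator {a..b} x :: real) = sqrt (b - a)" unfolding l2norm_def * by simp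
qed

lemma l2_set_integrable:
  assumes f: "l2 f" shows "set_integrable lborel {a..b} f" "set_integrable lborel {a..b} (\<lambda>x. norm (f x))"
proof -
  note [measurable] = l2D(1)[OF f]
  show "set_integrable lborel {a..b} f" unfolding set_integrable_def
    by (rule l2_mult_integrable(1)[OF f l2_indicator_Icc(1)[of a b], of _ 1]) (auto simp: indicator_def)
  then show "set_integrable lborel {a..b} (\<lambda>x. norm (f x))" by (rule set_integrable_norm)
qed

lemma l2_set_lebesgue_bound:
  assumes f: "l2 f" and "a \<le> b" shows "(LINT x:{a..b}|lborel. norm (f x)) \<le> sqrt (b - a) * l2norm f"
proof -
  note [measurable] = l2D(1)[OF f]
  have "norm (LINT x:{a..b}|lborel. norm (f x)) \<le> 1 * (l2norm f * l2norm (\<lambda>x. indicator {a..b} x :: real))"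
    unfolding set_lebesgue_integral_def
    by (rule l2_mult_integrable(2)[OF f l2_indicator_Icc(1)[of a b], of _ 1]) (auto simp: indicator_def)
  then show ?thesis using assms(2) l2_indicator_Icc(2)[of a b] by (simp add: mult.commute)
qed

lemma l2I_exhaust:
  fixes f :: "real \<Rightarrow> 'a::euclidean_space"
  assumes f[measurable]: "f \<in> borel_measurable borel"
    and i: "\<And>n::nat. set_integrable lborel {- real n..real n} (\<lambda>x. (norm (f x))\<^sup>2)"
    and C: "\<And>n::nat. (LINT x:{- real n..real n}|lborel. (norm (f x))\<^sup>2) \<le> C\<^sup>2" and C0: "0 \<le> C"
  shows "l2 f" "l2norm f \<le> C"
proof -
  let ?g = "\<lambda>n::nat. \<lambda>x. indicator {- real n..real n} x *\<^sub>R f x"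
  have e: "(\<lambda>x. (norm (?g n x))\<^sup>2) = (\<lambda>x. indicator {- real n..real n} x *\<^sub>R (norm (f x))\<^sup>2)" for n
    by (auto simp: indicator_def fun_eq_iff)
  have 1: "l2 (?g n)" for n
    using i[of n] unfolding l2_def e set_integrable_def by simp
  have "(l2norm (?g n))\<^sup>2 \<le> C\<^sup>2" for n
    unfolding l2norm_power2 e using C[of n] by (simp add: set_lebesgue_integral_def)
  then have 2: "l2norm (?g n) \<le> C" for n using C0 by (auto intro: power2_le_imp_le)
  have 3: "(\<lambda>n. ?g n x) \<longlonglongrightarrow> f x" for x
  proof (rule tendsto_eventually)
    obtain N :: nat where "\<bar>x\<bar> \<le> real N" using real_arch_simple by blast
    then show "\<forall>\<^sub>F n in sequentially. ?g n x = f x"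
      by (intro eventually_sequentiallyI[of N]) (auto simp: indicator_def)
  qed
  show "l2 f" "l2norm f \<le> C" using l2_Fatou[OF 1 2 3] by auto
qed

section \<open>Absolutely continuous functions\<close>

text \<open>Absolute continuity in the form of the fundamental theorem of calculus. The derivative
  \<open>g\<close> is a locally integrable representative and may be altered on null sets.\<close>

definition ac :: "(real \<Rightarrow> 'a::euclidean_space) \<Rightarrow> (real \<Rightarrow> 'a) \<Rightarrow> bool" where
  "ac f g \<longleftrightarrow> (\<forall>a b. set_integrable lborel {a..b} g) \<and> (\<forall>a b. a \<le> b \<longrightarrow> (LINT x:{a..b}|lborel. g x) = f b - f a)"

lemma acD:
  assumes "ac f g"
  shows "set_integrable lborel {a..b} g" "a \<le> b \<Longrightarrow> (LINT x:{a..b}|lborel. g x) = f b - f a"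
  using assms by (auto simp: ac_def)

lemma ac_continuous:
  assumes "ac f g" shows "continuous_on UNIV f"
proof -
  have "continuous_on {a..b} f" if "a \<le> b" for a b
  proof -
    note i = set_borel_integral_eq_integral[OF acD(1)[OF assms]]
    have "f x = integral {a..x} g + f a" if "x \<in> {a..b}" for x
      using acD(2)[OF assms, of a x] i(2)[of a x] that by simp
    moreover have "continuous_on {a..b} (\<lambda>x. integral {a..x} g + f a)"
      by (intro continuous_intros indefinite_integral_continuous_1 i)
    ultimately show ?thesis using continuous_on_cong[OF refl, of "{a..b}" f "\<lambda>x. integral {a..x} g + f a"] by blast
  qed
  then have "continuous_on {x - 1..x + 1} f" for x by simp
  then have "isCont f x" for x
    by (rule continuous_on_interior[of "{x - 1..x + 1}"]) auto
  then show ?thesis by (simp add: continuous_at_imp_continuous_on)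
qed

lemma ac_cong_AE:
  assumes "ac f g" "AE x in lborel. g x = g' x" "g' \<in> borel_measurable borel"
  shows "ac f g'"
proof -
  note [measurable] = assms(3)
  have ae: "AE x in lborel. indicator {a..b} x *\<^sub>R g x = indicator {a..b} x *\<^sub>R g' x" for a b
    using assms(2) by auto
  note i = acD(1)[OF assms(1), unfolded set_integrable_def]
  have "set_integrable lborel {a..b} g'" for a b
    unfolding set_integrable_def by (rule integrable_cong_AE_imp[OF i _ ae]) measurable
  moreover have "(LINT x:{a..b}|lborel. g' x) = (LINT x:{a..b}|lborel. g x)" for a b
    unfolding set_lebesgue_integral_def
  proof (rule integral_cong_AE)
    show "AE x in lborel. indicator {a..b} x *\<^sub>R g' x = indicator {a..b} x *\<^sub>R g x"
      using ae[of a b] by eventually_elim (rule sym)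
  qed (use i in auto)
  ultimately show ?thesis using assms(1) by (simp add: ac_def)
qed

lemma ac_zero_imp_const: "ac f (\<lambda>x. 0) \<Longrightarrow> f x = f y"
  by (metis acD(2) set_lebesgue_integral_zero linear right_minus_eq)

lemma ac_add: "ac f f' \<Longrightarrow> ac g g' \<Longrightarrow> ac (\<lambda>x. f x + g x) (\<lambda>x. f' x + g' x)"
  by (auto simp: ac_def set_integral_add)

lemma ac_linear:
  assumes T: "bounded_linear T" and "ac f g" shows "ac (\<lambda>x. T (f x)) (\<lambda>x. T (g x))"
proof -
  interpret bounded_linear T by fact
  have e: "indicator A x *\<^sub>R T y = T (indicator A x *\<^sub>R y)" for A x y
    by (simp add: scaleR)
  show ?thesis using assms(2) unfolding ac_def set_integrable_def set_lebesgue_integral_def e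
    by (auto simp: integral_bounded_linear[OF T] diff intro: integrable_bounded_linear[OF T])
qed

lemma ac_diff: "ac f f' \<Longrightarrow> ac g g' \<Longrightarrow> ac (\<lambda>x. f x - g x) (\<lambda>x. f' x - g' x)"
  by (auto simp: ac_def set_integral_diff)

lemma ac_C1:
  assumes "\<And>x. (f has_vector_derivative g x) (at x)" and "continuous_on UNIV g"
  shows "ac f g"
  unfolding ac_def
proof safe
  have c: "continuous_on {a..b} g" for a b using assms(2) continuous_on_subset by blast
  show "set_integrable lborel {a..b} g" for a b by (rule borel_integrable_atLeastAtMost'[OF c])
  show "(LINT x:{a..b}|lborel. g x) = f b - f a" if "a \<le> b" for a b
    unfolding set_lebesgue_integral_def
    by (rule integral_FTC_atLeastAtMost[OF that _ c]) (use assms(1) has_vector_derivative_at_within in blast)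
qed

lemma set_integrable_cont_mult:
  fixes f :: "real \<Rightarrow> 'a::euclidean_space" and g :: "real \<Rightarrow> 'b::euclidean_space"
    and B :: "'a \<Rightarrow> 'b \<Rightarrow> 'c::euclidean_space"
  assumes B: "bounded_bilinear B" and f: "continuous_on UNIV f" and g: "set_integrable lborel {a..b} g"
  shows "set_integrable lborel {a..b} (\<lambda>x. B (f x) (g x))"
proof -
  obtain K where K: "0 \<le> K" "\<And>x y. norm (B x y) \<le> norm x * norm y * K"
    using bounded_bilinear.nonneg_bounded[OF B] by blast
  have "compact (f ` {a..b})" by (intro compact_continuous_image continuous_on_subset[OF f]) auto
  then have "bounded (f ` {a..b})" by (rule compact_imp_bounded)
  then obtain L where L: "\<And>x. x \<in> {a..b} \<Longrightarrow> norm (f x) \<le> L" unfolding bounded_iff by blast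
  define L' where "L' = max L 0"
  have L': "L' \<ge> 0" "\<And>x. x \<in> {a..b} \<Longrightarrow> norm (f x) \<le> L'" using L by (auto simp: L'_def le_max_iff_disj)
  have [measurable]: "f \<in> borel_measurable borel" using f by (rule borel_measurable_continuous_onI)
  have gm[measurable]: "(\<lambda>x. indicator {a..b} x *\<^sub>R g x) \<in> borel_measurable lborel"
    using g by (auto simp: set_integrable_def)
  interpret bounded_bilinear B by fact
  have e: "indicator {a..b} x *\<^sub>R B (f x) (g x) = B (f x) (indicator {a..b} x *\<^sub>R g x)" for x
    by (simp add: scaleR_right)
  have cB: "continuous_on UNIV (\<lambda>p. B (fst p) (snd p))"
    by (intro continuous_on continuous_intros)
  have "(\<lambda>x. (\<lambda>p. B (fst p) (snd p)) (f x, indicator {a..b} x *\<^sub>R g x)) \<in> borel_measurable lborel"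
    by (rule measurable_compose[OF _ borel_measurable_continuous_onI[OF cB]])
       (intro borel_measurable_Pair gm; simp)
  then have m: "(\<lambda>x. B (f x) (indicator {a..b} x *\<^sub>R g x)) \<in> borel_measurable lborel" by simp
  have i: "integrable lborel (\<lambda>x. (L' * K) * norm (indicator {a..b} x *\<^sub>R g x))"
    by (intro integrable_mult_right integrable_norm g[unfolded set_integrable_def])
  show ?thesis unfolding set_integrable_def e
  proof (rule Bochner_Integration.integrable_bound[OF i m], rule AE_I2)
    fix x
    show "norm (B (f x) (indicator {a..b} x *\<^sub>R g x)) \<le> norm ((L' * K) * norm (indicator {a..b} x *\<^sub>R g x))"
    proof (cases "x \<in> {a..b}")
      case True
      have "norm (f x) * norm (g x) * K \<le> L' * norm (g x) * K"
        using L' True K by (intro mult_right_mono) auto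
      with K(2)[of "f x" "g x"] True L'(1) K(1) show ?thesis by (simp add: indicator_def abs_mult mult_ac)
    qed (auto simp: indicator_def zero_right)
  qed
qed

lemma set_integral_Icc_split:
  fixes g :: "real \<Rightarrow> 'a::euclidean_space"
  assumes "set_integrable lborel {a..b} g" "a \<le> x" "x \<le> b"
  shows "(LINT t:{a..b}|lborel. g t) = (LINT t:{a..x}|lborel. g t) + (LINT t:{x..b}|lborel. g t)"
proof -
  have i1: "set_integrable lborel {a..x} g" and i2: "set_integrable lborel {x..b} g"
    using assms by (auto intro: set_integrable_subset[OF assms(1)])
  show ?thesis
    unfolding set_borel_integral_eq_integral(2)[OF assms(1)] set_borel_integral_eq_integral(2)[OF i1]
      set_borel_integral_eq_integral(2)[OF i2]
    by (rule Henstock_Kurzweil_Integration.integral_combine[symmetric])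
       (use assms set_borel_integral_eq_integral(1)[OF assms(1)] in auto)
qed

lemma set_integral_le_bound:
  fixes g :: "real \<Rightarrow> 'a::euclidean_space" and k :: "real \<Rightarrow> real"
  assumes "set_integrable lborel {a..b} g" "set_integrable lborel {a..b} k"
    and "\<And>x. x \<in> {a..b} \<Longrightarrow> norm (g x) \<le> k x"
  shows "norm (LINT t:{a..b}|lborel. g t) \<le> (LINT t:{a..b}|lborel. k t)"
  unfolding set_lebesgue_integral_def
  by (rule Bochner_Integration.integral_norm_bound_integral) (use assms in \<open>auto simp: set_integrable_def indicator_def\<close>)

lemma uniformly_small_osc:
  fixes f :: "real \<Rightarrow> 'a::euclidean_space"
  assumes "continuous_on UNIV f" "e > 0"
  obtains d where "d > 0" "\<And>x y. x \<in> {a..b} \<Longrightarrow> y \<in> {a..b} \<Longrightarrow> \<bar>x - y\<bar> < d \<Longrightarrow> norm (f x - f y) < e"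
proof -
  have "uniformly_continuous_on {a..b} f"
    by (intro compact_uniformly_continuous continuous_on_subset[OF assms(1)]) auto
  then obtain d where "d > 0" "\<forall>x\<in>{a..b}. \<forall>x'\<in>{a..b}. dist x' x < d \<longrightarrow> dist (f x') (f x) < e"
    using assms(2) unfolding uniformly_continuous_on_def by meson
  then show ?thesis by (intro that[of d]) (auto simp: dist_norm)
qed

text \<open>Applied to the defect of the product rule, which is locally controlled by the oscillation
  of the factors.\<close>
lemma zero_if_small_increments:
  fixes \<Phi> :: "real \<Rightarrow> 'a::real_normed_vector" and G :: "real \<Rightarrow> real"
  assumes ab: "a \<le> b"
    and small: "\<And>e. e > 0 \<Longrightarrow> \<exists>d>0. \<forall>x y. a \<le> x \<longrightarrow> x \<le> y \<longrightarrow> y \<le> b \<longrightarrow> y - x < d \<longrightarrow>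
                  norm (\<Phi> y - \<Phi> x) \<le> e * (G y - G x)"
  shows "\<Phi> b = \<Phi> a"
proof -
  have le: "norm (\<Phi> b - \<Phi> a) \<le> e * (G b - G a)" if e: "e > 0" for e
  proof -
    obtain d where d: "d > 0" and inc: "\<And>x y. a \<le> x \<Longrightarrow> x \<le> y \<Longrightarrow> y \<le> b \<Longrightarrow> y - x < d \<Longrightarrow>
                  norm (\<Phi> y - \<Phi> x) \<le> e * (G y - G x)"
      using small[OF e] by blast
    obtain n :: nat where n: "(b - a) / d < real n" using reals_Archimedean2 by blast
    define N where "N = Suc n"
    have N: "N > 0" "(b - a) / real N < d"
    proof -
      have "(b - a) < real N * d" using n d by (simp add: N_def field_simps)
      then show "(b - a) / real N < d" by (simp add: N_def field_simps)
    qed (simp add: N_def)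
    define p where "p k = a + real k * ((b - a) / real N)" for k :: nat
    have st: "0 \<le> (b - a) / real N" using ab by simp
    have pN: "p N = b" using N(1) by (simp add: p_def)
    have pmono: "p k \<le> p l" if "k \<le> l" for k l
      unfolding p_def using that st by (intro add_left_mono mult_right_mono) auto
    have "norm (\<Phi> (p k) - \<Phi> a) \<le> e * (G (p k) - G a)" if "k \<le> N" for k
      using that
    proof (induction k)
      case 0
      then show ?case by (simp add: p_def)
    next
      case (Suc k)
      have "p (Suc k) - p k = (b - a) / real N" by (simp add: p_def distrib_right add_divide_distrib)
      then have "norm (\<Phi> (p (Suc k)) - \<Phi> (p k)) \<le> e * (G (p (Suc k)) - G (p k))"
        using N(2) pmono[of 0 k] pmono[of k "Suc k"] pmono[OF Suc.prems] pN
        by (intro inc) (auto simp: p_def)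
      moreover have "norm (\<Phi> (p (Suc k)) - \<Phi> a) \<le> norm (\<Phi> (p (Suc k)) - \<Phi> (p k)) + norm (\<Phi> (p k) - \<Phi> a)"
        using norm_triangle_ineq[of "\<Phi> (p (Suc k)) - \<Phi> (p k)" "\<Phi> (p k) - \<Phi> a"] by simp
      moreover have "norm (\<Phi> (p k) - \<Phi> a) \<le> e * (G (p k) - G a)" using Suc by simp
      ultimately show ?case by (simp add: algebra_simps)
    qed
    from this[of N] pN show ?thesis by simp
  qed
  have "((\<lambda>e. e * (G b - G a)) \<longlongrightarrow> 0 * (G b - G a)) (at_right 0)" by (intro tendsto_intros)
  then have "norm (\<Phi> b - \<Phi> a) \<le> 0 * (G b - G a)"
    by (rule tendsto_lowerbound) (auto intro!: eventually_at_rightI[of 0 1] le)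
  then show ?thesis by simp
qed

text \<open>The factors have derivatives only in the integrated sense, so the Leibniz rule is
  obtained from increments. A general bilinear product covers scalar multiples and inner products at
  once.\<close>

lemma ac_prod:
  fixes f1 :: "real \<Rightarrow> 'a::euclidean_space" and f2 :: "real \<Rightarrow> 'b::euclidean_space"
    and B :: "'a \<Rightarrow> 'b \<Rightarrow> 'c::euclidean_space"
  assumes B: "bounded_bilinear B" and 1: "ac f1 g1" and 2: "ac f2 g2"
  shows "ac (\<lambda>x. B (f1 x) (f2 x)) (\<lambda>x. B (f1 x) (g2 x) + B (g1 x) (f2 x))"
proof -
  interpret bounded_bilinear B by fact
  note c1 = ac_continuous[OF 1] and c2 = ac_continuous[OF 2]
  note i1 = acD(1)[OF 1] and i2 = acD(1)[OF 2]
  have I1: "set_integrable lborel {a..b} (\<lambda>x. B (f1 x) (g2 x))" for a b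
    by (rule set_integrable_cont_mult[OF B c1 i2])
  have I2: "set_integrable lborel {a..b} (\<lambda>x. B (g1 x) (f2 x))" for a b
    by (rule set_integrable_cont_mult[OF bounded_bilinear.flip[OF B] c2 i1])
  have I: "set_integrable lborel {a..b} (\<lambda>x. B (f1 x) (g2 x) + B (g1 x) (f2 x))" for a b
    by (rule set_integral_add(1)[OF I1 I2])
  obtain K where K: "0 \<le> K" "\<And>x y. norm (B x y) \<le> norm x * norm y * K"
    using nonneg_bounded by blast
  have main: "(LINT x:{a..b}|lborel. B (f1 x) (g2 x) + B (g1 x) (f2 x)) = B (f1 b) (f2 b) - B (f1 a) (f2 a)"
    if ab: "a \<le> b" for a b
  proof -
    \<comment> \<open>\<open>\<Phi>\<close> is the defect of the integrated product rule;
      \<open>G\<close>, the integral of the two derivatives' norms up to a constant, is what its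
      increments are measured against.\<close>
    define \<Phi> where "\<Phi> x = B (f1 x) (f2 x) - (LINT t:{a..x}|lborel. B (f1 t) (g2 t) + B (g1 t) (f2 t))" for x
    define G where "G x = (LINT t:{a..x}|lborel. K * (norm (g2 t) + norm (g1 t)))" for x
    have iK: "set_integrable lborel {x..y} (\<lambda>t. K * (norm (g2 t) + norm (g1 t)))" for x y
      by (intro set_integrable_mult_right set_integral_add(1) set_integrable_norm i1 i2)
    have "\<Phi> b = \<Phi> a"
    proof (rule zero_if_small_increments[OF ab, of _ G])
      fix e :: real assume e: "e > 0"
      obtain d1 where d1: "d1 > 0" "\<And>x y. x \<in> {a..b} \<Longrightarrow> y \<in> {a..b} \<Longrightarrow> \<bar>x - y\<bar> < d1 \<Longrightarrow> norm (f1 x - f1 y) < e"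
        using uniformly_small_osc[OF c1 e] by blast
      obtain d2 where d2: "d2 > 0" "\<And>x y. x \<in> {a..b} \<Longrightarrow> y \<in> {a..b} \<Longrightarrow> \<bar>x - y\<bar> < d2 \<Longrightarrow> norm (f2 x - f2 y) < e"
        using uniformly_small_osc[OF c2 e] by blast
      show "\<exists>d>0. \<forall>x y. a \<le> x \<longrightarrow> x \<le> y \<longrightarrow> y \<le> b \<longrightarrow> y - x < d \<longrightarrow> norm (\<Phi> y - \<Phi> x) \<le> e * (G y - G x)"
      proof (intro exI[of _ "min d1 d2"] conjI allI impI)
        fix x y assume xy: "a \<le> x" "x \<le> y" "y \<le> b" "y - x < min d1 d2"
        \<comment> \<open>Freezing \<open>f1\<close> at the right end and \<open>f2\<close> at the
          left end makes the discrete product rule exact; what remains is the oscillation of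
          \<open>f1\<close> and \<open>f2\<close> over the short interval, below
          \<open>e\<close>.\<close>
        have J1: "(LINT t:{x..y}|lborel. B (f1 y) (g2 t)) = B (f1 y) (f2 y - f2 x)"
          using acD(2)[OF ac_linear[OF bounded_linear_right[of "f1 y"] 2] xy(2)] by (simp add: diff_right)
        have J2: "(LINT t:{x..y}|lborel. B (g1 t) (f2 x)) = B (f1 y - f1 x) (f2 x)"
          using acD(2)[OF ac_linear[OF bounded_linear_left[of "f2 x"] 1] xy(2)] by (simp add: diff_left)
        have i1': "set_integrable lborel {x..y} (\<lambda>t. B (f1 y) (g2 t))"
          by (rule acD(1)[OF ac_linear[OF bounded_linear_right[of "f1 y"] 2]])
        have i2': "set_integrable lborel {x..y} (\<lambda>t. B (g1 t) (f2 x))"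
          by (rule acD(1)[OF ac_linear[OF bounded_linear_left[of "f2 x"] 1]])
        have sp: "(LINT t:{a..y}|lborel. B (f1 t) (g2 t) + B (g1 t) (f2 t)) =
           (LINT t:{a..x}|lborel. B (f1 t) (g2 t) + B (g1 t) (f2 t)) + (LINT t:{x..y}|lborel. B (f1 t) (g2 t) + B (g1 t) (f2 t))"
          by (rule set_integral_Icc_split[OF I]) (use xy in auto)
        have "\<Phi> y - \<Phi> x = (B (f1 y) (f2 y - f2 x) + B (f1 y - f1 x) (f2 x)) - (LINT t:{x..y}|lborel. B (f1 t) (g2 t) + B (g1 t) (f2 t))"
          unfolding \<Phi>_def sp by (simp add: diff_left diff_right)
        also have "\<dots> = (LINT t:{x..y}|lborel. (B (f1 y) (g2 t) + B (g1 t) (f2 x)) - (B (f1 t) (g2 t) + B (g1 t) (f2 t)))"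
          unfolding J1[symmetric] J2[symmetric]
          by (simp add: set_integral_diff(2)[OF set_integral_add(1)[OF i1' i2'] I] set_integral_add(2)[OF i1' i2'])
        also have "norm \<dots> \<le> (LINT t:{x..y}|lborel. e * (K * (norm (g2 t) + norm (g1 t))))"
        proof (rule set_integral_le_bound)
          fix t assume t: "t \<in> {x..y}"
          have "(B (f1 y) (g2 t) + B (g1 t) (f2 x)) - (B (f1 t) (g2 t) + B (g1 t) (f2 t)) =
            B (f1 y - f1 t) (g2 t) + B (g1 t) (f2 x - f2 t)" by (simp add: diff_left diff_right)
          also have "norm \<dots> \<le> norm (f1 y - f1 t) * norm (g2 t) * K + norm (g1 t) * norm (f2 x - f2 t) * K"
            by (rule order_trans[OF norm_triangle_ineq add_mono[OF K(2) K(2)]])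
          also have "\<dots> \<le> e * norm (g2 t) * K + norm (g1 t) * e * K"
            using d1(2)[of y t] d2(2)[of x t] t xy K(1) e
            by (intro add_mono mult_right_mono mult_left_mono) auto
          finally show "norm ((B (f1 y) (g2 t) + B (g1 t) (f2 x)) - (B (f1 t) (g2 t) + B (g1 t) (f2 t))) \<le> e * (K * (norm (g2 t) + norm (g1 t)))"
            by (simp add: algebra_simps)
        qed (intro set_integral_diff(1) set_integral_add(1) i1' i2' I1 I2 set_integrable_mult_right iK)+
        also have "\<dots> = e * (LINT t:{x..y}|lborel. (K * (norm (g2 t) + norm (g1 t))))"
          by (rule set_integral_mult_right)
        also have "\<dots> = e * (G y - G x)"
          using set_integral_Icc_split[OF iK, of a x y] xy by (simp add: G_def)
        finally show "norm (\<Phi> y - \<Phi> x) \<le> e * (G y - G x)" .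
      qed (use d1 d2 in auto)
    qed
    moreover have "(LINT t:{a..a}|lborel. B (f1 t) (g2 t) + B (g1 t) (f2 t)) = 0"
      using set_borel_integral_eq_integral(2)[OF I[of a a]] by (simp del: atLeastAtMost_singleton) simp
    ultimately show ?thesis unfolding \<Phi>_def by (simp add: algebra_simps del: atLeastAtMost_singleton)
  qed
  show ?thesis unfolding ac_def using I main by blast
qed

lemma ac_scaleR: "ac f1 g1 \<Longrightarrow> ac f2 g2 \<Longrightarrow> ac (\<lambda>x. f1 x *\<^sub>R f2 x) (\<lambda>x. f1 x *\<^sub>R g2 x + g1 x *\<^sub>R f2 x)"
  by (rule ac_prod[OF bounded_bilinear_scaleR])

lemma ac_norm_square:
  assumes "ac f g" shows "ac (\<lambda>x. (norm (f x))\<^sup>2) (\<lambda>x. 2 * (f x \<bullet> g x))"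
  using ac_prod[OF bounded_bilinear_inner assms assms]
  by (simp add: power2_norm_eq_inner inner_commute)

lemma ac_indefinite:
  assumes "\<And>a b. set_integrable lborel {a..b} g"
  obtains f where "f 0 = 0" "ac f g"
proof -
  define f where "f x = (if x \<ge> 0 then LINT t:{0..x}|lborel. g t else - (LINT t:{x..0}|lborel. g t))" for x
  have "(LINT x:{a..b}|lborel. g x) = f b - f a" if "a \<le> b" for a b
    using that set_integral_Icc_split[OF assms, of a 0 b] set_integral_Icc_split[OF assms, of 0 a b]
      set_integral_Icc_split[OF assms, of a b 0]
    by (auto simp: f_def)
  moreover have "f 0 = 0" unfolding f_def using set_borel_integral_eq_integral(2)[OF assms[of 0 0]] by simp
  ultimately show ?thesis using assms by (intro that[of f]) (unfold ac_def, blast+)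
qed

section \<open>The Sobolev space \<open>H\<^sup>1\<close>\<close>

definition h1 :: "(real \<Rightarrow> 'a::euclidean_space) \<Rightarrow> (real \<Rightarrow> 'a) \<Rightarrow> bool" where
  "h1 f g \<longleftrightarrow> l2 f \<and> l2 g \<and> ac f g"

lemma h1D: assumes "h1 f g" shows "l2 f" "l2 g" "ac f g"
  using assms by (auto simp: h1_def)

lemma h1_add: "h1 f f' \<Longrightarrow> h1 g g' \<Longrightarrow> h1 (\<lambda>x. f x + g x) (\<lambda>x. f' x + g' x)"
  by (simp add: h1_def l2_plus ac_add)

lemma h1_diff: "h1 f f' \<Longrightarrow> h1 g g' \<Longrightarrow> h1 (\<lambda>x. f x - g x) (\<lambda>x. f' x - g' x)"
  by (simp add: h1_def l2_diff ac_diff)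

lemma h1_linear: "bounded_linear T \<Longrightarrow> h1 f g \<Longrightarrow> h1 (\<lambda>x. T (f x)) (\<lambda>x. T (g x))"
  by (simp add: h1_def l2_linear ac_linear)

text \<open>Compare f at x with f at y in [x, x + 1] and average over y; on an interval of length
  one Cauchy-Schwarz has constant 1. This is what makes the Neumann iterates converge
  uniformly.\<close>

lemma h1_sup_bound:
  assumes "h1 f g" shows "norm (f x) \<le> l2norm f + l2norm g"
proof -
  note f = h1D(1)[OF assms] and g = h1D(2)[OF assms] and fg = h1D(3)[OF assms]
  have G: "(LINT t:{x..x+1}|lborel. norm (g t)) \<le> l2norm g"
    using l2_set_lebesgue_bound[OF g, of x "x + 1"] by simp
  have le: "norm (f x) \<le> norm (f y) + l2norm g" if y: "y \<in> {x..x+1}" for y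
  proof -
    have "norm (f y - f x) \<le> (LINT t:{x..y}|lborel. norm (g t))"
      using acD(2)[OF fg, of x y] y set_integral_le_bound[OF acD(1)[OF fg], of x y "\<lambda>t. norm (g t)"]
        set_integrable_norm[OF acD(1)[OF fg]] by auto
    also have "\<dots> \<le> (LINT t:{x..x+1}|lborel. norm (g t))"
      unfolding set_lebesgue_integral_def
      by (rule integral_mono)
         (use y set_integrable_norm[OF acD(1)[OF fg]] in \<open>auto simp: set_integrable_def indicator_def\<close>)
    finally have "norm (f y - f x) \<le> l2norm g" using G by linarith
    then show ?thesis using norm_triangle_ineq3[of "f x" "f y"] by (simp add: norm_minus_commute)
  qed
  have c: "set_integrable lborel {x..x+1} (\<lambda>t. norm (f x))"
    by (intro borel_integrable_atLeastAtMost' continuous_intros)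
  have c2: "set_integrable lborel {x..x+1} (\<lambda>t. norm (f t) + l2norm g)"
    by (intro borel_integrable_atLeastAtMost' continuous_intros continuous_on_subset[OF ac_continuous[OF fg]]) auto
  have const: "(LINT t:{x..x+1}|lborel. k) = k" for k :: real
    by (subst set_integral_const) auto
  have nf: "set_integrable lborel {x..x+1} (\<lambda>t. norm (f t))" by (rule l2_set_integrable(2)[OF f])
  have kc: "set_integrable lborel {x..x+1} (\<lambda>t. k::real)" for k
    by (intro borel_integrable_atLeastAtMost' continuous_intros)
  have "norm (f x) = (LINT t:{x..x+1}|lborel. norm (f x))" by (simp add: const)
  also have "\<dots> \<le> (LINT t:{x..x+1}|lborel. norm (f t) + l2norm g)"
    by (rule set_integral_mono[OF c c2]) (rule le)
  also have "\<dots> = (LINT t:{x..x+1}|lborel. norm (f t)) + l2norm g"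
    by (subst set_integral_add(2)[OF nf kc]) (simp add: const)
  also have "\<dots> \<le> l2norm f + l2norm g"
    using l2_set_lebesgue_bound[OF f, of x "x + 1"] by simp
  finally show ?thesis .
qed

lemma integrable_limit_zero:
  fixes f :: "real \<Rightarrow> real"
  assumes "integrable lborel f" "(f \<longlongrightarrow> L) at_top"
  shows "L = 0"
proof (rule ccontr)
  assume "L \<noteq> 0"
  then have "\<forall>\<^sub>F x in at_top. dist (f x) L < \<bar>L\<bar> / 2" using assms(2) by (intro tendstoD) auto
  then obtain X where X: "\<And>x. x \<ge> X \<Longrightarrow> dist (f x) L < \<bar>L\<bar> / 2" unfolding eventually_at_top_linorder by auto
  have low: "\<bar>L\<bar> / 2 \<le> \<bar>f x\<bar>" if "x \<ge> X" for x using X[OF that] unfolding dist_real_def by arith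
  define I where "I = (\<integral>x. \<bar>f x\<bar> \<partial>lborel)"
  \<comment> \<open>A window of length \<open>T\<close> on which |f| is at least |L| / 2 contributes
    I + 1, more than the whole integral.\<close>
  define T where "T = (I + 1) / (\<bar>L\<bar> / 2)"
  have I0: "I \<ge> 0" by (simp add: I_def)
  have T0: "T > 0" using \<open>L \<noteq> 0\<close> I0 by (simp add: T_def)
  have "(\<integral>x. indicator {X..X+T} x * (\<bar>L\<bar> / 2) \<partial>lborel) \<le> I"
    unfolding I_def
  proof (rule integral_mono)
    show "integrable lborel (\<lambda>x. indicator {X..X+T} x * (\<bar>L\<bar> / 2))"
      using borel_integrable_atLeastAtMost'[of X "X + T" "\<lambda>x. \<bar>L\<bar> / 2"] by (simp add: set_integrable_def)
  qed (use assms(1) low in \<open>auto simp: indicator_def\<close>)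
  moreover have "(\<integral>x. indicator {X..X+T} x * (\<bar>L\<bar> / 2) \<partial>lborel) = T * (\<bar>L\<bar> / 2)" using T0 by simp
  ultimately show False using \<open>L \<noteq> 0\<close> by (simp add: T_def)
qed

text \<open>Integrability of g gives f a limit at each end, and integrability of f forces both
  limits to be 0. All integrations by parts on the whole line rest on this.\<close>

lemma integral_derivative_zero_real:
  fixes f :: "real \<Rightarrow> real"
  assumes f: "integrable lborel f" and g: "integrable lborel g" and fg: "ac f g"
  shows "(\<integral>x. g x \<partial>lborel) = 0"
proof -
  have si: "set_integrable lborel A g" if "A \<in> sets borel" for A
    unfolding set_integrable_def using that g by (intro integrable_mult_indicator) auto
  have top: "((\<lambda>b. f b) \<longlongrightarrow> f 0 + (LINT x:{0..}|lborel. g x)) at_top"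
  proof -
    have "((\<lambda>b. f 0 + (LINT x:{0..b}|lborel. g x)) \<longlongrightarrow> f 0 + (LINT x:{0..}|lborel. g x)) at_top"
      by (intro tendsto_intros tendsto_set_lebesgue_integral_at_top si) auto
    then show ?thesis
      by (rule Lim_transform_eventually) (use acD(2)[OF fg] in \<open>auto intro!: eventually_mono[OF eventually_ge_at_top[of 0]]\<close>)
  qed
  have bot: "((\<lambda>b. f (- b)) \<longlongrightarrow> f 0 - (LINT x:{..0}|lborel. g x)) at_top"
  proof -
    have "((\<lambda>b. f 0 - (LINT x:{b..0}|lborel. g x)) \<longlongrightarrow> f 0 - (LINT x:{..0}|lborel. g x)) at_bot"
      by (intro tendsto_intros tendsto_set_lebesgue_integral_at_bot si) auto
    then have "((\<lambda>b. f b) \<longlongrightarrow> f 0 - (LINT x:{..0}|lborel. g x)) at_bot"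
      by (rule Lim_transform_eventually) (use acD(2)[OF fg] in \<open>auto intro!: eventually_mono[OF eventually_le_at_bot[of 0]]\<close>)
    then show ?thesis by (simp add: filterlim_at_bot_mirror)
  qed
  have 1: "f 0 + (LINT x:{0..}|lborel. g x) = 0" by (rule integrable_limit_zero[OF f top])
  have 2: "f 0 - (LINT x:{..0}|lborel. g x) = 0"
    by (rule integrable_limit_zero[OF _ bot]) (use lborel_integrable_real_affine[OF f, of "-1" 0] in simp)
  have "(\<integral>x. g x \<partial>lborel) = (\<integral>x. indicator {..0} x *\<^sub>R g x + indicator {0..} x *\<^sub>R g x \<partial>lborel)"
  proof (rule integral_cong_AE)
    show "AE x in lborel. g x = indicator {..0} x *\<^sub>R g x + indicator {0..} x *\<^sub>R g x"
      using AE_lborel_singleton[of "0::real"] by eventually_elim (auto simp: indicator_def)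
  qed (use g in auto)
  also have "\<dots> = (LINT x:{..0}|lborel. g x) + (LINT x:{0..}|lborel. g x)"
    using si[of "{..0}"] si[of "{0..}"] unfolding set_lebesgue_integral_def set_integrable_def
    by (intro Bochner_Integration.integral_add) auto
  finally show ?thesis using 1 2 by simp
qed

lemma integral_derivative_zero:
  fixes f :: "real \<Rightarrow> 'a::euclidean_space"
  assumes f: "integrable lborel f" and g: "integrable lborel g" and fg: "ac f g"
  shows "(\<integral>x. g x \<partial>lborel) = 0"
proof (rule euclidean_eqI)
  fix b :: 'a assume "b \<in> Basis"
  have "(\<integral>x. g x \<bullet> b \<partial>lborel) = 0"
    by (rule integral_derivative_zero_real[of "\<lambda>x. f x \<bullet> b"])
       (use f g ac_linear[OF bounded_linear_inner_left fg] in auto)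
  then show "(\<integral>x. g x \<partial>lborel) \<bullet> b = 0 \<bullet> b" using g by simp
qed

section \<open>Perturbation of first-order operators\<close>

text \<open>Operators S d/dx + B(x) with a constant invertible leading part; \<open>T\<close> is the
  inverse of \<open>S\<close>, so the derivative can be recovered from the equation. Linearity is
  over the reals: multiplication by a complex number enters as a linear map of the Euclidean
  space.\<close>

locale first_order =
  fixes S T :: "'a::euclidean_space \<Rightarrow> 'a" and B :: "real \<Rightarrow> 'a \<Rightarrow> 'a" and \<beta> :: real
  assumes S: "bounded_linear S" and T: "bounded_linear T"
    and ST: "\<And>v. S (T v) = v" and TS: "\<And>v. T (S v) = v"
    and B_lin: "\<And>x. linear (B x)"
    and B_bound: "\<And>x v. norm (B x v) \<le> \<beta> * norm v"
    and B_cont: "\<And>f. continuous_on UNIV f \<Longrightarrow> continuous_on UNIV (\<lambda>x. B x (f x))"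
begin

definition Op :: "(real \<Rightarrow> 'a) \<Rightarrow> (real \<Rightarrow> 'a) \<Rightarrow> real \<Rightarrow> 'a" where
  "Op f g x = S (g x) + B x (f x)"

lemma beta_nonneg: "0 \<le> \<beta>"
proof -
  obtain b :: 'a where "b \<in> Basis" using nonempty_Basis by blast
  then have "0 \<le> \<beta> * 1" using B_bound[of 0 b] norm_ge_zero[of "B 0 b"] by (simp del: norm_ge_zero)
  then show ?thesis by simp
qed

lemma l2_B:
  assumes "l2 f" "continuous_on UNIV f"
  shows "l2 (\<lambda>x. B x (f x))" "l2norm (\<lambda>x. B x (f x)) \<le> \<beta> * l2norm f"
  using l2_bound[OF assms(1) borel_measurable_continuous_onI[OF B_cont[OF assms(2)]] _ beta_nonneg] B_bound
  by auto

lemma l2_Op: assumes "h1 f g" shows "l2 (Op f g)"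
  unfolding Op_def[abs_def]
  by (intro l2_plus l2_linear[OF S] l2_B h1D[OF assms] ac_continuous[OF h1D(3)[OF assms]])

lemma Op_diff: "Op (\<lambda>x. f x - f' x) (\<lambda>x. g x - g' x) x = Op f g x - Op f' g' x"
  by (simp add: Op_def linear_diff[OF B_lin] linear_diff[OF bounded_linear.linear[OF S]])

text \<open>The iteration solves Op \<phi>' = f + Z \<phi> and contracts with ratio C * \<zeta>. The
  predicate \<open>A\<close> plays the role of an invariant subspace: the complement of the zero
  mode near 0, the whole space around a positive real. The equation converts L^2 convergence into
  convergence of derivatives, hence into uniform convergence.\<close>

theorem neumann:
  fixes Z :: "'a \<Rightarrow> 'a"
  assumes Z: "bounded_linear Z" and Zb: "\<And>v. norm (Z v) \<le> \<zeta> * norm v" and \<zeta>: "0 \<le> \<zeta>"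
    and solve: "\<And>f. l2 f \<Longrightarrow> A f \<Longrightarrow> \<exists>\<phi> g. h1 \<phi> g \<and> A \<phi> \<and> (AE x in lborel. Op \<phi> g x = f x)"
    and A_add: "\<And>f \<phi>. l2 f \<Longrightarrow> l2 \<phi> \<Longrightarrow> A f \<Longrightarrow> A \<phi> \<Longrightarrow> A (\<lambda>x. f x + Z (\<phi> x))"
    and A_diff: "\<And>\<phi> \<psi>. l2 \<phi> \<Longrightarrow> l2 \<psi> \<Longrightarrow> A \<phi> \<Longrightarrow> A \<psi> \<Longrightarrow> A (\<lambda>x. \<phi> x - \<psi> x)"
    and bound: "\<And>\<phi> g. h1 \<phi> g \<Longrightarrow> A \<phi> \<Longrightarrow> l2norm \<phi> \<le> C * l2norm (Op \<phi> g)"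
    and C: "0 \<le> C" and small: "C * \<zeta> < 1"
    and f: "l2 f" and Af: "A f"
  obtains \<phi> g where "h1 \<phi> g" "AE x in lborel. Op \<phi> g x - Z (\<phi> x) = f x"
proof -
  define q where "q = C * \<zeta>"
  have q: "0 \<le> q" "q < 1" using C \<zeta> small by (auto simp: q_def)
  obtain \<tau> where \<tau>: "0 \<le> \<tau>" "\<And>v. norm (T v) \<le> \<tau> * norm v"
    using bounded_linear.nonneg_bounded[OF T] by (metis mult.commute)
  define good where "good h p \<longleftrightarrow> h1 (fst p) (snd p) \<and> A (fst p) \<and> (AE x in lborel. Op (fst p) (snd p) x = h x)"
    for h and p :: "(real \<Rightarrow> 'a) \<times> (real \<Rightarrow> 'a)"
  \<comment> \<open>The choice need not be linear in \<open>h\<close>: differences of iterates are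
    controlled by the a priori estimate \<open>bound\<close> alone.\<close>
  define sol where "sol h = (SOME p. good h p)" for h
  have sol: "good h (sol h)" if "l2 h" "A h" for h
    unfolding sol_def using solve[OF that] by (intro someI_ex[of "good h"]) (auto simp: good_def)
  define p where "p = rec_nat (sol f) (\<lambda>_ r. sol (\<lambda>x. f x + Z (fst r x)))"
  have p0: "p 0 = sol f" and pS: "p (Suc k) = sol (\<lambda>x. f x + Z (fst (p k) x))" for k
    by (simp_all add: p_def)
  define \<phi> where "\<phi> k = fst (p k)" for k
  define g where "g k = snd (p k)" for k
  have "h1 (\<phi> k) (g k) \<and> A (\<phi> k)" for k
  proof (induction k)
    case 0
    then show ?case using sol[OF f Af] by (simp add: good_def \<phi>_def g_def p0)
  next
    case (Suc k)
    have "good (\<lambda>x. f x + Z (\<phi> k x)) (p (Suc k))"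
      unfolding pS \<phi>_def[symmetric]
      by (intro sol l2_plus f l2_linear[OF Z] A_add Af) (use Suc h1D in blast)+
    then show ?case by (simp add: good_def \<phi>_def g_def)
  qed
  then have h: "h1 (\<phi> k) (g k)" and A\<phi>: "A (\<phi> k)" for k by auto
  note l\<phi> = h1D(1)[OF h] and ac\<phi> = h1D(3)[OF h]
  have eqn: "AE x in lborel. Op (\<phi> (Suc k)) (g (Suc k)) x = f x + Z (\<phi> k x)" for k
  proof -
    have "good (\<lambda>x. f x + Z (\<phi> k x)) (p (Suc k))"
      unfolding pS \<phi>_def[symmetric]
      by (intro sol l2_plus f l2_linear[OF Z] A_add Af A\<phi> l\<phi>)
    then show ?thesis by (simp add: good_def \<phi>_def g_def)
  qed
  define d where "d k = (\<lambda>x. \<phi> (Suc k) x - \<phi> k x)" for k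
  define e where "e k = (\<lambda>x. g (Suc k) x - g k x)" for k
  have hd: "h1 (d k) (e k)" for k unfolding d_def e_def by (rule h1_diff[OF h h])
  note ld = h1D(1)[OF hd] and le = h1D(2)[OF hd] and acd = h1D(3)[OF hd]
  have Ad: "A (d k)" for k unfolding d_def by (intro A_diff l\<phi> A\<phi>)
  have eqd: "AE x in lborel. Op (d (Suc k)) (e (Suc k)) x = Z (d k x)" for k
    using eqn[of k] eqn[of "Suc k"]
    by eventually_elim (simp add: d_def e_def Op_diff linear_diff[OF bounded_linear.linear[OF Z]])
  have lZd: "l2 (\<lambda>x. Z (d k x))" "l2norm (\<lambda>x. Z (d k x)) \<le> \<zeta> * l2norm (d k)" for k
    using l2_bound[OF ld l2D(1)[OF l2_linear[OF Z ld]] _ \<zeta>, of k k] Zb by auto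
  have dec: "l2norm (d (Suc k)) \<le> q * l2norm (d k)" for k
  proof -
    have "l2norm (d (Suc k)) \<le> C * l2norm (Op (d (Suc k)) (e (Suc k)))" by (rule bound[OF hd Ad])
    also have "l2norm (Op (d (Suc k)) (e (Suc k))) = l2norm (\<lambda>x. Z (d k x))"
      by (rule l2norm_cong_AE[OF l2_Op[OF hd] l2D(1)[OF lZd(1)] eqd])
    finally show ?thesis using mult_left_mono[OF lZd(2) C, of k] by (simp add: q_def mult_ac)
  qed
  define a where "a = l2norm (d 0)"
  have a: "0 \<le> a" by (simp add: a_def)
  have dk: "l2norm (d k) \<le> a * q ^ k" for k
  proof (induction k)
    case (Suc k)
    then show ?case using dec[of k] mult_left_mono[OF Suc q(1)] by (simp add: mult_ac)
  qed (simp add: a_def)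
  \<comment> \<open>The equation gives the derivative of the difference as T applied to Z d_k - B
    d_(k+1), so it decays as fast as the differences themselves.\<close>
  have ek: "l2norm (e (Suc k)) \<le> \<tau> * (\<zeta> + \<beta>) * a * q ^ k" for k
  proof -
    let ?r = "\<lambda>x. Z (d k x) - B x (d (Suc k) x)"
    have lr: "l2 ?r" by (intro l2_diff lZd l2_B ld ac_continuous[OF acd])
    have "AE x in lborel. norm (e (Suc k) x) \<le> \<tau> * norm (?r x)"
      using eqd[of k]
    proof eventually_elim
      case (elim x)
      have "e (Suc k) x = T (S (e (Suc k) x))" by (simp add: TS)
      also have "S (e (Suc k) x) = ?r x" using elim by (simp add: Op_def eq_diff_eq)
      finally show ?case using \<tau>(2) by metis
    qed
    then have "l2norm (e (Suc k)) \<le> \<tau> * l2norm ?r"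
      by (rule l2_bound(2)[OF lr l2D(1)[OF le] _ \<tau>(1)])
    also have "\<tau> * l2norm ?r \<le> \<tau> * (\<zeta> * (a * q ^ k) + \<beta> * (a * q ^ k))"
    proof (rule mult_left_mono[OF _ \<tau>(1)])
      have "l2norm ?r \<le> \<zeta> * l2norm (d k) + \<beta> * l2norm (d (Suc k))"
      using l2norm_triangle_diff[OF lZd(1)[of k] l2_B(1)[OF ld ac_continuous[OF acd], of "Suc k"]]
        lZd(2)[of k] l2_B(2)[OF ld ac_continuous[OF acd], of "Suc k"] by linarith
    also have "\<dots> \<le> \<zeta> * (a * q ^ k) + \<beta> * (a * q ^ k)"
    proof (intro add_mono mult_left_mono dk \<zeta> beta_nonneg)
      have "l2norm (d (Suc k)) \<le> 1 * l2norm (d k)"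
        using dec[of k] mult_right_mono[of q 1 "l2norm (d k)"] q by simp
      then show "l2norm (d (Suc k)) \<le> a * q ^ k" using dk[of k] by simp
    qed
    finally show "l2norm ?r \<le> \<zeta> * (a * q ^ k) + \<beta> * (a * q ^ k)" .
    qed
    finally show ?thesis by (simp add: algebra_simps)
  qed
  define M where "M = a * q + \<tau> * (\<zeta> + \<beta>) * a"
  have sup: "norm (d (Suc k) x) \<le> M * q ^ k" for k x
    using h1_sup_bound[OF hd, of "Suc k" x] dk[of "Suc k"] ek[of k] by (simp add: M_def algebra_simps)
  \<comment> \<open>The telescoping series starts at \<open>d 1\<close>, because the recursion
    \<open>eqd\<close>, and with it the derivative bound, describes
    \<open>d (Suc k)\<close>.\<close>
  have "uniform_limit UNIV (\<lambda>n x. \<Sum>i<n. d (Suc i) x) (\<lambda>x. \<Sum>i. d (Suc i) x) sequentially"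
    by (rule Weierstrass_m_test[OF sup]) (use q in \<open>auto intro!: summable_mult summable_geometric\<close>)
  moreover have "(\<Sum>i<n. d (Suc i) x) = \<phi> (Suc n) x - \<phi> 1 x" for n x
    by (induction n) (auto simp: d_def)
  ultimately have "uniform_limit UNIV (\<lambda>n x. \<phi> (Suc n) x - \<phi> 1 x) (\<lambda>x. \<Sum>i. d (Suc i) x) sequentially" by simp
  then have "uniform_limit UNIV (\<lambda>n x. (\<phi> (Suc n) x - \<phi> 1 x) + \<phi> 1 x) (\<lambda>x. (\<Sum>i. d (Suc i) x) + \<phi> 1 x) sequentially"
    by (rule uniform_limit_add[OF _ uniform_limit_const])
  then obtain F where "uniform_limit UNIV (\<lambda>n. \<phi> (Suc n)) F sequentially" by auto
  then have UF: "uniform_limit UNIV \<phi> F sequentially"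
    by (simp add: filterlim_sequentially_Suc)
  have ptw: "(\<lambda>n. \<phi> n x) \<longlonglongrightarrow> F x" for x by (rule tendsto_uniform_limitI[OF UF]) simp
  have cF: "continuous_on UNIV F"
    by (rule uniform_limit_theorem[OF _ UF]) (auto intro!: always_eventually ac_continuous[OF ac\<phi>])
  have "l2norm (\<phi> n) \<le> l2norm (\<phi> 0) + a * (\<Sum>k<n. q ^ k)" for n
  proof (induction n)
    case (Suc n)
    have "\<phi> (Suc n) = (\<lambda>x. \<phi> n x + d n x)" by (simp add: d_def fun_eq_iff)
    then have "l2norm (\<phi> (Suc n)) \<le> l2norm (\<phi> n) + l2norm (d n)" using l2norm_triangle[OF l\<phi> ld] by simp
    then show ?case using Suc dk[of n] by (simp add: algebra_simps)
  qed simp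
  moreover have "(\<Sum>k<n. q ^ k) \<le> 1 / (1 - q)" for n
    using sum_le_suminf[of "\<lambda>k. q ^ k" "{..<n}"] q by (simp add: suminf_geometric summable_geometric)
  ultimately have "l2norm (\<phi> n) \<le> l2norm (\<phi> 0) + a * (1 / (1 - q))" for n
    using a by (meson add_left_mono mult_left_mono order_trans)
  from l2_Fatou(1)[OF l\<phi> this ptw] have lF: "l2 F" .
  define G where "G x = T (f x + Z (F x) - B x (F x))" for x
  have lG: "l2 G" unfolding G_def[abs_def]
    by (intro l2_linear[OF T] l2_diff l2_plus f l2_linear[OF Z] lF l2_B cF)
  \<comment> \<open>The representative of the derivative of \<open>\<phi> (Suc k)\<close> read off
    from the equation. In the difference to \<open>G\<close> the term f cancels, so the convergence
    is uniform although f is merely in L^2, and the integrated equation passes to the limit.\<close>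
  define gg where "gg k x = T (f x + Z (\<phi> k x) - B x (\<phi> (Suc k) x))" for k x
  have lgg: "l2 (gg k)" for k unfolding gg_def
    by (intro l2_linear[OF T] l2_diff l2_plus f l2_linear[OF Z] l\<phi> l2_B ac_continuous[OF ac\<phi>])
  have acgg: "ac (\<phi> (Suc k)) (gg k)" for k
  proof (rule ac_cong_AE[OF ac\<phi> _ l2D(1)[OF lgg]])
    show "AE x in lborel. g (Suc k) x = gg k x" using eqn[of k]
    proof eventually_elim
      case (elim x)
      have "g (Suc k) x = T (S (g (Suc k) x))" by (simp add: TS)
      also have "S (g (Suc k) x) = f x + Z (\<phi> k x) - B x (\<phi> (Suc k) x)" using elim by (simp add: Op_def eq_diff_eq)
      finally show ?case by (simp add: gg_def)
    qed
  qed
  have acF: "ac F G"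
    unfolding ac_def
  proof (intro conjI allI impI)
    show "set_integrable lborel {a..b} G" for a b by (rule l2_set_integrable(1)[OF lG])
    show "(LINT x:{a..b}|lborel. G x) = F b - F a" if "a \<le> b" for a b
    proof -
      have "(\<lambda>k. LINT x:{a..b}|lborel. gg k x) \<longlonglongrightarrow> (LINT x:{a..b}|lborel. G x)"
      proof (rule LIMSEQ_I)
        fix r :: real assume r: "r > 0"
        define \<epsilon> where "\<epsilon> = r / (\<tau> * (\<zeta> + \<beta>) * (b - a) + 1)"
        have den: "\<tau> * (\<zeta> + \<beta>) * (b - a) \<ge> 0" using \<tau> \<zeta> beta_nonneg that by simp
        then have \<epsilon>: "\<epsilon> > 0" using r by (simp add: \<epsilon>_def add_nonneg_pos)
        obtain N where N: "\<And>n x. n \<ge> N \<Longrightarrow> dist (\<phi> n x) (F x) < \<epsilon>"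
          using UF \<epsilon> unfolding uniform_limit_iff eventually_sequentially by blast
        show "\<exists>no. \<forall>n\<ge>no. norm ((LINT x:{a..b}|lborel. gg n x) - (LINT x:{a..b}|lborel. G x)) < r"
        proof (intro exI[of _ N] allI impI)
          fix n assume n: "N \<le> n"
          have kc: "set_integrable lborel {a..b} (\<lambda>t. k::real)" for k
            by (intro borel_integrable_atLeastAtMost' continuous_intros)
          have "(LINT x:{a..b}|lborel. gg n x) - (LINT x:{a..b}|lborel. G x) = (LINT x:{a..b}|lborel. gg n x - G x)"
            by (rule set_integral_diff(2)[symmetric]) (intro l2_set_integrable(1) lgg lG)+
          also have "norm \<dots> \<le> (LINT x:{a..b}|lborel. \<tau> * (\<zeta> + \<beta>) * \<epsilon>)"
          proof (rule set_integral_le_bound[OF set_integral_diff(1)[OF l2_set_integrable(1)[OF lgg] l2_set_integrable(1)[OF lG]] kc])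
            fix x
            have "gg n x - G x = T (Z (\<phi> n x - F x) - B x (\<phi> (Suc n) x - F x))"
              unfolding gg_def G_def linear_diff[OF bounded_linear.linear[OF T], symmetric]
                linear_diff[OF B_lin] linear_diff[OF bounded_linear.linear[OF Z]]
              by (simp add: algebra_simps)
            then have "norm (gg n x - G x) \<le> \<tau> * norm (Z (\<phi> n x - F x) - B x (\<phi> (Suc n) x - F x))" using \<tau>(2) by simp
            also have "\<dots> \<le> \<tau> * (norm (Z (\<phi> n x - F x)) + norm (B x (\<phi> (Suc n) x - F x)))"
              by (intro mult_left_mono norm_triangle_ineq4 \<tau>)
            also have "\<dots> \<le> \<tau> * (\<zeta> * norm (\<phi> n x - F x) + \<beta> * norm (\<phi> (Suc n) x - F x))"
              by (intro mult_left_mono add_mono Zb B_bound \<tau>)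
            also have "\<dots> \<le> \<tau> * (\<zeta> * \<epsilon> + \<beta> * \<epsilon>)"
              using N[OF n, of x] N[of "Suc n" x] n
              by (intro mult_left_mono add_mono \<tau> \<zeta> beta_nonneg) (auto simp: dist_norm)
            finally show "norm (gg n x - G x) \<le> \<tau> * (\<zeta> + \<beta>) * \<epsilon>" by (simp add: algebra_simps)
          qed
          also have "\<dots> = \<tau> * (\<zeta> + \<beta>) * \<epsilon> * (b - a)"
            by (subst set_integral_const) (use that in auto)
          also have "\<dots> = (\<tau> * (\<zeta> + \<beta>) * (b - a)) * \<epsilon>" by simp
          also have "\<dots> < (\<tau> * (\<zeta> + \<beta>) * (b - a) + 1) * \<epsilon>" using \<epsilon> by simp
          also have "\<dots> = r" using den by (simp add: \<epsilon>_def)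
          finally show "norm ((LINT x:{a..b}|lborel. gg n x) - (LINT x:{a..b}|lborel. G x)) < r" .
        qed
      qed
      moreover have "(LINT x:{a..b}|lborel. gg k x) = \<phi> (Suc k) b - \<phi> (Suc k) a" for k
        by (rule acD(2)[OF acgg that])
      moreover have "(\<lambda>k. \<phi> (Suc k) b - \<phi> (Suc k) a) \<longlonglongrightarrow> F b - F a"
        by (intro tendsto_diff LIMSEQ_Suc ptw)
      ultimately show ?thesis using LIMSEQ_unique by fastforce
    qed
  qed
  have "h1 F G" by (simp add: h1_def lF lG acF)
  moreover have "Op F G x - Z (F x) = f x" for x by (simp add: Op_def G_def ST)
  ultimately show ?thesis using that by simp
qed

end

section \<open>Scalar equations along the kink\<close>

lemma set_integral_split_real:
  fixes g :: "real \<Rightarrow> 'a::euclidean_space"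
  assumes g: "integrable lborel g"
  shows "(LINT t:{..x}|lborel. g t) + (LINT t:{x..}|lborel. g t) = (\<integral>t. g t \<partial>lborel)"
    and "a \<le> b \<Longrightarrow> (LINT t:{..b}|lborel. g t) = (LINT t:{..a}|lborel. g t) + (LINT t:{a..b}|lborel. g t)"
proof -
  have si: "set_integrable lborel A g" if "A \<in> sets borel" for A
    unfolding set_integrable_def using that g by (intro integrable_mult_indicator) auto
  have ae: "AE t in lborel. t \<noteq> y" for y :: real by (rule AE_lborel_singleton)
  have "(LINT t:{..x} \<union> {x..}|lborel. g t) = (LINT t:{..x}|lborel. g t) + (LINT t:{x..}|lborel. g t)"
    by (rule set_integral_Un_AE) (use ae[of x] si in \<open>auto elim!: eventually_mono\<close>)
  moreover have "{..x} \<union> {x..} = UNIV" by auto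
  ultimately show "(LINT t:{..x}|lborel. g t) + (LINT t:{x..}|lborel. g t) = (\<integral>t. g t \<partial>lborel)"
    by (simp add: set_lebesgue_integral_def)
  assume ab: "a \<le> b"
  have "(LINT t:{..a} \<union> {a..b}|lborel. g t) = (LINT t:{..a}|lborel. g t) + (LINT t:{a..b}|lborel. g t)"
    by (rule set_integral_Un_AE) (use ae[of a] si in \<open>auto elim!: eventually_mono\<close>)
  moreover have "{..a} \<union> {a..b} = {..b}" using ab by auto
  ultimately show "(LINT t:{..b}|lborel. g t) = (LINT t:{..a}|lborel. g t) + (LINT t:{a..b}|lborel. g t)" by simp
qed

text \<open>Multiply the equation by y and absorb 2 |y| |G| into \<delta> |y|^2 + |G|^2 / \<delta>.
  The sign \<open>\<sigma>\<close> lets one estimate serve both tails and both scalar equations; it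
  decides at which end the boundary term is favourable.\<close>

lemma energy_estimate:
  fixes y :: "real \<Rightarrow> 'a::euclidean_space" and \<eta> :: "real \<Rightarrow> real"
  assumes ab: "a \<le> b" and y: "ac y y1" and eq: "\<And>x. s *\<^sub>R y1 x = \<eta> x *\<^sub>R y x + G x" and G: "l2 G"
    and \<sigma>: "\<bar>\<sigma>\<bar> = 1" and \<eta>: "\<And>x. x \<in> {a..b} \<Longrightarrow> \<sigma> * \<eta> x \<le> - \<delta>" and \<delta>: "\<delta> > 0"
  shows "\<delta> * (LINT x:{a..b}|lborel. (norm (y x))\<^sup>2) \<le> \<sigma> * s * ((norm (y a))\<^sup>2 - (norm (y b))\<^sup>2) + (l2norm G)\<^sup>2 / \<delta>"
proof -
  note yy = ac_norm_square[OF y]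
  have iy: "set_integrable lborel {a..b} (\<lambda>x. (norm (y x))\<^sup>2)"
    by (intro borel_integrable_atLeastAtMost' continuous_intros continuous_on_subset[OF ac_continuous[OF y]]) auto
  have iG: "set_integrable lborel {a..b} (\<lambda>x. (norm (G x))\<^sup>2)"
    unfolding set_integrable_def using l2D(2)[OF G] by (intro integrable_mult_indicator) auto
  have "\<sigma> * s * ((norm (y b))\<^sup>2 - (norm (y a))\<^sup>2) = (LINT x:{a..b}|lborel. \<sigma> * s * (2 * (y x \<bullet> y1 x)))"
    using acD(2)[OF yy ab] by simp
  also have "\<dots> \<le> (LINT x:{a..b}|lborel. - (\<delta> * (norm (y x))\<^sup>2) + (norm (G x))\<^sup>2 / \<delta>)"
  proof (rule set_integral_mono)
    show "set_integrable lborel {a..b} (\<lambda>x. \<sigma> * s * (2 * (y x \<bullet> y1 x)))"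
      by (intro set_integrable_mult_right acD(1)[OF yy])
    show "set_integrable lborel {a..b} (\<lambda>x. - (\<delta> * (norm (y x))\<^sup>2) + (norm (G x))\<^sup>2 / \<delta>)"
      using set_integral_add(1)[OF set_integrable_mult_right[OF iy, of "- \<delta>"] set_integrable_divide[OF iG, of \<delta>]] by simp
    fix x assume x: "x \<in> {a..b}"
    have "\<sigma> * s * (2 * (y x \<bullet> y1 x)) = 2 * \<sigma> * (y x \<bullet> (s *\<^sub>R y1 x))" by simp
    also have "\<dots> = 2 * (\<sigma> * \<eta> x) * (norm (y x))\<^sup>2 + 2 * \<sigma> * (y x \<bullet> G x)"
      unfolding eq by (simp add: inner_add_right power2_norm_eq_inner algebra_simps)
    also have "\<dots> \<le> 2 * (- \<delta>) * (norm (y x))\<^sup>2 + 2 * (norm (y x) * norm (G x))"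
    proof (intro add_mono mult_right_mono mult_left_mono \<eta>[OF x])
      have "\<sigma> * (y x \<bullet> G x) \<le> \<bar>\<sigma>\<bar> * \<bar>y x \<bullet> G x\<bar>" by (metis abs_ge_self abs_mult)
      also have "\<dots> \<le> norm (y x) * norm (G x)" using \<sigma> by (simp add: Cauchy_Schwarz_ineq2)
      finally show "2 * \<sigma> * (y x \<bullet> G x) \<le> 2 * (norm (y x) * norm (G x))" by simp
    qed auto
    also have "2 * (norm (y x) * norm (G x)) \<le> \<delta> * (norm (y x))\<^sup>2 + (norm (G x))\<^sup>2 / \<delta>"
    proof -
      have "0 \<le> (\<delta> * norm (y x) - norm (G x))\<^sup>2 / \<delta>" using \<delta> by simp
      also have "\<dots> = \<delta> * (norm (y x))\<^sup>2 + (norm (G x))\<^sup>2 / \<delta> - 2 * (norm (y x) * norm (G x))"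
        using \<delta> by (simp add: field_simps power2_eq_square)
      finally show ?thesis by simp
    qed
    finally show "\<sigma> * s * (2 * (y x \<bullet> y1 x)) \<le> - (\<delta> * (norm (y x))\<^sup>2) + (norm (G x))\<^sup>2 / \<delta>" by simp
  qed
  also have "\<dots> = - (\<delta> * (LINT x:{a..b}|lborel. (norm (y x))\<^sup>2)) + (LINT x:{a..b}|lborel. (norm (G x))\<^sup>2) / \<delta>"
  proof -
    have 1: "set_integrable lborel {a..b} (\<lambda>x. - (\<delta> * (norm (y x))\<^sup>2))" using set_integrable_mult_right[OF iy, of "- \<delta>"] by simp
    have 2: "set_integrable lborel {a..b} (\<lambda>x. (norm (G x))\<^sup>2 / \<delta>)" by (rule set_integrable_divide) (rule iG)
    show ?thesis unfolding set_integral_add(2)[OF 1 2] using iy by (simp add: set_integral_uminus)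
  qed
  also have "(LINT x:{a..b}|lborel. (norm (G x))\<^sup>2) \<le> (l2norm G)\<^sup>2"
    unfolding l2norm_power2 set_lebesgue_integral_def
    by (rule integral_mono) (use iG l2D(2)[OF G] in \<open>auto simp: set_integrable_def indicator_def\<close>)
  finally show ?thesis using \<delta> by (simp add: divide_right_mono algebra_simps)
qed

lemma l2_from_tails:
  fixes y :: "real \<Rightarrow> 'a::euclidean_space"
  assumes y: "continuous_on UNIV y" and X: "0 \<le> X" and Y: "\<And>x. x \<in> {-X..X} \<Longrightarrow> norm (y x) \<le> Y"
    and R: "\<And>b. X \<le> b \<Longrightarrow> (LINT x:{X..b}|lborel. (norm (y x))\<^sup>2) \<le> T"
    and L: "\<And>a. a \<le> - X \<Longrightarrow> (LINT x:{a..-X}|lborel. (norm (y x))\<^sup>2) \<le> T"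
  shows "l2 y" "l2norm y \<le> sqrt (2 * X * Y\<^sup>2 + 2 * T)"
proof -
  have i: "set_integrable lborel {a..b} (\<lambda>x. (norm (y x))\<^sup>2)" for a b
    by (intro borel_integrable_atLeastAtMost' continuous_intros continuous_on_subset[OF y]) auto
  have T0: "0 \<le> T"
    using R[of X] set_borel_integral_eq_integral(2)[OF i[of X X]] by simp
  have kc: "set_integrable lborel {a..b} (\<lambda>t. k::real)" for k and a b :: real
    by (intro borel_integrable_atLeastAtMost' continuous_intros)
  have "(LINT x:{-X..X}|lborel. (norm (y x))\<^sup>2) \<le> (LINT x:{-X..X}|lborel. Y\<^sup>2)"
    by (rule set_integral_mono[OF i kc]) (use Y in \<open>auto intro!: power_mono\<close>)
  also have "\<dots> = 2 * X * Y\<^sup>2" using X by (subst set_integral_const) auto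
  finally have mid: "(LINT x:{-X..X}|lborel. (norm (y x))\<^sup>2) \<le> 2 * X * Y\<^sup>2" .
  have le: "(LINT x:{- real n..real n}|lborel. (norm (y x))\<^sup>2) \<le> 2 * X * Y\<^sup>2 + 2 * T" for n
  proof -
    define N where "N = max (real n) X"
    have N: "real n \<le> N" "X \<le> N" by (auto simp: N_def)
    have "(LINT x:{- real n..real n}|lborel. (norm (y x))\<^sup>2) \<le> (LINT x:{-N..N}|lborel. (norm (y x))\<^sup>2)"
      unfolding set_lebesgue_integral_def
      by (rule integral_mono) (use i N in \<open>auto simp: set_integrable_def indicator_def\<close>)
    also have "\<dots> = (LINT x:{-N..-X}|lborel. (norm (y x))\<^sup>2) + ((LINT x:{-X..X}|lborel. (norm (y x))\<^sup>2) + (LINT x:{X..N}|lborel. (norm (y x))\<^sup>2))"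
      using set_integral_Icc_split[OF i, of "-N" "-X" N] set_integral_Icc_split[OF i, of "-X" X N] N X by simp
    also have "\<dots> \<le> T + (2 * X * Y\<^sup>2 + T)" using N by (intro add_mono mid R L) auto
    finally show ?thesis by simp
  qed
  have nn: "0 \<le> 2 * X * Y\<^sup>2 + 2 * T" using X T0 by simp
  note E = l2I_exhaust[OF borel_measurable_continuous_onI[OF y] i, of "sqrt (2 * X * Y\<^sup>2 + 2 * T)"]
  show "l2 y" "l2norm y \<le> sqrt (2 * X * Y\<^sup>2 + 2 * T)" using E le nn by auto
qed

text \<open>The scalar data of the profile, detached from N. \<open>n_ge\<close> is the trace of
  concavity; \<open>right\<close> and \<open>left\<close> record that h keeps away from 0 with
  opposite signs at the two ends.\<close>

locale kink =
  fixes s c :: real and r n m :: "real \<Rightarrow> real" and \<delta> X \<mu> :: real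
  assumes c: "0 \<le> c" "c < 1" and s_def: "s = sqrt (1 - c\<^sup>2)"
    and r_deriv: "\<And>x. (r has_real_derivative r x * n x / s) (at x)"
    and n_deriv: "\<And>x. (n has_real_derivative - 2 * m x * n x / s) (at x)"
    and m_cont: "continuous_on UNIV m"
    and r_pos: "\<And>x. r x > 0" and r_less: "\<And>x. r x < 1"
    and n_pos: "\<And>x. n x > 0" and n_le: "\<And>x. n x \<le> 1"
    and m_range: "\<And>x. 0 \<le> m x" "\<And>x. m x \<le> \<mu>"
    and n_ge: "\<And>x. 1 - (r x)\<^sup>2 \<le> n x"
    and \<delta>: "\<delta> > 0" and X: "X > 0"
    and right: "\<And>x. x \<ge> X \<Longrightarrow> n x - m x \<le> - \<delta>" and left: "\<And>x. x \<le> - X \<Longrightarrow> n x - m x \<ge> \<delta>"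
begin

section \<open>The integrating factor and its tail integrals\<close>

definition h :: "real \<Rightarrow> real" where "h x = n x - m x"

definition E :: "real \<Rightarrow> real" where "E x = r x * sqrt (n x)"

lemma s_pos: "s > 0" using c by (simp add: s_def power_less_one_iff abs_square_less_1)

lemma s2: "s\<^sup>2 = 1 - c\<^sup>2" using c by (simp add: s_def abs_square_le_1)

lemma n_cont: "continuous_on UNIV n"
  by (rule DERIV_continuous_on) (use n_deriv has_field_derivative_at_within in blast)

lemma h_cont: "continuous_on UNIV h"
  unfolding h_def by (intro continuous_intros n_cont m_cont)

lemma h_bound: "\<bar>h x\<bar> \<le> 1 + \<mu>"
  using n_pos[of x] n_le[of x] m_range[of x] by (auto simp: h_def)

lemma h_right: "x \<ge> X \<Longrightarrow> h x \<le> - \<delta>" and h_left: "x \<le> - X \<Longrightarrow> h x \<ge> \<delta>"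
  using right left by (auto simp: h_def)

lemma E_pos: "E x > 0" using r_pos n_pos by (simp add: E_def)

lemma E_le: "E x \<le> 1"
  using mult_mono[of "r x" 1 "sqrt (n x)" 1] r_pos[of x] r_less[of x] n_pos[of x] n_le[of x] by (simp add: E_def less_imp_le)

lemma E_deriv: "(E has_real_derivative h x * E x / s) (at x)"
proof -
  have "((\<lambda>x. r x * sqrt (n x)) has_real_derivative
     r x * n x / s * sqrt (n x) + (- 2 * m x * n x / s) * (inverse (sqrt (n x)) / 2) * r x) (at x)"
    using n_pos[of x] by (auto intro!: derivative_eq_intros r_deriv n_deriv)
  moreover have "r x * n x / s * sqrt (n x) + (- 2 * m x * n x / s) * (inverse (sqrt (n x)) / 2) * r x = h x * E x / s"
  proof -
    have "n x * inverse (sqrt (n x)) = sqrt (n x)"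
      using n_pos[of x] by (metis less_imp_le real_div_sqrt divide_inverse)
    moreover have "(- 2 * m x * n x / s) * (inverse (sqrt (n x)) / 2) * r x = - m x * r x * (n x * inverse (sqrt (n x))) / s"
      by simp
    ultimately have "(- 2 * m x * n x / s) * (inverse (sqrt (n x)) / 2) * r x = - m x * r x * sqrt (n x) / s"
      by simp
    then show ?thesis by (simp only:) (simp add: h_def E_def ring_distribs diff_divide_distrib mult_ac)
  qed
  ultimately show ?thesis by (simp add: E_def[abs_def])
qed

lemma E_cont: "continuous_on UNIV E"
  by (rule DERIV_continuous_on) (use E_deriv has_field_derivative_at_within in blast)

lemma ac_E: "ac E (\<lambda>x. h x * E x / s)"
  by (rule ac_C1) (use E_deriv in \<open>auto simp: has_real_derivative_iff_has_vector_derivative intro!: continuous_intros E_cont h_cont\<close>, use s_pos in auto)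

lemma ac_invE: "ac (\<lambda>x. 1 / E x) (\<lambda>x. - h x / (s * E x))"
proof (rule ac_C1)
  show "((\<lambda>x. 1 / E x) has_vector_derivative - h x / (s * E x)) (at x)" for x
  proof -
    have "((\<lambda>x. 1 / E x) has_real_derivative (0 * E x - 1 * (h x * E x / s)) / (E x * E x)) (at x)"
      by (intro DERIV_divide DERIV_const E_deriv) (use E_pos[of x] in simp)
    moreover have "(0 * E x - 1 * (h x * E x / s)) / (E x * E x) = - h x / (s * E x)"
      using E_pos[of x] s_pos by (simp add: field_simps)
    ultimately show ?thesis by (simp add: has_real_derivative_iff_has_vector_derivative)
  qed
  show "continuous_on UNIV (\<lambda>x. - h x / (s * E x))"
    by (intro continuous_intros h_cont E_cont) (use s_pos E_pos in \<open>auto simp: less_imp_neq[symmetric]\<close>)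
qed

text \<open>E^2 = r^2 n is an exact derivative, that of s r^2 / 2, by the equation for r.\<close>

lemma E2_integral: "a \<le> b \<Longrightarrow> (LINT x:{a..b}|lborel. (E x)\<^sup>2) = s / 2 * ((r b)\<^sup>2 - (r a)\<^sup>2)"
proof -
  assume ab: "a \<le> b"
  have "ac (\<lambda>x. s / 2 * (r x)\<^sup>2) (\<lambda>x. (E x)\<^sup>2)"
  proof (rule ac_C1)
    fix x
    have "((\<lambda>x. s / 2 * (r x)\<^sup>2) has_real_derivative s / 2 * (2 * r x * (r x * n x / s))) (at x)"
      by (auto intro!: derivative_eq_intros r_deriv)
    moreover have "s / 2 * (2 * r x * (r x * n x / s)) = (E x)\<^sup>2"
      using s_pos n_pos[of x] by (simp add: E_def power_mult_distrib power2_eq_square[of "r x"])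
    ultimately show "((\<lambda>x. s / 2 * (r x)\<^sup>2) has_vector_derivative (E x)\<^sup>2) (at x)"
      by (simp add: has_real_derivative_iff_has_vector_derivative)
  qed (intro continuous_intros E_cont)
  from acD(2)[OF this ab] show ?thesis by (simp add: right_diff_distrib)
qed

lemma E2_integrable: "set_integrable lborel {a..b} (\<lambda>x. (E x)\<^sup>2)"
  by (intro borel_integrable_atLeastAtMost' continuous_intros continuous_on_subset[OF E_cont]) auto

text \<open>The left tail of E^2 is controlled by r^2 and, because 1 - r^2 \<le> n, the right tail
  by n. These are the two factors of E^2 itself, so dividing a tail by E leaves only the other
  factor in the denominator. Empty intervals are included since truncation produces them.\<close>

lemma E2_integral_le: "(LINT x:{a..b}|lborel. (E x)\<^sup>2) \<le> s / 2 * (r b)\<^sup>2" "(LINT x:{a..b}|lborel. (E x)\<^sup>2) \<le> s / 2 * n a"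
proof -
  have r1: "(r b)\<^sup>2 \<le> 1" using r_pos[of b] r_less[of b] by (simp add: power_le_one)
  show "(LINT x:{a..b}|lborel. (E x)\<^sup>2) \<le> s / 2 * (r b)\<^sup>2" using E2_integral[of a b] s_pos
    by (cases "a \<le> b") (auto simp: set_lebesgue_integral_def intro!: mult_left_mono)
  show "(LINT x:{a..b}|lborel. (E x)\<^sup>2) \<le> s / 2 * n a" using E2_integral[of a b] s_pos r1 n_ge[of a] n_pos[of a]
    by (cases "a \<le> b") (auto simp: set_lebesgue_integral_def intro!: mult_left_mono)
qed

lemma E_measurable [measurable]: "E \<in> borel_measurable borel"
  by (rule borel_measurable_continuous_onI[OF E_cont])

lemma r_mono: "a \<le> b \<Longrightarrow> r a \<le> r b"
  by (rule DERIV_nonneg_imp_nondecreasing) (use r_deriv r_pos n_pos s_pos in \<open>auto intro!: exI simp: less_imp_le\<close>)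

lemma n_mono: "a \<le> b \<Longrightarrow> n b \<le> n a"
  by (rule DERIV_nonpos_imp_nonincreasing) (use n_deriv n_pos m_range s_pos in \<open>auto intro!: exI simp: less_imp_le divide_le_0_iff mult_nonneg_nonneg\<close>)

lemma E_l2_indicator:
  "l2 (\<lambda>t. indicator {..x} t *\<^sub>R E t)" "l2norm (\<lambda>t. indicator {..x} t *\<^sub>R E t) \<le> sqrt (s / 2) * r x"
  "l2 (\<lambda>t. indicator {x..} t *\<^sub>R E t)" "l2norm (\<lambda>t. indicator {x..} t *\<^sub>R E t) \<le> sqrt (s / 2) * sqrt (n x)"
proof -
  have e1: "(\<lambda>t. indicator {a..b} t *\<^sub>R (norm (indicator {..x} t *\<^sub>R E t))\<^sup>2) = (\<lambda>t. indicator {a..min b x} t *\<^sub>R (E t)\<^sup>2)" for a b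
    by (auto simp: indicator_def fun_eq_iff)
  have e2: "(\<lambda>t. indicator {a..b} t *\<^sub>R (norm (indicator {x..} t *\<^sub>R E t))\<^sup>2) = (\<lambda>t. indicator {max a x..b} t *\<^sub>R (E t)\<^sup>2)" for a b
    by (auto simp: indicator_def fun_eq_iff)
  have i1: "set_integrable lborel {a..b} (\<lambda>t. (norm (indicator {..x} t *\<^sub>R E t))\<^sup>2)" for a b
    unfolding set_integrable_def e1 using E2_integrable by (simp add: set_integrable_def)
  have i2: "set_integrable lborel {a..b} (\<lambda>t. (norm (indicator {x..} t *\<^sub>R E t))\<^sup>2)" for a b
    unfolding set_integrable_def e2 using E2_integrable by (simp add: set_integrable_def)
  have b1: "(LINT t:{a..b}|lborel. (norm (indicator {..x} t *\<^sub>R E t))\<^sup>2) \<le> (sqrt (s / 2) * r x)\<^sup>2" for a b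
  proof -
    have "(LINT t:{a..b}|lborel. (norm (indicator {..x} t *\<^sub>R E t))\<^sup>2) = (LINT t:{a..min b x}|lborel. (E t)\<^sup>2)"
      unfolding set_lebesgue_integral_def e1 ..
    also have "\<dots> \<le> s / 2 * (r (min b x))\<^sup>2" by (rule E2_integral_le)
    also have "\<dots> \<le> s / 2 * (r x)\<^sup>2" using s_pos r_pos[of "min b x"] by (intro mult_left_mono power_mono r_mono) auto
    finally show ?thesis using s_pos by (simp add: power_mult_distrib)
  qed
  have b2: "(LINT t:{a..b}|lborel. (norm (indicator {x..} t *\<^sub>R E t))\<^sup>2) \<le> (sqrt (s / 2) * sqrt (n x))\<^sup>2" for a b
  proof -
    have "(LINT t:{a..b}|lborel. (norm (indicator {x..} t *\<^sub>R E t))\<^sup>2) = (LINT t:{max a x..b}|lborel. (E t)\<^sup>2)"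
      unfolding set_lebesgue_integral_def e2 ..
    also have "\<dots> \<le> s / 2 * n (max a x)" by (rule E2_integral_le)
    also have "\<dots> \<le> s / 2 * n x" using s_pos by (intro mult_left_mono n_mono) auto
    finally show ?thesis using s_pos n_pos[of x] by (simp add: power_mult_distrib)
  qed
  have m1: "(\<lambda>t. indicator {..x} t *\<^sub>R E t) \<in> borel_measurable borel" by measurable
  have m2: "(\<lambda>t. indicator {x..} t *\<^sub>R E t) \<in> borel_measurable borel" by measurable
  have p1: "0 \<le> sqrt (s / 2) * r x" using r_pos[of x] s_pos by simp
  have p2: "0 \<le> sqrt (s / 2) * sqrt (n x)" using n_pos[of x] s_pos by simp
  show "l2 (\<lambda>t. indicator {..x} t *\<^sub>R E t)" "l2norm (\<lambda>t. indicator {..x} t *\<^sub>R E t) \<le> sqrt (s / 2) * r x"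
    by (rule l2I_exhaust[OF m1 i1 b1 p1])+
  show "l2 (\<lambda>t. indicator {x..} t *\<^sub>R E t)" "l2norm (\<lambda>t. indicator {x..} t *\<^sub>R E t) \<le> sqrt (s / 2) * sqrt (n x)"
    by (rule l2I_exhaust[OF m2 i2 b2 p2])+
qed

lemma l2_E: "l2 E"
proof (rule l2I_exhaust(1)[where C = "sqrt (s / 2)"])
  show "(LINT x:{- real k..real k}|lborel. (norm (E x))\<^sup>2) \<le> (sqrt (s / 2))\<^sup>2" for k
  proof -
    have "(r (real k))\<^sup>2 \<le> 1" using r_pos[of "real k"] r_less[of "real k"] by (simp add: power_le_one)
    then have "s / 2 * (r (real k))\<^sup>2 \<le> s / 2 * 1" using s_pos by (intro mult_left_mono) auto
    with E2_integral_le(1)[of "- real k" "real k"]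
    have "(LINT x:{- real k..real k}|lborel. (E x)\<^sup>2) \<le> s / 2" by linarith
    then show ?thesis using s_pos by simp
  qed
qed (use E2_integrable s_pos in auto)

section \<open>Solvability and uniqueness for the two scalar equations\<close>

lemma l2_h: assumes "l2 f" shows "l2 (\<lambda>x. h x *\<^sub>R f x)"
proof (rule l2_bound(1)[OF assms])
  note [measurable] = l2D(1)[OF assms] borel_measurable_continuous_onI[OF h_cont]
  show "(\<lambda>x. h x *\<^sub>R f x) \<in> borel_measurable borel" by measurable
  show "AE x in lborel. norm (h x *\<^sub>R f x) \<le> (1 + \<mu>) * norm (f x)"
    by (rule AE_I2) (simp add: mult_right_mono h_bound)
  show "0 \<le> 1 + \<mu>" using h_bound[of 0] by linarith
qed

lemma EF_integrable:
  fixes F :: "real \<Rightarrow> 'a::euclidean_space"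
  assumes "l2 F"
  shows "integrable lborel (\<lambda>x. E x *\<^sub>R F x)" "norm (\<integral>x. E x *\<^sub>R F x \<partial>lborel) \<le> l2norm E * l2norm F"
proof -
  note [measurable] = l2D(1)[OF assms]
  have m: "(\<lambda>x. E x *\<^sub>R F x) \<in> borel_measurable borel" by measurable
  show "integrable lborel (\<lambda>x. E x *\<^sub>R F x)" "norm (\<integral>x. E x *\<^sub>R F x \<partial>lborel) \<le> l2norm E * l2norm F"
    using l2_mult_integrable[OF l2_E assms m, of 1] by auto
qed

text \<open>With the integrating factor E the equation reads (E D)' = E F / s. The homogeneous
  solution 1 / E is not square integrable, so E D has to vanish at both ends, which is the integral
  condition on F; under it the solution is explicit and bounded.\<close>

lemma solve_decaying:
  "\<exists>C\<ge>0. \<forall>F :: real \<Rightarrow> 'a::euclidean_space. l2 F \<longrightarrow> (\<integral>x. E x *\<^sub>R F x \<partial>lborel) = 0 \<longrightarrow>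
     (\<exists>D D1. h1 D D1 \<and> (\<forall>x. s *\<^sub>R D1 x + h x *\<^sub>R D x = F x) \<and> l2norm D \<le> C * l2norm F)"
proof -
  \<comment> \<open>On a tail the boundary terms cost at most the square of the norm of F and the
    source costs that square over \<delta>; dividing by \<delta> gives \<open>k2\<close>. In
    \<open>C\<close> the middle interval adds its length 2 X times the pointwise bound 1 /
    s.\<close>
  define k2 where "k2 = (1 + 1 / \<delta>) / \<delta>"
  define C where "C = sqrt (2 * X * (1 / s) + 2 * k2)"
  have k2: "k2 \<ge> 0" using \<delta> by (simp add: k2_def)
  have main: "\<exists>D D1. h1 D D1 \<and> (\<forall>x. s *\<^sub>R D1 x + h x *\<^sub>R D x = F x) \<and> l2norm D \<le> C * l2norm F"
    if F: "l2 F" and orth: "(\<integral>x. E x *\<^sub>R F x \<partial>lborel) = 0" for F :: "real \<Rightarrow> 'a"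
  proof -
    note [measurable] = l2D(1)[OF F]
    let ?g = "\<lambda>x. (1 / s) *\<^sub>R (E x *\<^sub>R F x)"
    have ig: "integrable lborel ?g" by (rule integrable_scaleR_right[OF EF_integrable(1)[OF F]])
    define I where "I x = (LINT t:{..x}|lborel. ?g t)" for x
    have acI: "ac I ?g" unfolding ac_def
    proof (intro conjI allI impI)
      show "set_integrable lborel {a..b} ?g" for a b
        unfolding set_integrable_def using ig by (intro integrable_mult_indicator) auto
      show "(LINT x:{a..b}|lborel. ?g x) = I b - I a" if "a \<le> b" for a b
        unfolding I_def using set_integral_split_real(2)[OF ig that] by (metis add_diff_cancel_left')
    qed
    have I1: "norm (I x) \<le> 1 / s * (sqrt (s / 2) * r x * l2norm F)" for x
    proof -
      have "norm (I x) \<le> 1 / s * (l2norm (\<lambda>t. indicator {..x} t *\<^sub>R E t) * l2norm F)"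
        unfolding I_def set_lebesgue_integral_def
        by (rule l2_mult_integrable(2)[OF E_l2_indicator(1) F]) (use s_pos in \<open>auto simp: indicator_def\<close>)
      also have "\<dots> \<le> 1 / s * (sqrt (s / 2) * r x * l2norm F)"
        using s_pos by (intro mult_left_mono mult_right_mono E_l2_indicator) auto
      finally show ?thesis .
    qed
    \<comment> \<open>The vanishing integral turns the antiderivative anchored at the left end into
      minus the one anchored at the right end, so the right tail of E can be used as well.\<close>
    have I2: "norm (I x) \<le> 1 / s * (sqrt (s / 2) * sqrt (n x) * l2norm F)" for x
    proof -
      have "(\<integral>x. ?g x \<partial>lborel) = 0" unfolding integral_scaleR_right orth by simp
      then have "I x = - (LINT t:{x..}|lborel. ?g t)"
        unfolding I_def using set_integral_split_real(1)[OF ig, of x] by (simp add: eq_neg_iff_add_eq_0)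
      then have "norm (I x) = norm (LINT t:{x..}|lborel. ?g t)" by simp
      also have "\<dots> \<le> 1 / s * (l2norm (\<lambda>t. indicator {x..} t *\<^sub>R E t) * l2norm F)"
        unfolding set_lebesgue_integral_def
        by (rule l2_mult_integrable(2)[OF E_l2_indicator(3) F]) (use s_pos in \<open>auto simp: indicator_def\<close>)
      also have "\<dots> \<le> 1 / s * (sqrt (s / 2) * sqrt (n x) * l2norm F)"
        using s_pos by (intro mult_left_mono mult_right_mono E_l2_indicator) auto
      finally show ?thesis .
    qed
    define D where "D x = (1 / E x) *\<^sub>R I x" for x
    define D1 where "D1 x = (1 / E x) *\<^sub>R ?g x + (- h x / (s * E x)) *\<^sub>R I x" for x
    have acD': "ac D D1" unfolding D_def D1_def by (rule ac_scaleR[OF ac_invE acI])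
    have eq: "s *\<^sub>R D1 x + h x *\<^sub>R D x = F x" for x
      using E_pos[of x] s_pos by (simp add: D_def D1_def scaleR_add_right scaleR_diff_right)
    \<comment> \<open>The two bounds on the antiderivative are good at the two ends; by \<open>1 - r\<^sup>2 \<le> n\<close> one of them always works.\<close>
    have Db: "norm (D x) \<le> l2norm F / sqrt s" for x
    proof -
      \<comment> \<open>\<open>u\<close> is the factor of E that bounds the tail integral and
        \<open>v\<close> the other one; the tail factor cancels and v^2 \<ge> 1/2 bounds what is
        left.\<close>
      have key: "norm (D x) \<le> l2norm F / sqrt s"
        if "norm (I x) \<le> 1 / s * (sqrt (s / 2) * u * l2norm F)" "E x = u * v" "1 / 2 \<le> v\<^sup>2" "0 < u" "0 < v" for u v
      proof -
        have "norm (D x) = norm (I x) / (u * v)" using that by (simp add: D_def)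
        also have "\<dots> \<le> (1 / s * (sqrt (s / 2) * u * l2norm F)) / (u * v)"
          using that by (intro divide_right_mono) auto
        also have "\<dots> = l2norm F / s * sqrt (s / 2) * (1 / v)" using that by simp
        also have "\<dots> \<le> l2norm F / s * sqrt (s / 2) * sqrt 2"
        proof (intro mult_left_mono)
          have "1 / 2 \<le> v\<^sup>2" by fact
          then have "sqrt (1 / 2) \<le> v" using that(5) by (simp add: real_le_lsqrt real_le_rsqrt)
          then have "1 \<le> v * sqrt 2" by (simp add: real_sqrt_divide field_simps)
          then show "1 / v \<le> sqrt 2" using that(5) by (simp add: field_simps)
        qed (use s_pos in auto)
        also have "\<dots> = l2norm F / sqrt s"
          using s_pos by (simp add: real_sqrt_divide field_simps)
        finally show ?thesis .
      qed
      show ?thesis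
      proof (cases "(r x)\<^sup>2 \<ge> 1 / 2")
        case True
        then show ?thesis using key[OF I2, of "r x"] n_pos r_pos by (simp add: E_def mult.commute)
      next
        case False
        then have "n x \<ge> 1 / 2" using n_ge[of x] by simp
        then show ?thesis using key[OF I1, of "sqrt (n x)"] n_pos r_pos by (simp add: E_def less_imp_le)
      qed
    qed
    have Db2: "s * (norm (D x))\<^sup>2 \<le> (l2norm F)\<^sup>2" for x
    proof -
      have "(norm (D x))\<^sup>2 \<le> (l2norm F / sqrt s)\<^sup>2" by (rule power_mono[OF Db]) simp
      then show ?thesis using s_pos by (simp add: power_divide field_simps)
    qed
    have eq': "s *\<^sub>R D1 x = (- h x) *\<^sub>R D x + F x" for x using eq[of x] by (simp add: algebra_simps)
    \<comment> \<open>Outward the equation for D is expanding, so the boundary term at the far end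
      has the unfavourable sign. The pointwise bound \<open>Db2\<close>, valid on the whole line,
      controls it.\<close>
    have t: "(LINT x:{a..b}|lborel. (norm (D x))\<^sup>2) \<le> k2 * (l2norm F)\<^sup>2"
      if ab: "a \<le> b" and sg: "\<bar>\<sigma>\<bar> = 1" "\<And>x. x \<in> {a..b} \<Longrightarrow> \<sigma> * (- h x) \<le> - \<delta>" for a b \<sigma>
    proof -
      have "\<delta> * (LINT x:{a..b}|lborel. (norm (D x))\<^sup>2) \<le> \<sigma> * s * ((norm (D a))\<^sup>2 - (norm (D b))\<^sup>2) + (l2norm F)\<^sup>2 / \<delta>"
        by (rule energy_estimate[OF ab acD' eq' F sg \<delta>])
      also have "\<sigma> * s * ((norm (D a))\<^sup>2 - (norm (D b))\<^sup>2) \<le> (l2norm F)\<^sup>2"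
      proof -
        have "\<sigma> = 1 \<or> \<sigma> = - 1" using sg(1) by linarith
        moreover have "0 \<le> s * (norm (D x))\<^sup>2" for x using s_pos by simp
        ultimately show ?thesis using Db2[of a] Db2[of b]
          by (smt (verit) mult_minus_left mult_cancel_right1 right_diff_distrib mult_minus1)
      qed
      finally show ?thesis using \<delta> by (simp add: k2_def field_simps)
    qed
    have "l2 D \<and> l2norm D \<le> sqrt (2 * X * (l2norm F / sqrt s)\<^sup>2 + 2 * (k2 * (l2norm F)\<^sup>2))"
      using l2_from_tails[OF ac_continuous[OF acD'], of X "l2norm F / sqrt s" "k2 * (l2norm F)\<^sup>2"] X Db
        t[of X _ "-1"] t[of _ "-X" 1] h_right h_left by force
    moreover have "2 * X * (l2norm F / sqrt s)\<^sup>2 + 2 * (k2 * (l2norm F)\<^sup>2) = (2 * X * (1 / s) + 2 * k2) * (l2norm F)\<^sup>2"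
      using s_pos by (simp add: power_divide algebra_simps)
    ultimately have lD: "l2 D" and bD: "l2norm D \<le> C * l2norm F"
      by (auto simp: C_def real_sqrt_mult)
    have "D1 = (\<lambda>x. (1 / s) *\<^sub>R (F x - h x *\<^sub>R D x))"
    proof
      fix x
      have "D1 x = (1 / s) *\<^sub>R (s *\<^sub>R D1 x)" using s_pos by simp
      also have "s *\<^sub>R D1 x = F x - h x *\<^sub>R D x" using eq[of x] by (simp add: algebra_simps)
      finally show "D1 x = (1 / s) *\<^sub>R (F x - h x *\<^sub>R D x)" .
    qed
    then have "l2 D1" using l2_linear[OF bounded_linear_scaleR_right l2_diff[OF F l2_h[OF lD]], of "1 / s"] by simp
    then show ?thesis using lD bD acD' eq by (auto simp: h1_def)
  qed
  show ?thesis by (intro exI[of _ C] conjI allI impI main) (use k2 X s_pos in \<open>auto simp: C_def\<close>)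
qed

text \<open>Here E itself solves the homogeneous equation and decays at both ends, so there is no
  condition on G, and the solution is fixed by vanishing at 0. It is estimated directly on the
  middle interval and carried outward by damping.\<close>

lemma solve_growing:
  "\<exists>C\<ge>0. \<forall>G :: real \<Rightarrow> 'a::euclidean_space. l2 G \<longrightarrow>
     (\<exists>P P1. h1 P P1 \<and> (\<forall>x. s *\<^sub>R P1 x - h x *\<^sub>R P x = G x) \<and> l2norm P \<le> C * l2norm G)"
proof -
  have "\<exists>x\<in>{-X..X}. \<forall>y\<in>{-X..X}. E x \<le> E y"
    by (rule continuous_attains_inf) (use X E_cont continuous_on_subset in auto)
  then obtain x0 where x0: "\<And>y. y \<in> {-X..X} \<Longrightarrow> E x0 \<le> E y" by blast
  define e where "e = E x0"
  have e: "e > 0" "\<And>y. y \<in> {-X..X} \<Longrightarrow> e \<le> E y" using E_pos x0 by (auto simp: e_def)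
  \<comment> \<open>Cauchy-Schwarz for the integral of G / (s E) over a part of the middle interval,
    where E is at least \<open>e\<close>.\<close>
  define k1 where "k1 = sqrt (2 * X) / (s * e)"
  have k1: "k1 \<ge> 0" using s_pos e X by (simp add: k1_def)
  define k2 where "k2 = (s * k1\<^sup>2 + 1 / \<delta>) / \<delta>"
  have k2: "k2 \<ge> 0" using \<delta> s_pos by (simp add: k2_def)
  define C where "C = sqrt (2 * X * k1\<^sup>2 + 2 * k2)"
  have main: "\<exists>P P1. h1 P P1 \<and> (\<forall>x. s *\<^sub>R P1 x - h x *\<^sub>R P x = G x) \<and> l2norm P \<le> C * l2norm G"
    if G: "l2 G" for G :: "real \<Rightarrow> 'a"
  proof -
    let ?g = "\<lambda>x. (1 / (s * E x)) *\<^sub>R G x"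
    have iE: "continuous_on UNIV (\<lambda>x. 1 / (s * E x))"
      by (intro continuous_intros E_cont) (use s_pos E_pos in \<open>auto simp: less_imp_neq[symmetric]\<close>)
    have ig: "set_integrable lborel {a..b} ?g" for a b
      by (rule set_integrable_cont_mult[OF bounded_bilinear_scaleR iE l2_set_integrable(1)[OF G]])
    obtain I where I0: "I 0 = 0" and acI: "ac I ?g" using ac_indefinite[OF ig] by blast
    define P where "P x = E x *\<^sub>R I x" for x
    define P1 where "P1 x = E x *\<^sub>R ?g x + (h x * E x / s) *\<^sub>R I x" for x
    have acP: "ac P P1" unfolding P_def P1_def by (rule ac_scaleR[OF ac_E acI])
    have eq: "s *\<^sub>R P1 x - h x *\<^sub>R P x = G x" for x
      using E_pos[of x] s_pos by (simp add: P_def P1_def scaleR_add_right)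
    have Pb: "norm (P x) \<le> k1 * l2norm G" if x: "x \<in> {-X..X}" for x
    proof -
      have kg: "set_integrable lborel {a..b} (\<lambda>t. 1 / (s * e) * norm (G t))" for a b
        by (intro set_integrable_mult_right l2_set_integrable(2) G)
      have gb: "norm (?g t) \<le> 1 / (s * e) * norm (G t)" if t: "t \<in> {-X..X}" for t
        using e(2)[OF t] e(1) E_pos[of t] s_pos by (auto intro!: mult_right_mono divide_left_mono)
      have *: "norm (I b - I a) \<le> k1 * l2norm G" if "a \<le> b" "-X \<le> a" "b \<le> X" for a b
      proof -
        have "norm (I b - I a) \<le> (LINT t:{a..b}|lborel. 1 / (s * e) * norm (G t))"
          unfolding acD(2)[OF acI that(1), symmetric]
          by (rule set_integral_le_bound[OF ig kg gb]) (use that in auto)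
        also have "\<dots> = 1 / (s * e) * (LINT t:{a..b}|lborel. norm (G t))"
          by (rule set_integral_mult_right)
        also have "\<dots> \<le> 1 / (s * e) * (sqrt (b - a) * l2norm G)"
          using s_pos e by (intro mult_left_mono l2_set_lebesgue_bound[OF G that(1)]) auto
        also have "\<dots> \<le> 1 / (s * e) * (sqrt (2 * X) * l2norm G)"
          using s_pos e that by (intro mult_left_mono mult_right_mono) auto
        finally show ?thesis by (simp add: k1_def)
      qed
      have "norm (I x) \<le> k1 * l2norm G"
        using *[of 0 x] *[of x 0] I0 x X by (cases "0 \<le> x") auto
      moreover have "norm (P x) \<le> 1 * norm (I x)"
        unfolding P_def using E_pos[of x] E_le[of x] by (simp add: mult_left_le_one_le)
      ultimately show ?thesis by simp
    qed
    have Pb2: "s * (norm (P x))\<^sup>2 \<le> s * k1\<^sup>2 * (l2norm G)\<^sup>2" if x: "x \<in> {-X..X}" for x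
      using power_mono[OF Pb[OF x], of 2] s_pos by (simp add: power_mult_distrib)
    have eq': "s *\<^sub>R P1 x = h x *\<^sub>R P x + G x" for x using eq[of x] by (simp add: algebra_simps)
    \<comment> \<open>To the right of X the equation for P is damped: the boundary term at b is
      nonpositive and dropped, the one at X is bounded by \<open>Pb2\<close>. The left tail is the
      mirror image.\<close>
    have R: "(LINT x:{X..b}|lborel. (norm (P x))\<^sup>2) \<le> k2 * (l2norm G)\<^sup>2" if "X \<le> b" for b
    proof -
      have "\<delta> * (LINT x:{X..b}|lborel. (norm (P x))\<^sup>2) \<le> 1 * s * ((norm (P X))\<^sup>2 - (norm (P b))\<^sup>2) + (l2norm G)\<^sup>2 / \<delta>"
        by (rule energy_estimate[OF that acP eq' G _ _ \<delta>]) (use h_right in auto)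
      also have "\<dots> \<le> s * k1\<^sup>2 * (l2norm G)\<^sup>2 + (l2norm G)\<^sup>2 / \<delta>"
        
      proof -
        have "s * (norm (P X))\<^sup>2 \<le> s * k1\<^sup>2 * (l2norm G)\<^sup>2" by (rule Pb2) (use X in simp)
        moreover have "0 \<le> s * (norm (P b))\<^sup>2" using s_pos by simp
        ultimately show ?thesis unfolding mult_1 right_diff_distrib by linarith
      qed
      finally show ?thesis using \<delta> by (simp add: k2_def field_simps)
    qed
    have L: "(LINT x:{a..-X}|lborel. (norm (P x))\<^sup>2) \<le> k2 * (l2norm G)\<^sup>2" if "a \<le> -X" for a
    proof -
      have "\<delta> * (LINT x:{a..-X}|lborel. (norm (P x))\<^sup>2) \<le> (-1) * s * ((norm (P a))\<^sup>2 - (norm (P (-X)))\<^sup>2) + (l2norm G)\<^sup>2 / \<delta>"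
        by (rule energy_estimate[OF that acP eq' G _ _ \<delta>]) (use h_left in auto)
      also have "\<dots> \<le> s * k1\<^sup>2 * (l2norm G)\<^sup>2 + (l2norm G)\<^sup>2 / \<delta>"
        
      proof -
        have "s * (norm (P (-X)))\<^sup>2 \<le> s * k1\<^sup>2 * (l2norm G)\<^sup>2" by (rule Pb2) (use X in simp)
        moreover have "0 \<le> s * (norm (P a))\<^sup>2" using s_pos by simp
        ultimately show ?thesis unfolding mult_minus1 right_diff_distrib mult_minus_left by linarith
      qed
      finally show ?thesis using \<delta> by (simp add: k2_def field_simps)
    qed
    have "l2 P \<and> l2norm P \<le> sqrt (2 * X * (k1 * l2norm G)\<^sup>2 + 2 * (k2 * (l2norm G)\<^sup>2))"
      using l2_from_tails[OF ac_continuous[OF acP] _ Pb R L] X by simp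
    moreover have "2 * X * (k1 * l2norm G)\<^sup>2 + 2 * (k2 * (l2norm G)\<^sup>2) = (2 * X * k1\<^sup>2 + 2 * k2) * (l2norm G)\<^sup>2"
      by (simp add: power_mult_distrib algebra_simps)
    ultimately have lP: "l2 P" and bP: "l2norm P \<le> C * l2norm G"
      by (auto simp: C_def real_sqrt_mult)
    have "P1 = (\<lambda>x. (1 / s) *\<^sub>R (h x *\<^sub>R P x + G x))"
    proof
      fix x
      have "P1 x = (1 / s) *\<^sub>R (s *\<^sub>R P1 x)" using s_pos by simp
      then show "P1 x = (1 / s) *\<^sub>R (h x *\<^sub>R P x + G x)" unfolding eq' .
    qed
    then have "l2 P1" using l2_linear[OF bounded_linear_scaleR_right l2_plus[OF l2_h[OF lP] G], of "1 / s"] by simp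
    then show ?thesis using lP bP acP eq by (auto simp: h1_def)
  qed
  show ?thesis by (intro exI[of _ C] conjI allI impI main) (use k2 X in \<open>auto simp: C_def\<close>)
qed

text \<open>E D is constant and E \<le> 1, so a nonzero constant would keep |D| bounded below on the
  whole line, contradicting square integrability.\<close>

lemma unique_decaying:
  fixes D :: "real \<Rightarrow> 'a::euclidean_space"
  assumes D: "h1 D D1" and eq: "AE x in lborel. s *\<^sub>R D1 x + h x *\<^sub>R D x = 0"
  shows "D x = 0"
proof -
  have "ac (\<lambda>x. E x *\<^sub>R D x) (\<lambda>x. E x *\<^sub>R D1 x + (h x * E x / s) *\<^sub>R D x)"
    by (rule ac_scaleR[OF ac_E h1D(3)[OF D]])
  then have "ac (\<lambda>x. E x *\<^sub>R D x) (\<lambda>x. 0)"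
  proof (rule ac_cong_AE)
    show "AE x in lborel. E x *\<^sub>R D1 x + (h x * E x / s) *\<^sub>R D x = 0" using eq
    proof eventually_elim
      case (elim x)
      have "E x *\<^sub>R D1 x + (h x * E x / s) *\<^sub>R D x = (E x / s) *\<^sub>R (s *\<^sub>R D1 x + h x *\<^sub>R D x)"
        using s_pos by (simp add: scaleR_add_right mult.commute)
      then show ?case using elim by simp
    qed
  qed simp
  from ac_zero_imp_const[OF this] have const: "E x *\<^sub>R D x = E 0 *\<^sub>R D 0" for x .
  have "norm (E 0 *\<^sub>R D 0) = 0"
  proof (rule ccontr)
    assume "norm (E 0 *\<^sub>R D 0) \<noteq> 0"
    then have k: "norm (E 0 *\<^sub>R D 0) > 0" by simp
    define k where "k = norm (E 0 *\<^sub>R D 0)"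
    have "k \<le> norm (D x)" for x
    proof -
      have "k = E x * norm (D x)" unfolding k_def const[of x, symmetric] using E_pos[of x] by simp
      also have "\<dots> \<le> 1 * norm (D x)" by (rule mult_right_mono[OF E_le]) simp
      finally show ?thesis by simp
    qed
    then have kk: "k\<^sup>2 \<le> (norm (D x))\<^sup>2" for x using k by (auto simp: k_def intro!: power_mono)
    have "integrable lborel (\<lambda>x::real. k\<^sup>2)"
      by (rule Bochner_Integration.integrable_bound[OF l2D(2)[OF h1D(1)[OF D]]]) (use kk in auto)
    then have "k\<^sup>2 = 0" by (rule integrable_limit_zero) simp
    then have "k = 0" by simp
    then show False using k unfolding k_def by (metis less_irrefl)
  qed
  then have "E x *\<^sub>R D x = 0" unfolding const[of x] by (simp only: norm_eq_zero)
  then show ?thesis using E_pos[of x] by simp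
qed

lemma unique_growing:
  fixes P :: "real \<Rightarrow> 'a::euclidean_space"
  assumes P: "ac P P1" and eq: "AE x in lborel. s *\<^sub>R P1 x - h x *\<^sub>R P x = 0"
  obtains k where "\<And>x. P x = E x *\<^sub>R k"
proof -
  have "ac (\<lambda>x. (1 / E x) *\<^sub>R P x) (\<lambda>x. (1 / E x) *\<^sub>R P1 x + (- h x / (s * E x)) *\<^sub>R P x)"
    by (rule ac_scaleR[OF ac_invE P])
  then have "ac (\<lambda>x. (1 / E x) *\<^sub>R P x) (\<lambda>x. 0)"
  proof (rule ac_cong_AE)
    show "AE x in lborel. (1 / E x) *\<^sub>R P1 x + (- h x / (s * E x)) *\<^sub>R P x = 0" using eq
    proof eventually_elim
      case (elim x)
      have "(1 / E x) *\<^sub>R P1 x + (- h x / (s * E x)) *\<^sub>R P x = (1 / (s * E x)) *\<^sub>R (s *\<^sub>R P1 x - h x *\<^sub>R P x)"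
        using s_pos by (simp add: scaleR_diff_right)
      then show ?case using elim by simp
    qed
  qed simp
  from ac_zero_imp_const[OF this] have const: "(1 / E x) *\<^sub>R P x = (1 / E 0) *\<^sub>R P 0" for x .
  have "P x = E x *\<^sub>R ((1 / E 0) *\<^sub>R P 0)" for x
    unfolding const[of x, symmetric] using E_pos[of x] by simp
  then show ?thesis by (rule that)
qed

text \<open>The integrand is s times the derivative of E D. Hence the condition in
  \<open>solve_decaying\<close> is necessary as well as sufficient.\<close>

lemma range_orthogonal:
  fixes D :: "real \<Rightarrow> 'a::euclidean_space"
  assumes D: "h1 D D1"
  shows "(\<integral>x. E x *\<^sub>R (s *\<^sub>R D1 x + h x *\<^sub>R D x) \<partial>lborel) = 0"
proof (rule integral_derivative_zero[where f = "\<lambda>x. s *\<^sub>R (E x *\<^sub>R D x)"])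
  show "integrable lborel (\<lambda>x. s *\<^sub>R (E x *\<^sub>R D x))" 
    by (rule integrable_scaleR_right[OF EF_integrable(1)[OF h1D(1)[OF D]]])
  show "integrable lborel (\<lambda>x. E x *\<^sub>R (s *\<^sub>R D1 x + h x *\<^sub>R D x))"
    by (intro EF_integrable(1) l2_plus l2_h l2_linear[OF bounded_linear_scaleR_right] h1D[OF D])
  have "ac (\<lambda>x. s *\<^sub>R (E x *\<^sub>R D x)) (\<lambda>x. s *\<^sub>R (E x *\<^sub>R D1 x + (h x * E x / s) *\<^sub>R D x))"
    by (rule ac_linear[OF bounded_linear_scaleR_right ac_scaleR[OF ac_E h1D(3)[OF D]]])
  moreover have "s *\<^sub>R (E x *\<^sub>R D1 x + (h x * E x / s) *\<^sub>R D x) = E x *\<^sub>R (s *\<^sub>R D1 x + h x *\<^sub>R D x)" for x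
    using s_pos by (simp add: scaleR_add_right mult.commute)
  ultimately show "ac (\<lambda>x. s *\<^sub>R (E x *\<^sub>R D x)) (\<lambda>x. E x *\<^sub>R (s *\<^sub>R D1 x + h x *\<^sub>R D x))" by simp
qed

end

section \<open>The linearization in characteristic variables\<close>

lemma norm_fst_le_norm: "norm (fst v) \<le> norm v" and norm_snd_le_norm: "norm (snd v) \<le> norm v"
  using Product_Vector.norm_fst_le[of "fst v" "snd v"] Product_Vector.norm_snd_le[of "snd v" "fst v"] by auto

lemma l2_Pair:
  fixes f :: "real \<Rightarrow> 'a::euclidean_space" and g :: "real \<Rightarrow> 'b::euclidean_space"
  assumes "l2 f" "l2 g"
  shows "l2 (\<lambda>x. (f x, g x))" "l2norm (\<lambda>x. (f x, g x)) \<le> l2norm f + l2norm g"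
proof -
  have e: "(\<lambda>x. (f x, g x)) = (\<lambda>x. (f x, 0) + (0, g x))" by simp
  have 1: "l2 (\<lambda>x. (f x, 0::'b))"
    by (rule l2_linear[OF bounded_linear_Pair[OF bounded_linear_ident bounded_linear_zero] assms(1)])
  have 2: "l2 (\<lambda>x. (0::'a, g x))"
    by (rule l2_linear[OF bounded_linear_Pair[OF bounded_linear_zero bounded_linear_ident] assms(2)])
  show "l2 (\<lambda>x. (f x, g x))" unfolding e by (rule l2_plus[OF 1 2])
  show "l2norm (\<lambda>x. (f x, g x)) \<le> l2norm f + l2norm g"
    using l2norm_triangle[OF 1 2, folded e] by (simp add: l2norm_def norm_Pair)
qed

lemma l2_component:
  fixes f :: "real \<Rightarrow> 'a::euclidean_space \<times> 'b::euclidean_space"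
  assumes "l2 f"
  shows "l2 (\<lambda>x. fst (f x))" "l2norm (\<lambda>x. fst (f x)) \<le> l2norm f"
    "l2 (\<lambda>x. snd (f x))" "l2norm (\<lambda>x. snd (f x)) \<le> l2norm f"
proof -
  show 1: "l2 (\<lambda>x. fst (f x))" and 2: "l2 (\<lambda>x. snd (f x))"
    using l2_linear[OF bounded_linear_fst assms] l2_linear[OF bounded_linear_snd assms] by auto
  have "AE x in lborel. norm (fst (f x)) \<le> 1 * norm (f x)" "AE x in lborel. norm (snd (f x)) \<le> 1 * norm (f x)"
    by (rule AE_I2, simp add: norm_fst_le_norm norm_snd_le_norm)+
  from l2_bound(2)[OF assms l2D(1)[OF 1] this(1)] l2_bound(2)[OF assms l2D(1)[OF 2] this(2)]
  show "l2norm (\<lambda>x. fst (f x)) \<le> l2norm f" "l2norm (\<lambda>x. snd (f x)) \<le> l2norm f" by auto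
qed

lemma h1_Pair:
  fixes f :: "real \<Rightarrow> 'a::euclidean_space" and g :: "real \<Rightarrow> 'b::euclidean_space"
  assumes "h1 f f'" "h1 g g'"
  shows "h1 (\<lambda>x. (f x, g x)) (\<lambda>x. (f' x, g' x))"
  using h1_add[OF h1_linear[OF bounded_linear_Pair[OF bounded_linear_ident bounded_linear_zero] assms(1)]
    h1_linear[OF bounded_linear_Pair[OF bounded_linear_zero bounded_linear_ident] assms(2)]] by simp

lemma l2_scaleR: 
  assumes "l2 f" shows "l2 (\<lambda>x. a *\<^sub>R f x)" "l2norm (\<lambda>x. a *\<^sub>R f x) = \<bar>a\<bar> * l2norm f"
proof -
  show "l2 (\<lambda>x. a *\<^sub>R f x)" by (rule l2_linear[OF bounded_linear_scaleR_right assms])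
  show "l2norm (\<lambda>x. a *\<^sub>R f x) = \<bar>a\<bar> * l2norm f"
    unfolding l2norm_def by (simp add: power_mult_distrib real_sqrt_mult)
qed

definition cscale :: "complex \<Rightarrow> complex \<times> complex \<Rightarrow> complex \<times> complex" where
  "cscale z v = (z * fst v, z * snd v)"

lemma cscale_linear: "bounded_linear (cscale z)"
  unfolding cscale_def
  by (intro bounded_linear_Pair bounded_linear_compose[OF bounded_linear_mult_right]
      bounded_linear_fst bounded_linear_snd)

lemma norm_cscale: "norm (cscale z v) = norm z * norm v"
proof -
  have "(norm z * cmod (fst v))\<^sup>2 + (norm z * cmod (snd v))\<^sup>2 = (norm z)\<^sup>2 * ((cmod (fst v))\<^sup>2 + (cmod (snd v))\<^sup>2)"
    by (simp add: power_mult_distrib distrib_left)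
  then show ?thesis by (simp add: cscale_def norm_Pair norm_mult real_sqrt_mult norm_prod_def)
qed

lemma cscale_simps:
  "cscale z (v + w) = cscale z v + cscale z w" "cscale z (v - w) = cscale z v - cscale z w"
  "cscale (a + b) v = cscale a v + cscale b v" "cscale (a - b) v = cscale a v - cscale b v"
  "cscale a (cscale b v) = cscale (a * b) v" "cscale 0 v = 0" "cscale z 0 = 0" "cscale 1 v = v" "cscale (- z) v = - cscale z v"
  by (auto simp: cscale_def algebra_simps zero_prod_def)

lemma inner_cscale: "cscale z v \<bullet> v = Re z * (norm v)\<^sup>2"
  by (cases v) (simp add: cscale_def inner_complex_def power2_norm_eq_inner algebra_simps)

lemma l2_cscale:
  assumes "l2 f" shows "l2 (\<lambda>x. cscale z (f x))" "l2norm (\<lambda>x. cscale z (f x)) = norm z * l2norm f"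
proof -
  show "l2 (\<lambda>x. cscale z (f x))" by (rule l2_linear[OF cscale_linear assms])
  show "l2norm (\<lambda>x. cscale z (f x)) = norm z * l2norm f"
    unfolding l2norm_def by (simp add: norm_cscale power_mult_distrib real_sqrt_mult)
qed

lemma h1_cscale: "h1 f g \<Longrightarrow> h1 (\<lambda>x. cscale z (f x)) (\<lambda>x. cscale z (g x))"
  by (rule h1_linear[OF cscale_linear])

context kink
begin

text \<open>The square root of the ratio (1 - c) / (1 + c) of the characteristic speeds. It balances
  them: (1 + c) * \<kappa> and (1 - c) / \<kappa> both equal s.\<close>

definition \<kappa> :: real where "\<kappa> = (1 - c) / s"

lemma \<kappa>: "\<kappa> > 0" "(1 + c) * \<kappa> = s" "1 + c = s / \<kappa>" "1 - c = \<kappa> * s"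
proof -
  show k: "\<kappa> > 0" using c s_pos by (simp add: \<kappa>_def)
  have "(1 + c) * (1 - c) = s * s" using s2 by (simp add: power2_eq_square algebra_simps)
  then show "(1 + c) * \<kappa> = s" using s_pos by (simp add: \<kappa>_def field_simps)
  then show "1 + c = s / \<kappa>" using k by (simp add: field_simps)
  show "1 - c = \<kappa> * s" using s_pos by (simp add: \<kappa>_def)
qed

text \<open>\<Sigma> in its eigenbasis (1, 1), (1, -1), with eigenvalues c + 1 and c - 1.\<close>

definition S :: "complex \<times> complex \<Rightarrow> complex \<times> complex" where
  "S v = ((1 + c) *\<^sub>R fst v, (- (1 - c)) *\<^sub>R snd v)"

definition T :: "complex \<times> complex \<Rightarrow> complex \<times> complex" where
  "T v = ((1 / (1 + c)) *\<^sub>R fst v, (- (1 / (1 - c))) *\<^sub>R snd v)"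

text \<open>The skew part is h (-q, p). The symmetric part is -(c m / \<kappa>) (p - \<kappa> q) (1,
  -\<kappa>): rank one, nonpositive, and zero on the line p = \<kappa> q that contains the
  translation mode.\<close>

definition B :: "real \<Rightarrow> complex \<times> complex \<Rightarrow> complex \<times> complex" where
  "B x v = ((- (c * m x / \<kappa>)) *\<^sub>R fst v - (h x - c * m x) *\<^sub>R snd v,
            (h x + c * m x) *\<^sub>R fst v - (\<kappa> * c * m x) *\<^sub>R snd v)"

definition \<beta> :: real where "\<beta> = c * \<mu> / \<kappa> + 2 * (1 + \<mu> + c * \<mu>) + \<kappa> * c * \<mu>"

lemma mu_nonneg: "0 \<le> \<mu>"
  using m_range[of 0] by linarith

lemma cm_bound: "0 \<le> c * m x" "c * m x \<le> c * \<mu>"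
  using c m_range[of x] by (auto intro: mult_left_mono)

text \<open>The shift by z is included in the zero-order term, so the perturbation theorem can be
  applied around any z and not just around 0.\<close>

lemma first_order_kink:
  "first_order S T (\<lambda>x v. B x v - cscale z v) (\<beta> + norm z)"
proof (rule first_order.intro)
  show "bounded_linear S" unfolding S_def
    by (intro bounded_linear_Pair bounded_linear_compose[OF bounded_linear_scaleR_right] bounded_linear_fst bounded_linear_snd)
  show "bounded_linear T" unfolding T_def
    by (intro bounded_linear_Pair bounded_linear_compose[OF bounded_linear_scaleR_right] bounded_linear_fst bounded_linear_snd)
  have "(c - 1) / (1 - c) = - 1" using c by (simp add: divide_eq_eq)
  then show "S (T v) = v" "T (S v) = v" for v using c by (auto simp: S_def T_def)
  show "linear (\<lambda>v. B x v - cscale z v)" for x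
    by (rule linearI) (auto simp: B_def cscale_def scaleR_add_right algebra_simps)
  show "norm (B x v - cscale z v) \<le> (\<beta> + norm z) * norm v" for x v
  proof -
    have 1: "norm (((- (c * m x / \<kappa>)) *\<^sub>R fst v - (h x - c * m x) *\<^sub>R snd v)) \<le> (c * \<mu> / \<kappa>) * norm v + (1 + \<mu> + c * \<mu>) * norm v"
    proof (rule order_trans[OF norm_triangle_ineq4 add_mono])
      show "norm ((- (c * m x / \<kappa>)) *\<^sub>R fst v) \<le> (c * \<mu> / \<kappa>) * norm v"
        unfolding norm_scaleR using cm_bound[of x] mu_nonneg \<kappa>(1)
        by (intro mult_mono norm_fst_le_norm) (auto simp: abs_mult divide_right_mono abs_of_nonneg)
      show "norm ((h x - c * m x) *\<^sub>R snd v) \<le> (1 + \<mu> + c * \<mu>) * norm v"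
        unfolding norm_scaleR using cm_bound[of x] mu_nonneg h_bound[of x]
        by (intro mult_mono norm_snd_le_norm) auto
    qed
    have 2: "norm ((h x + c * m x) *\<^sub>R fst v - (\<kappa> * c * m x) *\<^sub>R snd v) \<le> (1 + \<mu> + c * \<mu>) * norm v + (\<kappa> * c * \<mu>) * norm v"
    proof (rule order_trans[OF norm_triangle_ineq4 add_mono])
      show "norm ((h x + c * m x) *\<^sub>R fst v) \<le> (1 + \<mu> + c * \<mu>) * norm v"
        unfolding norm_scaleR using cm_bound[of x] mu_nonneg h_bound[of x]
        by (intro mult_mono norm_fst_le_norm) auto
      have "\<bar>\<kappa> * c * m x\<bar> = \<kappa> * (c * m x)" using \<kappa>(1) cm_bound[of x]
        by (simp only: mult.assoc, subst abs_of_nonneg) auto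
      also have "\<dots> \<le> \<kappa> * (c * \<mu>)" by (rule mult_left_mono[OF cm_bound(2)]) (use \<kappa>(1) in simp)
      finally show "norm ((\<kappa> * c * m x) *\<^sub>R snd v) \<le> (\<kappa> * c * \<mu>) * norm v"
        unfolding norm_scaleR using cm_bound[of x] mu_nonneg \<kappa>(1) c
        by (intro mult_mono norm_snd_le_norm) (auto simp: mult.assoc)
    qed
    have "norm (B x v) \<le> \<beta> * norm v"
      unfolding B_def \<beta>_def using order_trans[OF norm_Pair_le add_mono[OF 1 2]] by (simp add: algebra_simps)
    then show ?thesis
      using norm_triangle_ineq4[of "B x v" "cscale z v"] by (simp add: norm_cscale distrib_right)
  qed
  show "continuous_on UNIV (\<lambda>x. B x (f x) - cscale z (f x))" if "continuous_on UNIV f" for f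
    unfolding B_def cscale_def by (intro continuous_intros that h_cont m_cont) (use \<kappa> in auto)
qed

sublocale M: first_order S T B \<beta>
  using first_order_kink[of 0] by (simp add: cscale_simps)

lemma Op_components:
  "fst (M.Op f g x) = (1 + c) *\<^sub>R fst (g x) - (c * m x / \<kappa>) *\<^sub>R fst (f x) - (h x - c * m x) *\<^sub>R snd (f x)"
  "snd (M.Op f g x) = (- (1 - c)) *\<^sub>R snd (g x) + (h x + c * m x) *\<^sub>R fst (f x) - (\<kappa> * c * m x) *\<^sub>R snd (f x)"
  by (auto simp: M.Op_def S_def B_def)

text \<open>The functional (1, 1 / \<kappa>) annihilates the direction (1, -\<kappa>) of the
  dissipative part, and by the choice of \<kappa> it combines the two derivatives with equal weight
  s. So the first combination closes in D; substituting q = P - D in the first component gives the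
  equation for P.\<close>

lemma Op_triangular:
  defines "D \<equiv> \<lambda>(f :: real \<Rightarrow> complex \<times> complex) x. (1 / \<kappa>) *\<^sub>R fst (f x) - snd (f x)"
  defines "P \<equiv> \<lambda>(f :: real \<Rightarrow> complex \<times> complex) x. (1 / \<kappa>) *\<^sub>R fst (f x)"
  shows "fst (M.Op f g x) + (1 / \<kappa>) *\<^sub>R snd (M.Op f g x) = s *\<^sub>R D g x + h x *\<^sub>R D f x"
    "fst (M.Op f g x) - (h x - c * m x) *\<^sub>R D f x = s *\<^sub>R P g x - h x *\<^sub>R P f x"
proof -
  have k: "\<kappa> \<noteq> 0" using \<kappa>(1) by simp
  obtain p q where pq: "f x = (p, q)" by (cases "f x")
  obtain p1 q1 where pq1: "g x = (p1, q1)" by (cases "g x")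
  define P0 where "P0 = (1 / \<kappa>) *\<^sub>R p"
  define P1 where "P1 = (1 / \<kappa>) *\<^sub>R p1"
  have p: "p = \<kappa> *\<^sub>R P0" "p1 = \<kappa> *\<^sub>R P1" using k by (auto simp: P0_def P1_def)
  have c1: "(1 + c) *\<^sub>R p1 = s *\<^sub>R P1" unfolding p by (simp add: \<kappa>(2))
  have c2: "(1 - c) *\<^sub>R q1 = \<kappa> *\<^sub>R s *\<^sub>R q1" by (simp add: \<kappa>(4))
  have c3: "(c * m x / \<kappa>) *\<^sub>R p = (c * m x) *\<^sub>R P0" unfolding p using k by simp
  have O1: "fst (M.Op f g x) = s *\<^sub>R P1 - (c * m x) *\<^sub>R P0 - (h x - c * m x) *\<^sub>R q"
    unfolding Op_components pq pq1 fst_conv snd_conv c1 c3 ..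
  have "(h x + c * m x) *\<^sub>R p = \<kappa> *\<^sub>R (h x + c * m x) *\<^sub>R P0" by (simp add: p mult.commute)
  then have O2: "(1 / \<kappa>) *\<^sub>R snd (M.Op f g x) = - (s *\<^sub>R q1) + (h x + c * m x) *\<^sub>R P0 - (c * m x) *\<^sub>R q"
    unfolding Op_components pq pq1 fst_conv snd_conv scaleR_minus_left c2
    using k by (simp add: scaleR_diff_right scaleR_add_right mult.assoc)
  have D: "D f x = P0 - q" "D g x = P1 - q1" "P f x = P0" "P g x = P1"
    by (auto simp: D_def P_def pq pq1 P0_def P1_def)
  show "fst (M.Op f g x) + (1 / \<kappa>) *\<^sub>R snd (M.Op f g x) = s *\<^sub>R D g x + h x *\<^sub>R D f x"
    unfolding O1 O2 D by (simp add: algebra_simps)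
  show "fst (M.Op f g x) - (h x - c * m x) *\<^sub>R D f x = s *\<^sub>R P g x - h x *\<^sub>R P f x"
    unfolding O1 D by (simp add: algebra_simps)
qed

section \<open>The zero mode, the pairing with it, and its complement\<close>

definition ev :: "real \<Rightarrow> complex \<times> complex" where
  "ev x = E x *\<^sub>R (complex_of_real \<kappa>, 1)"

definition ev' :: "real \<Rightarrow> complex \<times> complex" where
  "ev' x = (h x * E x / s) *\<^sub>R (complex_of_real \<kappa>, 1)"

lemma l2_real_scaleR:
  assumes "l2 (f :: real \<Rightarrow> real)" shows "l2 (\<lambda>x. f x *\<^sub>R (v :: 'a::euclidean_space))"
  by (rule l2_linear[OF bounded_linear_scaleR_left assms])

lemma l2_ev: "l2 ev" unfolding ev_def[abs_def] by (rule l2_real_scaleR[OF l2_E])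

lemma h1_ev: "h1 ev ev'"
proof -
  have "l2 (\<lambda>x. h x * E x / s)" using l2_scaleR(1)[OF l2_h[OF l2_E], of "1 / s"] by simp
  then have "h1 E (\<lambda>x. h x * E x / s)" by (simp add: h1_def l2_E ac_E)
  from h1_linear[OF bounded_linear_scaleR_left this] show ?thesis unfolding ev_def[abs_def] ev'_def[abs_def] .
qed

lemma prod_eq_zeroI:
  assumes "fst v + (1 / \<kappa>) *\<^sub>R snd v = 0" "fst v = 0" shows "v = (0 :: complex \<times> complex)"
  using assms \<kappa>(1) by (auto simp: prod_eq_iff)

lemma Op_ev: "M.Op ev ev' x = 0"
proof (rule prod_eq_zeroI)
  have k: "\<kappa> \<noteq> 0" using \<kappa>(1) by simp
  have D: "(1 / \<kappa>) *\<^sub>R fst (ev x) - snd (ev x) = 0" "(1 / \<kappa>) *\<^sub>R fst (ev' x) - snd (ev' x) = 0"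
    using k by (auto simp: ev_def ev'_def scaleR_conv_of_real)
  show "fst (M.Op ev ev' x) + (1 / \<kappa>) *\<^sub>R snd (M.Op ev ev' x) = 0"
    unfolding Op_triangular(1) D by simp
  have "s *\<^sub>R (1 / \<kappa>) *\<^sub>R fst (ev' x) - h x *\<^sub>R (1 / \<kappa>) *\<^sub>R fst (ev x) = 0"
    using k s_pos by (simp add: ev_def ev'_def scaleR_conv_of_real)
  then show "fst (M.Op ev ev' x) = 0" using Op_triangular(2)[of ev ev' x] unfolding D by simp
qed

text \<open>Pairing with the zero mode. That mode is real, so the pairing is complex linear with no
  conjugation; it is also the functional that cuts out the range.\<close>

definition ell :: "(real \<Rightarrow> complex \<times> complex) \<Rightarrow> complex" where
  "ell f = (\<integral>x. E x *\<^sub>R (\<kappa> *\<^sub>R fst (f x) + snd (f x)) \<partial>lborel)"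

lemma l2_ell: assumes "l2 f" shows "l2 (\<lambda>x. \<kappa> *\<^sub>R fst (f x) + snd (f x))"
    "l2norm (\<lambda>x. \<kappa> *\<^sub>R fst (f x) + snd (f x)) \<le> (\<kappa> + 1) * l2norm f"
proof -
  note a = l2_scaleR[OF l2_component(1)[OF assms], of \<kappa>] and b = l2_component[OF assms]
  show "l2 (\<lambda>x. \<kappa> *\<^sub>R fst (f x) + snd (f x))" by (rule l2_plus[OF a(1) b(3)])
  show "l2norm (\<lambda>x. \<kappa> *\<^sub>R fst (f x) + snd (f x)) \<le> (\<kappa> + 1) * l2norm f"
  proof -
    have "\<bar>\<kappa>\<bar> * l2norm (\<lambda>x. fst (f x)) \<le> \<kappa> * l2norm f" using b(2) \<kappa>(1) by simp
    then show ?thesis using l2norm_triangle[OF a(1) b(3)] b(4) unfolding a(2) distrib_right by linarith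
  qed
qed

lemma ell_integrable: "l2 f \<Longrightarrow> integrable lborel (\<lambda>x. E x *\<^sub>R (\<kappa> *\<^sub>R fst (f x) + snd (f x)))"
  by (rule EF_integrable(1)[OF l2_ell(1)])

lemma ell_bound: assumes "l2 f" shows "norm (ell f) \<le> l2norm E * (\<kappa> + 1) * l2norm f"
  unfolding ell_def
  using order_trans[OF EF_integrable(2)[OF l2_ell(1)[OF assms]] mult_left_mono[OF l2_ell(2)[OF assms]]]
  by (simp add: mult.assoc)

lemma ell_add: assumes "l2 f" "l2 g" shows "ell (\<lambda>x. f x + g x) = ell f + ell g"
proof -
  have "ell (\<lambda>x. f x + g x) = (\<integral>x. E x *\<^sub>R (\<kappa> *\<^sub>R fst (f x) + snd (f x)) + E x *\<^sub>R (\<kappa> *\<^sub>R fst (g x) + snd (g x)) \<partial>lborel)"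
    unfolding ell_def by (simp add: algebra_simps)
  then show ?thesis unfolding ell_def using ell_integrable[OF assms(1)] ell_integrable[OF assms(2)]
    by (simp only: Bochner_Integration.integral_add)
qed

lemma ell_cscale: assumes "l2 f" shows "ell (\<lambda>x. cscale z (f x)) = z * ell f"
proof -
  have "ell (\<lambda>x. cscale z (f x)) = (\<integral>x. z * (E x *\<^sub>R (\<kappa> *\<^sub>R fst (f x) + snd (f x))) \<partial>lborel)"
    unfolding ell_def by (simp add: cscale_def algebra_simps)
  then show ?thesis unfolding ell_def using ell_integrable[OF assms] by (simp only: integral_mult_right_zero)
qed

lemma ell_diff: assumes "l2 f" "l2 g" shows "ell (\<lambda>x. f x - g x) = ell f - ell g"
  using ell_add[OF assms(1) l2_cscale(1)[OF assms(2)], of "-1"] ell_cscale[OF assms(2), of "-1"]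
  by (simp add: cscale_simps)

lemma ell_cong: assumes "l2 f" "l2 g" "AE x in lborel. f x = g x" shows "ell f = ell g"
  unfolding ell_def
proof (rule integral_cong_AE)
  show "AE x in lborel. E x *\<^sub>R (\<kappa> *\<^sub>R fst (f x) + snd (f x)) = E x *\<^sub>R (\<kappa> *\<^sub>R fst (g x) + snd (g x))"
    using assms(3) by eventually_elim simp
qed (intro borel_measurable_integrable ell_integrable assms)+

text \<open>The pairing equals (\<kappa>^2 + 1) times the squared norm of E. That it is nonzero
  means that the kernel is not contained in the range: there is no Jordan block at 0, and projection
  along \<open>ev\<close> is possible.\<close>

lemma ell_ev: "ell ev \<noteq> 0"
proof -
  have "ell ev = (\<integral>x. complex_of_real ((\<kappa>\<^sup>2 + 1) * (norm (E x))\<^sup>2) \<partial>lborel)"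
    unfolding ell_def
    by (rule Bochner_Integration.integral_cong) (simp_all add: ev_def scaleR_conv_of_real power2_eq_square algebra_simps)
  also have "\<dots> = complex_of_real ((\<kappa>\<^sup>2 + 1) * (l2norm E)\<^sup>2)"
    by (simp only: integral_complex_of_real integral_mult_right_zero l2norm_power2)
  finally have e: "ell ev = complex_of_real ((\<kappa>\<^sup>2 + 1) * (l2norm E)\<^sup>2)" .
  have "l2norm E \<noteq> 0"
  proof
    assume "l2norm E = 0"
    then have "AE x in lborel. E x = 0" using l2norm_eq_0_iff[OF l2_E] by simp
    then have "AE x::real in lborel. False" by eventually_elim (use E_pos in \<open>auto simp: less_le\<close>)
    then show False by (simp add: eventually_False ae_filter_eq_bot_iff)
  qed
  moreover have "\<kappa>\<^sup>2 + 1 > 0" by (simp add: add_nonneg_pos)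
  ultimately show ?thesis unfolding e by (simp del: of_real_mult of_real_add)
qed

lemma h1_D:
  assumes "h1 f g" shows "h1 (\<lambda>x. (1 / \<kappa>) *\<^sub>R fst (f x) - snd (f x)) (\<lambda>x. (1 / \<kappa>) *\<^sub>R fst (g x) - snd (g x))"
    "h1 (\<lambda>x. (1 / \<kappa>) *\<^sub>R fst (f x)) (\<lambda>x. (1 / \<kappa>) *\<^sub>R fst (g x))"
proof -
  show 1: "h1 (\<lambda>x. (1 / \<kappa>) *\<^sub>R fst (f x)) (\<lambda>x. (1 / \<kappa>) *\<^sub>R fst (g x))"
    by (rule h1_linear[OF bounded_linear_compose[OF bounded_linear_scaleR_right bounded_linear_fst] assms])
  show "h1 (\<lambda>x. (1 / \<kappa>) *\<^sub>R fst (f x) - snd (f x)) (\<lambda>x. (1 / \<kappa>) *\<^sub>R fst (g x) - snd (g x))"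
    by (rule h1_diff[OF 1 h1_linear[OF bounded_linear_snd assms]])
qed

text \<open>The pairing is \<kappa> times the integral of E against the combination that sees only
  the equation for D, so \<open>range_orthogonal\<close> applies.\<close>

lemma ell_Op: assumes "h1 f g" shows "ell (M.Op f g) = 0"
proof -
  have k: "\<kappa> \<noteq> 0" using \<kappa>(1) by simp
  have "ell (M.Op f g) = (\<integral>x. \<kappa> *\<^sub>R (E x *\<^sub>R (fst (M.Op f g x) + (1 / \<kappa>) *\<^sub>R snd (M.Op f g x))) \<partial>lborel)"
    unfolding ell_def using k by (intro Bochner_Integration.integral_cong) (auto simp: scaleR_add_right mult.commute)
  also have "\<dots> = 0" unfolding Op_triangular(1) integral_scaleR_right range_orthogonal[OF h1_D(1)[OF assms]] by simp
  finally show ?thesis .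
qed

lemma kernel:
  assumes f: "h1 f g" and eq: "AE x in lborel. M.Op f g x = 0"
  obtains k where "\<And>x. f x = cscale k (ev x)"
proof -
  have kn: "\<kappa> \<noteq> 0" using \<kappa>(1) by simp
  have D: "(1 / \<kappa>) *\<^sub>R fst (f x) - snd (f x) = 0" for x
  proof (rule unique_decaying[OF h1_D(1)[OF f]])
    show "AE x in lborel. s *\<^sub>R ((1 / \<kappa>) *\<^sub>R fst (g x) - snd (g x)) + h x *\<^sub>R ((1 / \<kappa>) *\<^sub>R fst (f x) - snd (f x)) = 0"
      using eq unfolding Op_triangular(1)[symmetric] by eventually_elim simp
  qed
  have "AE x in lborel. s *\<^sub>R (1 / \<kappa>) *\<^sub>R fst (g x) - h x *\<^sub>R (1 / \<kappa>) *\<^sub>R fst (f x) = 0"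
    using eq unfolding Op_triangular(2)[symmetric] D by eventually_elim simp
  from unique_growing[OF h1D(3)[OF h1_D(2)[OF f]] this]
  obtain k where P: "\<And>x. (1 / \<kappa>) *\<^sub>R fst (f x) = E x *\<^sub>R k" by blast
  have "f x = cscale k (ev x)" for x
  proof -
    have "fst (f x) = \<kappa> *\<^sub>R (1 / \<kappa>) *\<^sub>R fst (f x)" using kn by simp
    then have "fst (f x) = \<kappa> *\<^sub>R E x *\<^sub>R k" unfolding P .
    moreover have "snd (f x) = E x *\<^sub>R k" using D[of x] P[of x] by simp
    ultimately show ?thesis by (simp add: prod_eq_iff cscale_def ev_def scaleR_conv_of_real)
  qed
  then show ?thesis by (rule that)
qed

lemma project:
  assumes "l2 f" shows "ell (\<lambda>x. f x - cscale (ell f / ell ev) (ev x)) = 0"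
  by (subst ell_diff[OF assms l2_cscale(1)[OF l2_ev]]) (simp add: ell_cscale[OF l2_ev] ell_ev)

lemma Op_cscale_ev: "M.Op (\<lambda>x. f x - cscale k (ev x)) (\<lambda>x. g x - cscale k (ev' x)) x = M.Op f g x"
proof -
  have "M.Op (\<lambda>x. cscale k (ev x)) (\<lambda>x. cscale k (ev' x)) x = cscale k (M.Op ev ev' x)"
    by (simp add: M.Op_def S_def B_def cscale_def algebra_simps)
  then show ?thesis by (simp add: M.Op_diff Op_ev cscale_simps)
qed

lemma project_norm:
  "\<exists>K\<ge>0. \<forall>f. l2 f \<longrightarrow> l2norm (\<lambda>x. f x - cscale (ell f / ell ev) (ev x)) \<le> K * l2norm f"
proof -
  define a where "a = l2norm E * (\<kappa> + 1)"
  have a: "0 \<le> a" using \<kappa>(1) by (simp add: a_def)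
  define K where "K = 1 + a / norm (ell ev) * l2norm ev"
  have "l2norm (\<lambda>x. f x - cscale (ell f / ell ev) (ev x)) \<le> K * l2norm f" if f: "l2 f" for f
  proof -
    have "l2norm (\<lambda>x. f x - cscale (ell f / ell ev) (ev x)) \<le> l2norm f + norm (ell f / ell ev) * l2norm ev"
      using l2norm_triangle_diff[OF f l2_cscale(1)[OF l2_ev]] by (simp add: l2_cscale(2)[OF l2_ev])
    also have "\<dots> \<le> l2norm f + (a * l2norm f) / norm (ell ev) * l2norm ev"
      using ell_bound[OF f] by (intro add_left_mono mult_right_mono) (auto simp: norm_divide a_def divide_right_mono)
    also have "\<dots> = K * l2norm f" by (simp add: K_def algebra_simps)
    finally show ?thesis .
  qed
  moreover have "0 \<le> K" using a by (simp add: K_def)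
  ultimately show ?thesis by (intro exI[of _ K]) simp
qed

text \<open>The condition on f is precisely the solvability condition of the equation for D. D is
  found first because it enters the source of the equation for P, which is solvable for any source.
  Subtracting a multiple of \<open>ev\<close> restores the normalization without changing the
  image.\<close>

lemma solve_orthogonal:
  "\<exists>C\<ge>0. \<forall>f. l2 f \<longrightarrow> ell f = 0 \<longrightarrow>
     (\<exists>\<phi> g. h1 \<phi> g \<and> ell \<phi> = 0 \<and> (\<forall>x. M.Op \<phi> g x = f x) \<and> l2norm \<phi> \<le> C * l2norm f)"
proof -
  obtain C1 where C1: "0 \<le> C1 \<and> (\<forall>F :: real \<Rightarrow> complex. l2 F \<longrightarrow> (\<integral>x. E x *\<^sub>R F x \<partial>lborel) = 0 \<longrightarrow>
       (\<exists>D D1. h1 D D1 \<and> (\<forall>x. s *\<^sub>R D1 x + h x *\<^sub>R D x = F x) \<and> l2norm D \<le> C1 * l2norm F))"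
    using solve_decaying[where 'a = complex] ..
  note C1 = conjunct1[OF C1] conjunct2[OF C1]
  obtain C2 where C2: "0 \<le> C2 \<and> (\<forall>G :: real \<Rightarrow> complex. l2 G \<longrightarrow>
       (\<exists>P P1. h1 P P1 \<and> (\<forall>x. s *\<^sub>R P1 x - h x *\<^sub>R P x = G x) \<and> l2norm P \<le> C2 * l2norm G))"
    using solve_growing[where 'a = complex] ..
  note C2 = conjunct1[OF C2] conjunct2[OF C2]
  obtain K where K: "0 \<le> K" "\<forall>f. l2 f \<longrightarrow> l2norm (\<lambda>x. f x - cscale (ell f / ell ev) (ev x)) \<le> K * l2norm f"
    using project_norm by (elim exE conjE)
  have kn: "\<kappa> \<noteq> 0" using \<kappa>(1) by simp
  define b where "b = 1 + \<mu> + c * \<mu>"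
  have b: "0 \<le> b" "\<And>x. \<bar>h x - c * m x\<bar> \<le> b"
  proof -
    show "0 \<le> b" using mu_nonneg c by (simp add: b_def add_nonneg_nonneg)
    show "\<bar>h x - c * m x\<bar> \<le> b" for x using cm_bound[of x] mu_nonneg h_bound[of x] by (auto simp: b_def)
  qed
  \<comment> \<open>\<open>d\<close> and \<open>p\<close> bound D and P by f, with \<open>b\<close>
    the size of the coupling; \<open>C\<close> reassembles the pair (\<kappa> P, P - D) and pays
    \<open>K\<close> for the projection.\<close>
  define d where "d = C1 * (1 + 1 / \<kappa>)"
  define p where "p = C2 * (1 + b * d)"
  define C where "C = K * (\<kappa> * p + (p + d))"
  have pos: "0 \<le> d" "0 \<le> p" using C1(1) C2(1) \<kappa>(1) b(1) by (auto simp: d_def p_def)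
  have main: "\<exists>\<phi> g. h1 \<phi> g \<and> ell \<phi> = 0 \<and> (\<forall>x. M.Op \<phi> g x = f x) \<and> l2norm \<phi> \<le> C * l2norm f"
    if f: "l2 f" and ef: "ell f = 0" for f
  proof -
    note cf = l2_component[OF f]
    let ?F = "\<lambda>x. fst (f x) + (1 / \<kappa>) *\<^sub>R snd (f x)"
    have lF: "l2 ?F" by (rule l2_plus[OF cf(1) l2_scaleR(1)[OF cf(3)]])
    have nF: "l2norm ?F \<le> (1 + 1 / \<kappa>) * l2norm f"
    proof -
      have "\<bar>1 / \<kappa>\<bar> * l2norm (\<lambda>x. snd (f x)) \<le> 1 / \<kappa> * l2norm f"
        using mult_left_mono[OF cf(4), of "1 / \<kappa>"] \<kappa>(1) by simp
      then show ?thesis using l2norm_triangle[OF cf(1) l2_scaleR(1)[OF cf(3)], of "1 / \<kappa>"] cf(2)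
        unfolding l2_scaleR(2)[OF cf(3), of "1 / \<kappa>"] distrib_right by linarith
    qed
    have "ell f = (\<integral>x. \<kappa> *\<^sub>R (E x *\<^sub>R ?F x) \<partial>lborel)"
      unfolding ell_def using kn by (intro Bochner_Integration.integral_cong) (auto simp: scaleR_add_right mult.commute)
    then have "\<kappa> *\<^sub>R (\<integral>x. E x *\<^sub>R ?F x \<partial>lborel) = 0" unfolding ef integral_scaleR_right by simp
    then have "(\<integral>x. E x *\<^sub>R ?F x \<partial>lborel) = 0" using kn by (simp only: scaleR_eq_0_iff) simp
    then obtain D D1 where D: "h1 D D1" "\<And>x. s *\<^sub>R D1 x + h x *\<^sub>R D x = ?F x" "l2norm D \<le> C1 * l2norm ?F"
      using C1(2)[rule_format, OF lF] by blast
    note lD = h1D(1)[OF D(1)]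
    have nD: "l2norm D \<le> d * l2norm f"
      using D(3) mult_left_mono[OF nF C1(1)] by (simp add: d_def mult.assoc)
    let ?c = "\<lambda>x. (h x - c * m x) *\<^sub>R D x"
    have mc: "?c \<in> borel_measurable borel"
      by (intro borel_measurable_continuous_onI continuous_intros h_cont m_cont ac_continuous[OF h1D(3)[OF D(1)]])
    have ae: "AE x in lborel. norm (?c x) \<le> b * norm (D x)"
      by (rule AE_I2) (simp add: mult_right_mono b)
    note lc = l2_bound[OF lD mc ae b(1)]
    have lG: "l2 (\<lambda>x. fst (f x) - ?c x)" by (rule l2_diff[OF cf(1) lc(1)])
    have nG: "l2norm (\<lambda>x. fst (f x) - ?c x) \<le> (1 + b * d) * l2norm f"
      using l2norm_triangle_diff[OF cf(1) lc(1)] cf(2) lc(2) mult_left_mono[OF nD b(1)]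
      unfolding distrib_right mult.assoc by linarith
    obtain P P1 where P: "h1 P P1" "\<And>x. s *\<^sub>R P1 x - h x *\<^sub>R P x = fst (f x) - ?c x"
      "l2norm P \<le> C2 * l2norm (\<lambda>x. fst (f x) - ?c x)"
      using C2(2)[rule_format, OF lG] by blast
    note lP = h1D(1)[OF P(1)]
    have nP: "l2norm P \<le> p * l2norm f"
      using P(3) mult_left_mono[OF nG C2(1)] by (simp add: p_def mult.assoc)
    define u where "u x = (\<kappa> *\<^sub>R P x, P x - D x)" for x
    define u1 where "u1 x = (\<kappa> *\<^sub>R P1 x, P1 x - D1 x)" for x
    have hu: "h1 u u1" unfolding u_def u1_def
      by (intro h1_Pair h1_diff P D h1_linear[OF bounded_linear_scaleR_right])
    have "l2norm u \<le> \<kappa> * l2norm P + (l2norm P + l2norm D)"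
      using l2_Pair(2)[OF l2_scaleR(1)[OF lP, of \<kappa>] l2_diff[OF lP lD]] l2_scaleR(2)[OF lP, of \<kappa>]
        l2norm_triangle_diff[OF lP lD] \<kappa>(1) unfolding u_def by simp
    also have "\<dots> \<le> \<kappa> * (p * l2norm f) + (p * l2norm f + d * l2norm f)"
      using \<kappa>(1) by (intro add_mono mult_left_mono nP nD) auto
    finally have nu: "l2norm u \<le> (\<kappa> * p + (p + d)) * l2norm f" by (simp add: algebra_simps)
    have Op: "M.Op u u1 x = f x" for x
    proof -
      have e: "(1 / \<kappa>) *\<^sub>R fst (u x) - snd (u x) = D x" "(1 / \<kappa>) *\<^sub>R fst (u1 x) - snd (u1 x) = D1 x"
        and e': "(1 / \<kappa>) *\<^sub>R fst (u x) = P x" "(1 / \<kappa>) *\<^sub>R fst (u1 x) = P1 x"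
        using kn by (auto simp: u_def u1_def)
      have a: "fst (M.Op u u1 x) + (1 / \<kappa>) *\<^sub>R snd (M.Op u u1 x) = ?F x"
        unfolding Op_triangular(1) e by (rule D(2))
      have "fst (M.Op u u1 x) - ?c x = fst (f x) - ?c x"
        using Op_triangular(2)[of u u1 x] unfolding e unfolding e' P(2) .
      then have a2: "fst (M.Op u u1 x) = fst (f x)" by simp
      then have "snd (M.Op u u1 x) = snd (f x)" using a kn by simp
      then show ?thesis using a2 by (simp add: prod_eq_iff)
    qed
    note lu = h1D(1)[OF hu]
    let ?k = "ell u / ell ev"
    show ?thesis
    proof (intro exI conjI allI)
      show "h1 (\<lambda>x. u x - cscale ?k (ev x)) (\<lambda>x. u1 x - cscale ?k (ev' x))"
        by (intro h1_diff hu h1_cscale h1_ev)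
      show "ell (\<lambda>x. u x - cscale ?k (ev x)) = 0" by (rule project[OF lu])
      show "M.Op (\<lambda>x. u x - cscale ?k (ev x)) (\<lambda>x. u1 x - cscale ?k (ev' x)) x = f x" for x
        unfolding Op_cscale_ev Op ..
      show "l2norm (\<lambda>x. u x - cscale ?k (ev x)) \<le> C * l2norm f"
        using order_trans[OF K(2)[rule_format, OF lu] mult_left_mono[OF nu K(1)]] by (simp add: C_def mult.assoc)
    qed
  qed
  show ?thesis by (intro exI[of _ C] conjI allI impI main) (use K pos \<kappa>(1) in \<open>auto simp: C_def\<close>)
qed

text \<open>The solution constructed from Op \<phi> carries the bound. It differs from \<phi> by a
  kernel element, which the normalization \<open>ell = 0\<close> of both forces to vanish.\<close>

lemma orthogonal_bound:
  "\<exists>C\<ge>0. \<forall>\<phi> g. h1 \<phi> g \<longrightarrow> ell \<phi> = 0 \<longrightarrow> l2norm \<phi> \<le> C * l2norm (M.Op \<phi> g)"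
proof -
  obtain C where C: "0 \<le> C" "\<forall>f. l2 f \<longrightarrow> ell f = 0 \<longrightarrow>
     (\<exists>\<phi> g. h1 \<phi> g \<and> ell \<phi> = 0 \<and> (\<forall>x. M.Op \<phi> g x = f x) \<and> l2norm \<phi> \<le> C * l2norm f)"
    using solve_orthogonal by (elim exE conjE)
  have "l2norm \<phi> \<le> C * l2norm (M.Op \<phi> g)" if h: "h1 \<phi> g" and e: "ell \<phi> = 0" for \<phi> g
  proof -
    obtain \<psi> k where \<psi>: "h1 \<psi> k" "ell \<psi> = 0" "\<And>x. M.Op \<psi> k x = M.Op \<phi> g x" "l2norm \<psi> \<le> C * l2norm (M.Op \<phi> g)"
      using C(2)[rule_format, OF M.l2_Op[OF h] ell_Op[OF h]] by blast
    have "AE x in lborel. M.Op (\<lambda>x. \<phi> x - \<psi> x) (\<lambda>x. g x - k x) x = 0"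
      unfolding M.Op_diff \<psi>(3) by simp
    then obtain a where a: "\<And>x. \<phi> x - \<psi> x = cscale a (ev x)"
      using kernel[OF h1_diff[OF h \<psi>(1)]] by blast
    have "a * ell ev = ell (\<lambda>x. \<phi> x - \<psi> x)" unfolding a by (rule ell_cscale[OF l2_ev, symmetric])
    also have "\<dots> = 0" unfolding ell_diff[OF h1D(1)[OF h] h1D(1)[OF \<psi>(1)]] e \<psi>(2) by simp
    finally have "a = 0" using ell_ev by simp
    then have "\<phi> = \<psi>" using a by (auto simp: cscale_simps fun_eq_iff)
    then show ?thesis using \<psi>(4) by simp
  qed
  then show ?thesis using C(1) by blast
qed

section \<open>The resolvent near zero and in the right half plane\<close>

definition surjective_at :: "complex \<Rightarrow> bool" where
  "surjective_at z \<longleftrightarrow> (\<forall>f. l2 f \<longrightarrow> (\<exists>\<phi> g. h1 \<phi> g \<and> (AE x in lborel. M.Op \<phi> g x - cscale z (\<phi> x) = f x)))"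

definition bounded_below_at :: "complex \<Rightarrow> bool" where
  "bounded_below_at z \<longleftrightarrow> (\<exists>C\<ge>0. \<forall>\<phi> g. h1 \<phi> g \<longrightarrow> l2norm \<phi> \<le> C * l2norm (\<lambda>x. M.Op \<phi> g x - cscale z (\<phi> x)))"

lemma l2_resolvent: "h1 \<phi> g \<Longrightarrow> l2 (\<lambda>x. M.Op \<phi> g x - cscale z (\<phi> x))"
  by (intro l2_diff M.l2_Op l2_cscale h1D(1))

text \<open>Since Op annihilates \<open>ev\<close> and \<open>ell\<close> annihilates the range, the
  shifted operator respects the splitting into multiples of \<open>ev\<close> and the kernel of
  \<open>ell\<close>. On the first part it is multiplication by -z; on the second it is a small
  perturbation of an invertible operator.\<close>

theorem punctured_neighbourhood:
  "\<exists>\<epsilon>>0. \<forall>z. z \<noteq> 0 \<longrightarrow> norm z < \<epsilon> \<longrightarrow> surjective_at z \<and> bounded_below_at z"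
proof -
  obtain C0 where C0: "0 \<le> C0" "\<forall>f. l2 f \<longrightarrow> ell f = 0 \<longrightarrow>
     (\<exists>\<phi> g. h1 \<phi> g \<and> ell \<phi> = 0 \<and> (\<forall>x. M.Op \<phi> g x = f x) \<and> l2norm \<phi> \<le> C0 * l2norm f)"
    using solve_orthogonal by (elim exE conjE)
  obtain C where C: "0 \<le> C" "\<forall>\<phi> g. h1 \<phi> g \<longrightarrow> ell \<phi> = 0 \<longrightarrow> l2norm \<phi> \<le> C * l2norm (M.Op \<phi> g)"
    using orthogonal_bound by (elim exE conjE)
  obtain K where K: "0 \<le> K" "\<forall>f. l2 f \<longrightarrow> l2norm (\<lambda>x. f x - cscale (ell f / ell ev) (ev x)) \<le> K * l2norm f"
    using project_norm by (elim exE conjE)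
  \<comment> \<open>The added 1 gives C * \<epsilon> < 1 and also covers C = 0.\<close>
  define \<epsilon> where "\<epsilon> = 1 / (C + 1)"
  have \<epsilon>: "\<epsilon> > 0" using C(1) by (simp add: \<epsilon>_def)
  have "surjective_at z \<and> bounded_below_at z" if z: "z \<noteq> 0" "norm z < \<epsilon>" for z
  proof
    have small: "C * norm z < 1"
    proof -
      have "C * norm z \<le> C * \<epsilon>" using z C(1) by (intro mult_left_mono) auto
      also have "\<dots> < 1" using C(1) by (simp add: \<epsilon>_def field_simps)
      finally show ?thesis .
    qed
    show "surjective_at z" unfolding surjective_at_def
    proof (intro allI impI)
      fix f :: "real \<Rightarrow> complex \<times> complex" assume f: "l2 f"
      let ?b = "ell f / ell ev"
      have lf0: "l2 (\<lambda>x. f x - cscale ?b (ev x))" by (intro l2_diff f l2_cscale l2_ev)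
      obtain \<phi> g where \<phi>: "h1 \<phi> g" "AE x in lborel. M.Op \<phi> g x - cscale z (\<phi> x) = f x - cscale ?b (ev x)"
      proof (rule M.neumann[of "cscale z" "norm z" "\<lambda>f. ell f = 0" C, OF cscale_linear _ _ _ _ _ _ C(1) small lf0 project[OF f]])
        show "\<exists>\<phi> g. h1 \<phi> g \<and> ell \<phi> = 0 \<and> (AE x in lborel. M.Op \<phi> g x = f x)" if "l2 f" "ell f = 0" for f :: "real \<Rightarrow> complex \<times> complex"
          using C0(2)[rule_format, OF that] by (elim exE conjE) (intro exI conjI, assumption, assumption, simp)
        show "ell (\<lambda>x. f x + cscale z (\<phi> x)) = 0" if "l2 f" "l2 \<phi>" "ell f = 0" "ell \<phi> = 0" for f \<phi> :: "real \<Rightarrow> complex \<times> complex"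
          using that by (simp add: ell_add l2_cscale ell_cscale)
        show "ell (\<lambda>x. \<phi> x - \<psi> x) = 0" if "l2 \<phi>" "l2 \<psi>" "ell \<phi> = 0" "ell \<psi> = 0" for \<phi> \<psi> :: "real \<Rightarrow> complex \<times> complex"
          using that by (simp add: ell_diff)
        show "l2norm \<phi> \<le> C * l2norm (M.Op \<phi> g)" if "h1 \<phi> g" "ell \<phi> = 0" for \<phi> g
          by (rule C(2)[rule_format, OF that])
      qed (auto simp: norm_cscale)
      \<comment> \<open>On \<open>ev\<close> the shifted operator is -z, so subtracting b / z times
        \<open>ev\<close> restores the missing component b \<open>ev\<close> of f.\<close>
      let ?k = "?b / z"
      have "AE x in lborel. M.Op (\<lambda>x. \<phi> x - cscale ?k (ev x)) (\<lambda>x. g x - cscale ?k (ev' x)) x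
              - cscale z (\<phi> x - cscale ?k (ev x)) = f x"
        using \<phi>(2)
      proof eventually_elim
        case (elim x)
        then show ?case using z(1) by (simp add: Op_cscale_ev cscale_simps algebra_simps)
      qed
      moreover have "h1 (\<lambda>x. \<phi> x - cscale ?k (ev x)) (\<lambda>x. g x - cscale ?k (ev' x))"
        by (intro h1_diff \<phi> h1_cscale h1_ev)
      ultimately show "\<exists>\<phi> g. h1 \<phi> g \<and> (AE x in lborel. M.Op \<phi> g x - cscale z (\<phi> x) = f x)"
        by (intro exI conjI)
    qed
    \<comment> \<open>\<open>a\<close> bounds the component along \<open>ev\<close> and blows up
      like 1 / |z|, as at a simple pole. \<open>b\<close> bounds the complementary component, after
      the term z \<phi> has been absorbed by C * |z| < 1.\<close>
    define a where "a = l2norm E * (\<kappa> + 1) / (norm z * norm (ell ev)) * l2norm ev"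
    define b where "b = C * K / (1 - C * norm z)"
    have ab: "0 \<le> a" "0 \<le> b" using \<kappa>(1) small C(1) K(1) by (auto simp: a_def b_def)
    have "l2norm \<phi> \<le> (b + a) * l2norm (\<lambda>x. M.Op \<phi> g x - cscale z (\<phi> x))" if h: "h1 \<phi> g" for \<phi> g
    proof -
      define f where "f x = M.Op \<phi> g x - cscale z (\<phi> x)" for x
      have lf: "l2 f" unfolding f_def by (rule l2_resolvent[OF h])
      note l\<phi> = h1D(1)[OF h]
      have ef: "ell f = - z * ell \<phi>"
        unfolding f_def by (simp add: ell_diff[OF M.l2_Op[OF h] l2_cscale(1)[OF l\<phi>]] ell_Op[OF h] ell_cscale[OF l\<phi>])
      define k where "k = ell \<phi> / ell ev"
      define \<phi>0 where "\<phi>0 x = \<phi> x - cscale k (ev x)" for x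
      define g0 where "g0 x = g x - cscale k (ev' x)" for x
      have h0: "h1 \<phi>0 g0" unfolding \<phi>0_def g0_def by (intro h1_diff h h1_cscale h1_ev)
      note l0 = h1D(1)[OF h0]
      have e0: "ell \<phi>0 = 0" unfolding \<phi>0_def k_def by (rule project[OF l\<phi>])
      have fk: "ell f / ell ev = - z * k" by (simp add: ef k_def)
      have Op0: "M.Op \<phi>0 g0 = (\<lambda>x. (f x - cscale (ell f / ell ev) (ev x)) + cscale z (\<phi>0 x))"
        unfolding fk by (rule ext) (simp add: \<phi>0_def[abs_def] g0_def[abs_def] Op_cscale_ev f_def cscale_simps)
      have "l2norm \<phi>0 \<le> C * l2norm (M.Op \<phi>0 g0)" by (rule C(2)[rule_format, OF h0 e0])
      also have "\<dots> \<le> C * (K * l2norm f + norm z * l2norm \<phi>0)"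
      proof (rule mult_left_mono[OF _ C(1)])
        have "l2norm (M.Op \<phi>0 g0) \<le> l2norm (\<lambda>x. f x - cscale (ell f / ell ev) (ev x)) + l2norm (\<lambda>x. cscale z (\<phi>0 x))"
          unfolding Op0 by (intro l2norm_triangle l2_diff lf l2_cscale l2_ev l0)
        then show "l2norm (M.Op \<phi>0 g0) \<le> K * l2norm f + norm z * l2norm \<phi>0"
          using K(2)[rule_format, OF lf] unfolding l2_cscale(2)[OF l0] by linarith
      qed
      finally have "(1 - C * norm z) * l2norm \<phi>0 \<le> C * K * l2norm f" by (simp add: algebra_simps)
      then have n0: "l2norm \<phi>0 \<le> b * l2norm f" using small by (simp add: b_def field_simps)
      have "norm k * l2norm ev \<le> a * l2norm f"
      proof -
        have "norm k = norm (ell f) / (norm z * norm (ell ev))"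
          using z(1) by (simp add: k_def ef norm_divide norm_mult)
        also have "\<dots> \<le> (l2norm E * (\<kappa> + 1) * l2norm f) / (norm z * norm (ell ev))"
          by (intro divide_right_mono ell_bound[OF lf]) auto
        finally have "norm k * l2norm ev \<le> (l2norm E * (\<kappa> + 1) * l2norm f) / (norm z * norm (ell ev)) * l2norm ev"
          by (rule mult_right_mono) simp
        then show ?thesis by (simp add: a_def mult_ac)
      qed
      moreover have "l2norm \<phi> \<le> l2norm \<phi>0 + norm k * l2norm ev"
      proof -
        have "\<phi> = (\<lambda>x. \<phi>0 x + cscale k (ev x))" by (simp add: \<phi>0_def)
        then show ?thesis using l2norm_triangle[OF l0 l2_cscale(1)[OF l2_ev, of k]] unfolding l2_cscale(2)[OF l2_ev] by simp
      qed
      ultimately have "l2norm \<phi> \<le> (b + a) * l2norm f" using n0 by (simp add: distrib_right)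
      then show ?thesis by (simp add: f_def[abs_def])
    qed
    then show "bounded_below_at z" unfolding bounded_below_at_def using ab by (intro exI[of _ "b + a"]) auto
  qed
  with \<epsilon> show ?thesis by blast
qed

text \<open>In characteristic variables the weight \<open>1 / n\<close> turns the quadratic form of the operator
  into an exact derivative minus a square.\<close>
lemma dissipative:
  assumes h: "h1 \<phi> g" shows "(\<integral>x. M.Op \<phi> g x \<bullet> \<phi> x \<partial>lborel) \<le> 0"
proof -
  note h1p = h1_linear[OF bounded_linear_fst h] and h1q = h1_linear[OF bounded_linear_snd h]
  let ?f = "\<lambda>x. (1 + c) *\<^sub>R (norm (fst (\<phi> x)))\<^sup>2 - (1 - c) *\<^sub>R (norm (snd (\<phi> x)))\<^sup>2"
  let ?g = "\<lambda>x. (1 + c) *\<^sub>R (2 * (fst (\<phi> x) \<bullet> fst (g x))) - (1 - c) *\<^sub>R (2 * (snd (\<phi> x) \<bullet> snd (g x)))"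
  have "ac ?f ?g"
    by (intro ac_diff ac_linear[OF bounded_linear_scaleR_right] ac_norm_square h1D(3)[OF h1p] h1D(3)[OF h1q])
  moreover have "integrable lborel ?f"
    using l2D(2)[OF h1D(1)[OF h1p]] l2D(2)[OF h1D(1)[OF h1q]] by auto
  moreover have ig: "integrable lborel ?g"
    using l2_inner_integrable(1)[OF h1D(1)[OF h1p] h1D(2)[OF h1p]] l2_inner_integrable(1)[OF h1D(1)[OF h1q] h1D(2)[OF h1q]]
    by auto
  ultimately have zero: "(\<integral>x. ?g x \<partial>lborel) = 0" by (intro integral_derivative_zero)
  have "(\<integral>x. M.Op \<phi> g x \<bullet> \<phi> x \<partial>lborel) \<le> (\<integral>x. ?g x / 2 \<partial>lborel)"
  proof (rule integral_mono)
    show "integrable lborel (\<lambda>x. M.Op \<phi> g x \<bullet> \<phi> x)" by (rule l2_inner_integrable(1)[OF M.l2_Op[OF h] h1D(1)[OF h]])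
    show "integrable lborel (\<lambda>x. ?g x / 2)" using ig by simp
    fix x
    obtain p q where pq: "\<phi> x = (p, q)" by (cases "\<phi> x")
    obtain p1 q1 where pq1: "g x = (p1, q1)" by (cases "g x")
    have "0 \<le> c * m x * (1 / \<kappa>) * (norm (p - \<kappa> *\<^sub>R q))\<^sup>2" using cm_bound(1)[of x] \<kappa>(1) by simp
    also have "(norm (p - \<kappa> *\<^sub>R q))\<^sup>2 = (norm p)\<^sup>2 - 2 * \<kappa> * (p \<bullet> q) + \<kappa>\<^sup>2 * (norm q)\<^sup>2"
      unfolding power2_norm_eq_inner
      by (simp add: inner_diff_left inner_diff_right inner_commute power2_eq_square[of \<kappa>] algebra_simps)
    also have "c * m x * (1 / \<kappa>) * \<dots> = c * m x / \<kappa> * (norm p)\<^sup>2 - 2 * (c * m x) * (p \<bullet> q) + \<kappa> * c * m x * (norm q)\<^sup>2"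
      using \<kappa>(1) by (simp add: field_simps power2_eq_square)
    finally have sq: "0 \<le> c * m x / \<kappa> * (norm p)\<^sup>2 - 2 * (c * m x) * (p \<bullet> q) + \<kappa> * c * m x * (norm q)\<^sup>2" .
    have O: "M.Op \<phi> g x = ((1 + c) *\<^sub>R p1 - (c * m x / \<kappa>) *\<^sub>R p - (h x - c * m x) *\<^sub>R q,
        (- (1 - c)) *\<^sub>R q1 + (h x + c * m x) *\<^sub>R p - (\<kappa> * c * m x) *\<^sub>R q)"
      by (rule prod_eqI) (simp_all only: Op_components pq pq1 fst_conv snd_conv)
    have "M.Op \<phi> g x \<bullet> \<phi> x = ((1 + c) * (p1 \<bullet> p) - (c * m x / \<kappa>) * (norm p)\<^sup>2 - (h x - c * m x) * (q \<bullet> p))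
       + (- (1 - c) * (q1 \<bullet> q) + (h x + c * m x) * (p \<bullet> q) - (\<kappa> * c * m x) * (norm q)\<^sup>2)"
      unfolding O pq inner_Pair inner_diff_left inner_add_left inner_scaleR_left power2_norm_eq_inner ..
    also have "\<dots> = ?g x / 2 - (c * m x / \<kappa> * (norm p)\<^sup>2 - 2 * (c * m x) * (p \<bullet> q) + \<kappa> * c * m x * (norm q)\<^sup>2)"
      unfolding pq pq1 fst_conv snd_conv real_scaleR_def inner_commute[of p1 p] inner_commute[of q1 q] inner_commute[of q p]
      by (simp add: left_diff_distrib distrib_right diff_divide_distrib)
    finally show "M.Op \<phi> g x \<bullet> \<phi> x \<le> ?g x / 2" using sq by linarith
  qed
  also have "\<dots> = 0" using zero by simp
  finally show ?thesis .
qed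

text \<open>With x = Re z and \<psi> the image of \<phi>, dissipativity gives a pairing of \<psi>
  with \<phi> of at most -x times the squared norm of \<phi>. Expanding the nonnegative squared norm
  of \<psi> + x \<phi> then gives the bound. Only Re z appears because the inner product is the real
  part of the complex one.\<close>

lemma resolvent_bound:
  assumes h: "h1 \<phi> g" and z: "Re z > 0"
  shows "l2norm \<phi> \<le> (1 / Re z) * l2norm (\<lambda>x. M.Op \<phi> g x - cscale z (\<phi> x))"
proof -
  define \<psi> where "\<psi> x = M.Op \<phi> g x - cscale z (\<phi> x)" for x
  have l\<psi>: "l2 \<psi>" unfolding \<psi>_def by (rule l2_resolvent[OF h])
  note l\<phi> = h1D(1)[OF h]
  let ?x = "Re z"
  note i1 = l2_inner_integrable(1)[OF M.l2_Op[OF h] l\<phi>] and i2 = l2D(2)[OF l\<phi>] and i3 = l2D(2)[OF l\<psi>]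
  have i4: "integrable lborel (\<lambda>x. \<psi> x \<bullet> \<phi> x)" by (rule l2_inner_integrable(1)[OF l\<psi> l\<phi>])
  have in1: "(\<integral>x. \<psi> x \<bullet> \<phi> x \<partial>lborel) \<le> - ?x * (l2norm \<phi>)\<^sup>2"
  proof -
    have "(\<integral>x. \<psi> x \<bullet> \<phi> x \<partial>lborel) = (\<integral>x. M.Op \<phi> g x \<bullet> \<phi> x - ?x * (norm (\<phi> x))\<^sup>2 \<partial>lborel)"
      by (simp add: \<psi>_def inner_diff_left inner_cscale)
    also have "\<dots> = (\<integral>x. M.Op \<phi> g x \<bullet> \<phi> x \<partial>lborel) - ?x * (l2norm \<phi>)\<^sup>2"
      unfolding l2norm_power2 using i1 i2 by simp
    finally show ?thesis using dissipative[OF h] by simp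
  qed
  have "0 \<le> (\<integral>x. (norm (\<psi> x + ?x *\<^sub>R \<phi> x))\<^sup>2 \<partial>lborel)" by simp
  also have "\<dots> = (\<integral>x. (norm (\<psi> x))\<^sup>2 + (2 * ?x) * (\<psi> x \<bullet> \<phi> x) + ?x\<^sup>2 * (norm (\<phi> x))\<^sup>2 \<partial>lborel)"
    unfolding power2_norm_eq_inner
    by (rule Bochner_Integration.integral_cong)
       (simp_all add: inner_add_left inner_add_right inner_commute power2_eq_square[of "Re z"] algebra_simps)
  also have "\<dots> = (l2norm \<psi>)\<^sup>2 + 2 * ?x * (\<integral>x. \<psi> x \<bullet> \<phi> x \<partial>lborel) + ?x\<^sup>2 * (l2norm \<phi>)\<^sup>2"
    unfolding l2norm_power2 using i2 i3 i4 by simp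
  also have "\<dots> \<le> (l2norm \<psi>)\<^sup>2 + 2 * ?x * (- ?x * (l2norm \<phi>)\<^sup>2) + ?x\<^sup>2 * (l2norm \<phi>)\<^sup>2"
    using in1 z by (intro add_mono mult_left_mono) auto
  also have "\<dots> = (l2norm \<psi>)\<^sup>2 - (?x * l2norm \<phi>)\<^sup>2" by (simp add: power_mult_distrib power2_eq_square)
  finally have "(?x * l2norm \<phi>)\<^sup>2 \<le> (l2norm \<psi>)\<^sup>2" by linarith
  then have "?x * l2norm \<phi> \<le> l2norm \<psi>" by (rule power2_le_imp_le) simp
  then show ?thesis using z by (simp add: \<psi>_def[abs_def] field_simps)
qed

text \<open>The radius \<open>z0\<close> of the disc is the reciprocal of the resolvent bound 1 / z0
  at its centre.\<close>

lemma surjective_step: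
  assumes z0: "z0 > 0" and s0: "surjective_at (complex_of_real z0)" and z: "norm (z - complex_of_real z0) < z0"
  shows "surjective_at z"
  unfolding surjective_at_def
proof (intro allI impI)
  fix f :: "real \<Rightarrow> complex \<times> complex" assume f: "l2 f"
  let ?z0 = "complex_of_real z0"
  interpret N: first_order S T "\<lambda>x v. B x v - cscale ?z0 v" "\<beta> + norm ?z0" by (rule first_order_kink)
  have NOp: "N.Op \<phi> g x = M.Op \<phi> g x - cscale ?z0 (\<phi> x)" for \<phi> g x by (simp add: N.Op_def M.Op_def)
  obtain \<phi> g where \<phi>: "h1 \<phi> g" "AE x in lborel. N.Op \<phi> g x - cscale (z - ?z0) (\<phi> x) = f x"
  proof (rule N.neumann[of "cscale (z - ?z0)" "norm (z - ?z0)" "\<lambda>_. True" "1 / z0", OF cscale_linear _ _ _ _ _ _ _ _ f])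
    show "\<exists>\<phi> g. h1 \<phi> g \<and> True \<and> (AE x in lborel. N.Op \<phi> g x = f x)" if "l2 f" for f :: "real \<Rightarrow> complex \<times> complex"
      using s0 that unfolding surjective_at_def NOp by simp
    show "l2norm \<phi> \<le> 1 / z0 * l2norm (N.Op \<phi> g)" if "h1 \<phi> g" for \<phi> g
      using resolvent_bound[OF that, of ?z0] z0 by (simp add: NOp[abs_def])
    show "1 / z0 * norm (z - ?z0) < 1" using z z0 by (simp add: field_simps)
  qed (use z0 in \<open>auto simp: norm_cscale\<close>)
  show "\<exists>\<phi> g. h1 \<phi> g \<and> (AE x in lborel. M.Op \<phi> g x - cscale z (\<phi> x) = f x)"
  proof (intro exI conjI)
    show "AE x in lborel. M.Op \<phi> g x - cscale z (\<phi> x) = f x"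
      using \<phi>(2) by eventually_elim (simp add: NOp cscale_simps algebra_simps)
  qed (rule \<phi>)
qed

text \<open>The discs with centre t and radius t exhaust the open right half plane as t grows, so it
  suffices to reach arbitrarily large positive reals.\<close>

theorem right_half_plane:
  assumes z: "Re z > 0" shows "surjective_at z \<and> bounded_below_at z"
proof
  show "bounded_below_at z" unfolding bounded_below_at_def
    using resolvent_bound[OF _ z] z by (intro exI[of _ "1 / Re z"]) auto
  obtain \<epsilon> where \<epsilon>: "\<epsilon> > 0" "\<forall>z. z \<noteq> 0 \<longrightarrow> norm z < \<epsilon> \<longrightarrow> surjective_at z \<and> bounded_below_at z"
    using punctured_neighbourhood by (elim exE conjE)
  \<comment> \<open>The start lies in the punctured neighbourhood of 0. With the growth factor 3/2
    the next point is at distance t / 2, inside the disc of radius t.\<close>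
  define t where "t k = \<epsilon> / 2 * (3 / 2) ^ k" for k :: nat
  have t: "t k > 0" for k using \<epsilon>(1) by (simp add: t_def)
  have sur: "surjective_at (complex_of_real (t k))" for k
  proof (induction k)
    case 0
    then show ?case using \<epsilon> by (simp add: t_def)
  next
    case (Suc k)
    have "complex_of_real (t (Suc k)) - complex_of_real (t k) = complex_of_real (t k / 2)" by (simp add: t_def)
    then have "norm (complex_of_real (t (Suc k)) - complex_of_real (t k)) = t k / 2"
      using t[of k] by (simp only: norm_of_real)
    then show ?case using t[of k] by (intro surjective_step[OF t Suc]) simp
  qed
  \<comment> \<open>The disc around t contains z exactly when |z|^2 < 2 t Re z.\<close>
  obtain k where k: "(norm z)\<^sup>2 / (2 * Re z) / (\<epsilon> / 2) < (3 / 2) ^ k"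
    using real_arch_pow[of "3 / 2 :: real"] by auto
  have big: "(norm z)\<^sup>2 < 2 * Re z * t k"
    using k z \<epsilon>(1) by (simp add: t_def field_simps)
  have "(norm (z - complex_of_real (t k)))\<^sup>2 = (norm z)\<^sup>2 - 2 * Re z * t k + (t k)\<^sup>2"
    by (simp add: cmod_power2 power2_diff)
  then have "(norm (z - complex_of_real (t k)))\<^sup>2 < (t k)\<^sup>2" using big by simp
  then have "norm (z - complex_of_real (t k)) < t k"
    by (rule power2_less_imp_less[OF _ less_imp_le[OF t]])
  then show "surjective_at z" by (rule surjective_step[OF t sur])
qed

end

section \<open>The kink profile and its weight\<close>

lemma continuous_bounded_Icc:
  fixes f :: "real \<Rightarrow> real"
  assumes "continuous_on {a..b} f" shows "\<exists>M. \<forall>x\<in>{a..b}. \<bar>f x\<bar> \<le> M"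
proof -
  have "bounded (f ` {a..b})" by (intro compact_imp_bounded compact_continuous_image assms) simp
  then obtain M where "\<forall>y\<in>f ` {a..b}. norm y \<le> M" unfolding bounded_iff ..
  then show ?thesis by auto
qed

locale kink_profile =
  fixes Nd :: "nat \<Rightarrow> real \<Rightarrow> real" and c \<theta> K :: real
    and u v :: "real \<Rightarrow> real" and wd :: "nat \<Rightarrow> real \<Rightarrow> real"
  assumes N_smooth: "\<forall>k. \<forall>s\<ge>0. (Nd k has_real_derivative Nd (Suc k) s) (at s within {0..})"
    and N_decr: "\<forall>s>0. Nd 1 s < 0"
    and N_0: "Nd 0 0 = 1" and N_1: "Nd 0 1 = 0"
    and K_def: "K = - Nd 1 1"
    and N_concave: "\<forall>s\<in>{0..1}. Nd 2 s \<le> 0"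
    and c_range: "0 \<le> c" "c < 1"
    and theta_def: "\<theta> = - arcsin c / 2"
    and u_ode: "\<forall>x. (u has_real_derivative u x * Nd 0 ((u x)\<^sup>2 + (v x)\<^sup>2) / sqrt (1 - c\<^sup>2)) (at x)"
    and v_def: "\<forall>x. v x = u x * tan \<theta>"
    and u_pos: "\<forall>x. u x > 0"
    and u_norm: "(u 0)\<^sup>2 + (v 0)\<^sup>2 = 1/4"
    and w_smooth: "\<forall>k x. (wd k has_real_derivative wd (Suc k) x) (at x)"
    and w_left: "\<forall>x\<le>-1. wd 0 x = 0"
    and w_right: "\<forall>x\<ge>1. wd 0 x = K / sqrt (1 - c\<^sup>2) * x"
begin

section \<open>Mean value estimates for the nonlinearity\<close>

lemma K_pos: "K > 0" using N_decr K_def by simp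

lemma Nd_cont: "continuous_on {0..} (Nd k)"
  by (rule DERIV_continuous_on) (use N_smooth in auto)

lemma Nd_deriv: "x > 0 \<Longrightarrow> (Nd k has_real_derivative Nd (Suc k) x) (at x)"
proof -
  assume x: "x > 0"
  then have "(Nd k has_real_derivative Nd (Suc k) x) (at x within {0..})" using N_smooth by simp
  moreover have "at x within {0..} = at x" using x by (intro at_within_interior) simp
  ultimately show ?thesis by simp
qed

lemma Nd_mvt:
  assumes "0 \<le> a" "a < b" obtains \<xi> where "a < \<xi>" "\<xi> < b" "Nd k b - Nd k a = (b - a) * Nd (Suc k) \<xi>"
proof -
  have "continuous_on {a..b} (Nd k)" using assms by (intro continuous_on_subset[OF Nd_cont]) auto
  moreover have "Nd k differentiable (at x)" if "a < x" for x
    using Nd_deriv[of x k] that assms real_differentiable_def by force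
  ultimately obtain l z where "a < z" "z < b" "DERIV (Nd k) z :> l" "Nd k b - Nd k a = (b - a) * l"
    using MVT[OF assms(2), of "Nd k"] by blast
  moreover have "l = Nd (Suc k) z" using calculation assms by (intro DERIV_unique[OF _ Nd_deriv]) auto
  ultimately show ?thesis using that by blast
qed

lemma N_strict: "0 \<le> a \<Longrightarrow> a < b \<Longrightarrow> Nd 0 b < Nd 0 a"
proof -
  assume ab: "0 \<le> a" "a < b"
  obtain \<xi> where \<xi>: "a < \<xi>" "Nd 0 b - Nd 0 a = (b - a) * Nd (Suc 0) \<xi>" using Nd_mvt[OF ab] by metis
  have "Nd (Suc 0) \<xi> < 0" using N_decr \<xi>(1) ab by simp
  then have "(b - a) * Nd (Suc 0) \<xi> < 0" using ab by (simp add: mult_pos_neg)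
  then show ?thesis using \<xi>(2) by linarith
qed

text \<open>A concave function lies above its chord, here the chord from (0, 1) to (1, 0).\<close>

lemma N_ge: assumes "0 < \<sigma>" "\<sigma> < 1" shows "1 - \<sigma> \<le> Nd 0 \<sigma>"
proof -
  obtain \<xi>1 where 1: "0 < \<xi>1" "\<xi>1 < \<sigma>" "Nd 0 \<sigma> - Nd 0 0 = (\<sigma> - 0) * Nd (Suc 0) \<xi>1"
    using Nd_mvt[of 0 \<sigma> 0] assms by auto
  obtain \<xi>2 where 2: "\<sigma> < \<xi>2" "\<xi>2 < 1" "Nd 0 1 - Nd 0 \<sigma> = (1 - \<sigma>) * Nd (Suc 0) \<xi>2"
    using Nd_mvt[of \<sigma> 1 0] assms by auto
  obtain \<xi> where 3: "\<xi>1 < \<xi>" "\<xi> < \<xi>2" "Nd (Suc 0) \<xi>2 - Nd (Suc 0) \<xi>1 = (\<xi>2 - \<xi>1) * Nd (Suc (Suc 0)) \<xi>"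
    using Nd_mvt[of \<xi>1 \<xi>2 "Suc 0"] 1 2 by auto
  have "Nd 2 \<xi> \<le> 0" using N_concave 1 2 3 by simp
  then have "(\<xi>2 - \<xi>1) * Nd (Suc (Suc 0)) \<xi> \<le> 0"
    using 3 by (intro mult_nonneg_nonpos) (auto simp: numeral_2_eq_2)
  then have le: "Nd (Suc 0) \<xi>2 \<le> Nd (Suc 0) \<xi>1" using 3 by linarith
  have e1: "Nd 0 \<sigma> = 1 + \<sigma> * Nd (Suc 0) \<xi>1" using 1 N_0 by simp
  have e2: "Nd 0 \<sigma> = - (1 - \<sigma>) * Nd (Suc 0) \<xi>2" using 2 N_1 by (simp add: algebra_simps)
  \<comment> \<open>Weighting the two mean value forms by 1 - \<sigma> and \<sigma> isolates the
    difference of the two slopes, which concavity makes nonnegative.\<close>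
  have "Nd 0 \<sigma> = (1 - \<sigma>) * Nd 0 \<sigma> + \<sigma> * Nd 0 \<sigma>" by (simp add: algebra_simps)
  also have "(1 - \<sigma>) * Nd 0 \<sigma> = (1 - \<sigma>) * (1 + \<sigma> * Nd (Suc 0) \<xi>1)" using e1 by simp
  also have "\<sigma> * Nd 0 \<sigma> = \<sigma> * (- (1 - \<sigma>) * Nd (Suc 0) \<xi>2)" using e2 by simp
  finally have "Nd 0 \<sigma> = (1 - \<sigma>) + \<sigma> * (1 - \<sigma>) * (Nd (Suc 0) \<xi>1 - Nd (Suc 0) \<xi>2)" by (simp add: algebra_simps)
  moreover have "0 \<le> \<sigma> * (1 - \<sigma>) * (Nd (Suc 0) \<xi>1 - Nd (Suc 0) \<xi>2)" using assms le by simp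
  ultimately show ?thesis by linarith
qed

definition s :: real where "s = sqrt (1 - c\<^sup>2)"

lemma s_pos: "s > 0" using c_range by (simp add: s_def power_less_one_iff abs_square_less_1)

lemma trig: "cos \<theta> > 0" "2 * (sin \<theta> * cos \<theta>) = - c" "(cos \<theta>)\<^sup>2 - (sin \<theta>)\<^sup>2 = s"
proof -
  have a: "0 \<le> arcsin c" "arcsin c \<le> pi / 2"
    using arcsin_le_arcsin[of 0 c] arcsin_ubound[of c] c_range by auto
  have "\<bar>\<theta>\<bar> < pi / 2" unfolding theta_def using a pi_gt_zero by linarith
  then show "cos \<theta> > 0" by (intro cos_gt_zero_pi) auto
  have "sin (2 * \<theta>) = - c" using c_range by (simp add: theta_def)
  then show "2 * (sin \<theta> * cos \<theta>) = - c" by (simp add: sin_double)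
  have "cos (2 * \<theta>) = s" using c_range by (simp add: theta_def s_def cos_arcsin)
  then show "(cos \<theta>)\<^sup>2 - (sin \<theta>)\<^sup>2 = s" by (simp add: cos_double)
qed

section \<open>Polar amplitude of the kink\<close>

definition r :: "real \<Rightarrow> real" where "r x = u x / cos \<theta>"

lemma uv: "u x = r x * cos \<theta>" "v x = r x * sin \<theta>" "(u x)\<^sup>2 + (v x)\<^sup>2 = (r x)\<^sup>2"
proof -
  show 1: "u x = r x * cos \<theta>" using trig(1) by (simp add: r_def)
  show 2: "v x = r x * sin \<theta>" using v_def by (simp add: r_def tan_def)
  show "(u x)\<^sup>2 + (v x)\<^sup>2 = (r x)\<^sup>2"
    unfolding 1 2 power_mult_distrib distrib_left[symmetric] by simp
qed

definition n :: "real \<Rightarrow> real" where "n x = Nd 0 ((r x)\<^sup>2)"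

definition m :: "real \<Rightarrow> real" where "m x = - Nd 1 ((r x)\<^sup>2) * (r x)\<^sup>2"

lemma u_deriv: "(u has_real_derivative u x * n x / s) (at x)"
  using u_ode by (simp add: uv(3) n_def s_def)

lemma r_deriv: "(r has_real_derivative r x * n x / s) (at x)"
proof -
  have "((\<lambda>x. u x / cos \<theta>) has_real_derivative u x * n x / s / cos \<theta>) (at x)"
    by (intro DERIV_cdivide u_deriv)
  then show ?thesis by (simp add: r_def[abs_def] mult.commute)
qed

lemma r_pos: "r x > 0" using u_pos trig(1) by (simp add: r_def)

lemma r_cont: "continuous_on UNIV r"
  by (rule DERIV_continuous_on) (use r_deriv has_field_derivative_at_within in blast)

lemma Nd_r_cont: "continuous_on UNIV (\<lambda>x. Nd k ((r x)\<^sup>2))"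
  by (rule continuous_on_compose2[OF Nd_cont]) (auto intro!: continuous_intros r_cont)

lemma r0: "r 0 = 1 / 2"
proof -
  have "(r 0)\<^sup>2 = (1 / 2)\<^sup>2" using u_norm uv(3)[of 0] by (simp add: power2_eq_square)
  then show ?thesis using r_pos[of 0] power2_eq_imp_eq[of "r 0" "1 / 2"] by simp
qed

text \<open>Since \<open>N(1) = 0\<close>, the deficit \<open>1 - r\<^sup>2\<close> solves a linear equation with continuous coefficient,
  so it keeps its sign.\<close>
lemma r_less: "r x < 1"
proof -
  \<comment> \<open>The quotient N(\<sigma>) / (1 - \<sigma>), extended continuously to 1 by its
    limit -N'(1) = K.\<close>
  define Q where "Q \<sigma> = (if \<sigma> = 1 then K else Nd 0 \<sigma> / (1 - \<sigma>))" for \<sigma>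
  have NQ: "Nd 0 \<sigma> = (1 - \<sigma>) * Q \<sigma>" for \<sigma> using N_1 by (simp add: Q_def)
  have "continuous (at \<sigma> within {0..}) Q" if "\<sigma> \<ge> 0" for \<sigma>
  proof (cases "\<sigma> = 1")
    case True
    have "(Nd 0 has_real_derivative Nd 1 1) (at 1)" using Nd_deriv[of 1 0] by simp
    then have "((\<lambda>y. (Nd 0 y - Nd 0 1) / (y - 1)) \<longlongrightarrow> Nd 1 1) (at 1)" by (simp add: has_field_derivative_iff)
    then have "((\<lambda>y. - ((Nd 0 y - Nd 0 1) / (y - 1))) \<longlongrightarrow> K) (at 1)" unfolding K_def by (rule tendsto_minus)
    then have "(Q \<longlongrightarrow> K) (at 1)"
    proof (rule Lim_transform_eventually)
      show "\<forall>\<^sub>F y in at 1. - ((Nd 0 y - Nd 0 1) / (y - 1)) = Q y"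
        by (rule eventually_at_filter[THEN iffD2], rule always_eventually)
           (auto simp: Q_def N_1 divide_simps algebra_simps)
    qed
    then have "continuous (at 1) Q" by (simp add: continuous_within Q_def)
    then show ?thesis using True continuous_within_subset by blast
  next
    case False
    have "continuous (at \<sigma> within {0..}) (\<lambda>y. Nd 0 y / (1 - y))"
      using False that Nd_cont[of 0] by (intro continuous_intros) (auto simp: continuous_on_eq_continuous_within)
    moreover have "\<forall>\<^sub>F y in at \<sigma> within {0..}. Nd 0 y / (1 - y) = Q y"
      using eventually_neq_at_within[of 1 \<sigma> "{0..}"] by eventually_elim (simp add: Q_def)
    ultimately show ?thesis using False
      by (auto simp: continuous_within Q_def intro: Lim_transform_eventually)
  qed
  then have Qc: "continuous_on {0..} Q" by (simp add: continuous_on_eq_continuous_within)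
  define a where "a y = - 2 * (r y)\<^sup>2 * Q ((r y)\<^sup>2) / s" for y
  have ac: "continuous_on A a" for A
    unfolding a_def
    by (intro continuous_intros continuous_on_compose2[OF Qc] continuous_on_subset[OF r_cont]) (use s_pos in auto)
  have yd: "((\<lambda>x. 1 - (r x)\<^sup>2) has_real_derivative a y * (1 - (r y)\<^sup>2)) (at y)" for y
  proof -
    have "((\<lambda>x. 1 - (r x)\<^sup>2) has_real_derivative - (2 * r y * (r y * n y / s))) (at y)"
      by (auto intro!: derivative_eq_intros r_deriv)
    moreover have "n y = (1 - (r y)\<^sup>2) * Q ((r y)\<^sup>2)" unfolding n_def by (rule NQ)
    then have "- (2 * r y * (r y * n y / s)) = a y * (1 - (r y)\<^sup>2)" by (simp add: a_def power2_eq_square[of "r y"])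
    ultimately show ?thesis by simp
  qed
  \<comment> \<open>An interval containing both 0, where r = 1/2 is known, and \<open>x\<close>. On
    it \<open>exp (- g)\<close> is the integrating factor of the linear equation for 1 -
    r^2.\<close>
  define L where "L = \<bar>x\<bar> + 1"
  obtain g where g: "\<And>y. y \<in> {-L..L} \<Longrightarrow> (g has_vector_derivative a y) (at y within {-L..L})"
    using antiderivative_continuous[OF ac, of "-L" L] by blast
  have "\<exists>k. \<forall>y\<in>{-L..L}. (1 - (r y)\<^sup>2) * exp (- g y) = k"
  proof (rule has_field_derivative_zero_constant)
    fix y assume y: "y \<in> {-L..L}"
    have gd: "(g has_real_derivative a y) (at y within {-L..L})"
      using g[OF y] by (simp add: has_real_derivative_iff_has_vector_derivative)
    have "((\<lambda>y. (1 - (r y)\<^sup>2) * exp (- g y)) has_real_derivative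
        a y * (1 - (r y)\<^sup>2) * exp (- g y) + exp (- g y) * (- a y) * (1 - (r y)\<^sup>2)) (at y within {-L..L})"
      by (rule DERIV_mult[OF has_field_derivative_at_within[OF yd] DERIV_chain2[OF DERIV_exp DERIV_minus[OF gd]]])
    then show "((\<lambda>y. (1 - (r y)\<^sup>2) * exp (- g y)) has_real_derivative 0) (at y within {-L..L})"
      by (simp add: algebra_simps)
  qed simp
  then obtain k where k: "\<And>y. y \<in> {-L..L} \<Longrightarrow> (1 - (r y)\<^sup>2) * exp (- g y) = k" by blast
  have "(1 - (r 0)\<^sup>2) * exp (- g 0) = k" by (rule k) (simp add: L_def)
  then have "k = (1 - (1 / 2)\<^sup>2) * exp (- g 0)" unfolding r0 by simp
  moreover have "(1 - (1 / 2)\<^sup>2) * exp (- g 0) > 0" by (simp add: power2_eq_square)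
  ultimately have "k > 0" by simp
  then have "(1 - (r x)\<^sup>2) * exp (- g x) > 0"
    by (subst k) (auto simp: L_def intro: abs_le_D2 order_trans[OF abs_ge_self])
  then have "(r x)\<^sup>2 < 1" by (simp add: zero_less_mult_iff)
  then show ?thesis using r_pos[of x] by (simp add: power2_less_imp_less[of "r x" 1])
qed

lemma r2: "0 < (r x)\<^sup>2" "(r x)\<^sup>2 < 1" "(r x)\<^sup>2 \<in> {0..1}"
  using r_pos[of x] r_less[of x] by (auto simp: power_less_one_iff less_imp_le abs_square_less_1 power_le_one)

lemma n_bounds: "0 < n x" "n x \<le> 1" "1 - (r x)\<^sup>2 \<le> n x"
  using N_strict[of "(r x)\<^sup>2" 1] N_strict[of 0 "(r x)\<^sup>2"] N_ge[OF r2(1,2)] r2[of x] N_0 N_1 by (auto simp: n_def)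

lemma n_deriv: "(n has_real_derivative - 2 * m x * n x / s) (at x)"
proof -
  have "((\<lambda>x. Nd 0 ((r x)\<^sup>2)) has_real_derivative Nd (Suc 0) ((r x)\<^sup>2) * (2 * r x * (r x * n x / s))) (at x)"
    by (rule DERIV_chain2[where f = "Nd 0" and g = "\<lambda>x. (r x)\<^sup>2", OF Nd_deriv[OF r2(1)]]) (auto intro!: derivative_eq_intros r_deriv)
  then show ?thesis by (simp add: n_def[abs_def] m_def n_def power2_eq_square algebra_simps)
qed

lemma m_cont: "continuous_on UNIV m"
  unfolding m_def by (intro continuous_intros Nd_r_cont[of 1] r_cont)

lemma m_nonneg: "0 \<le> m x"
  using N_decr r2[of x] by (simp add: m_def mult_nonpos_nonneg less_imp_le)

lemma m_bounded: "\<exists>\<mu>. \<forall>x. m x \<le> \<mu>"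
proof -
  have "continuous_on {0..1} (\<lambda>\<sigma>. - Nd 1 \<sigma> * \<sigma>)"
    by (intro continuous_intros continuous_on_subset[OF Nd_cont]) auto
  from continuous_bounded_Icc[OF this] obtain \<mu> where \<mu>: "\<forall>\<sigma>\<in>{0..1}. \<bar>- Nd 1 \<sigma> * \<sigma>\<bar> \<le> \<mu>" ..
  have "\<bar>m x\<bar> \<le> \<mu>" for x unfolding m_def by (rule \<mu>[rule_format, OF r2(3)])
  then have "m x \<le> \<mu>" for x using abs_ge_self order_trans by blast
  then show ?thesis by blast
qed

text \<open>K is the value of -N'(\<sigma>) \<sigma> at 1, so the mean value theorem bounds K - m by
  a multiple of 1 - r^2, and the concavity bound replaces that by n. Along the kink n / s is the
  derivative of ln r, which makes the difference integrable to the right.\<close>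

lemma m_near_K: "\<exists>C\<ge>0. \<forall>x. \<bar>K - m x\<bar> \<le> C * n x"
proof -
  have "continuous_on {0..1} (\<lambda>\<sigma>. - Nd 2 \<sigma> * \<sigma> - Nd 1 \<sigma>)"
    by (intro continuous_intros continuous_on_subset[OF Nd_cont]) auto
  from continuous_bounded_Icc[OF this] obtain C where C: "\<forall>\<sigma>\<in>{0..1}. \<bar>- Nd 2 \<sigma> * \<sigma> - Nd 1 \<sigma>\<bar> \<le> C" ..
  have "\<bar>- Nd 2 0 * 0 - Nd 1 0\<bar> \<le> C" by (rule C[rule_format]) simp
  then have C0: "0 \<le> C" by linarith
  have "\<bar>K - m x\<bar> \<le> C * n x" for x
  proof -
    let ?\<sigma> = "(r x)\<^sup>2"
    have "\<exists>z. ?\<sigma> < z \<and> z < 1 \<and> (- Nd 1 1 * 1) - (- Nd 1 ?\<sigma> * ?\<sigma>) = (1 - ?\<sigma>) * (- Nd 2 z * z - Nd 1 z)"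
    proof (rule MVT2[OF r2(2)])
      fix y assume "?\<sigma> \<le> y" "y \<le> 1"
      then have "y > 0" using r2(1)[of x] by linarith
      then show "((\<lambda>y. - Nd 1 y * y) has_real_derivative - Nd 2 y * y - Nd 1 y) (at y)"
        using Nd_deriv[of y 1] by (auto intro!: derivative_eq_intros simp: numeral_2_eq_2)
    qed
    then obtain z where z: "?\<sigma> < z" "z < 1" "K - m x = (1 - ?\<sigma>) * (- Nd 2 z * z - Nd 1 z)"
      by (auto simp: K_def m_def)
    have zC: "\<bar>- Nd 2 z * z - Nd 1 z\<bar> \<le> C" 
    proof (rule C[rule_format])
      have "0 < z" using z r2(1)[of x] by linarith
      then show "z \<in> {0..1}" using z by simp
    qed
    have "\<bar>K - m x\<bar> = (1 - ?\<sigma>) * \<bar>- Nd 2 z * z - Nd 1 z\<bar>" unfolding z(3) abs_mult using r2(2)[of x] by simp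
    also have "\<dots> \<le> n x * C" using zC n_bounds[of x] r2(2)[of x] C0 by (intro mult_mono) auto
    finally show ?thesis by (simp add: mult.commute)
  qed
  then show ?thesis using C0 by blast
qed

section \<open>Limits of the kink and signs of h at both ends\<close>

lemma r_mono: "a \<le> b \<Longrightarrow> r a \<le> r b"
  by (rule DERIV_nonneg_imp_nondecreasing) (use r_deriv r_pos n_bounds s_pos in \<open>auto intro!: exI simp: less_imp_le\<close>)

lemma n_mono: "a \<le> b \<Longrightarrow> n b \<le> n a"
proof -
  assume "a \<le> b"
  then have "(r a)\<^sup>2 \<le> (r b)\<^sup>2" using r_mono r_pos[of a] by (intro power_mono) auto
  then show ?thesis using N_strict[of "(r a)\<^sup>2" "(r b)\<^sup>2"] unfolding n_def by (cases "(r a)\<^sup>2 = (r b)\<^sup>2") auto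
qed

lemma r_growth:
  assumes "a < b" "\<And>x. a \<le> x \<Longrightarrow> x \<le> b \<Longrightarrow> k \<le> r x * n x / s" shows "r b - r a \<ge> (b - a) * k"
proof -
  obtain z where z: "a < z" "z < b" "r b - r a = (b - a) * (r z * n z / s)"
    using MVT2[OF assms(1), of r "\<lambda>x. r x * n x / s"] r_deriv by blast
  show ?thesis unfolding z(3) using assms z by (intro mult_left_mono) auto
qed

lemma r_to_1: assumes "\<eta> > 0" shows "\<exists>X>0. \<forall>x\<ge>X. 1 - \<eta> < (r x)\<^sup>2"
proof -
  \<comment> \<open>If r^2 stayed below 1 - \<eta> on [0, X], then r \<ge> 1/2 and n \<ge> \<eta>
    would make r grow by 1 over this length, past its bound.\<close>
  define X where "X = 2 * s / \<eta>"
  have X: "X > 0" using s_pos assms by (simp add: X_def)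
  have "1 - \<eta> < (r X)\<^sup>2"
  proof (rule ccontr)
    assume "\<not> 1 - \<eta> < (r X)\<^sup>2"
    then have le: "(r X)\<^sup>2 \<le> 1 - \<eta>" by simp
    have "r X - r 0 \<ge> (X - 0) * (1 / 2 * \<eta> / s)"
    proof (rule r_growth[OF X])
      fix x assume x: "0 \<le> x" "x \<le> X"
      have "(r x)\<^sup>2 \<le> (r X)\<^sup>2" using r_mono[OF x(2)] r_pos[of x] by (intro power_mono) auto
      then have "\<eta> \<le> n x" using le n_bounds(3)[of x] by linarith
      then show "1 / 2 * \<eta> / s \<le> r x * n x / s"
        using r_mono[OF x(1)] r0 s_pos assms by (intro divide_right_mono mult_mono) auto
    qed
    moreover have "(X - 0) * (1 / 2 * \<eta> / s) = 1" using s_pos assms by (simp add: X_def)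
    ultimately show False using r_less[of X] r0 by linarith
  qed
  then have "1 - \<eta> < (r x)\<^sup>2" if "x \<ge> X" for x
    using power_mono[OF r_mono[OF that], of 2] r_pos[of X] by simp
  then show ?thesis using X by blast
qed

lemma r_to_0: assumes "\<eta> > 0" shows "\<exists>X>0. \<forall>x\<le>-X. (r x)\<^sup>2 < \<eta>"
proof -
  define e where "e = sqrt \<eta>"
  have e: "e > 0" using assms by (simp add: e_def)
  \<comment> \<open>To the left of 0, r \<le> 1/2 gives n \<ge> 3/4. If r stayed above
    \<open>e\<close> it would gain 3/4 over the length s / e, more than its value 1/2 at 0.\<close>
  define X where "X = s / e"
  have X: "X > 0" using s_pos e by (simp add: X_def)
  have "r (-X) < e"
  proof (rule ccontr)
    assume "\<not> r (-X) < e"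
    then have le: "e \<le> r (-X)" by simp
    have "r 0 - r (-X) \<ge> (0 - (-X)) * (e * (3 / 4) / s)"
    proof (rule r_growth)
      fix x assume x: "-X \<le> x" "x \<le> 0"
      have "(r x)\<^sup>2 \<le> (r 0)\<^sup>2" using r_mono[OF x(2)] r_pos[of x] by (intro power_mono) auto
      then have "3 / 4 \<le> n x" using n_bounds(3)[of x] by (simp add: r0 power2_eq_square)
      then show "e * (3 / 4) / s \<le> r x * n x / s"
        using r_mono[OF x(1)] le s_pos e by (intro divide_right_mono mult_mono) auto
    qed (use X in simp)
    moreover have "(0 - (-X)) * (e * (3 / 4) / s) = 3 / 4" using s_pos e by (simp add: X_def)
    ultimately show False using r_pos[of "-X"] r0 by linarith
  qed
  then have "(r x)\<^sup>2 < \<eta>" if "x \<le> -X" for x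
  proof -
    have "r x < e" using r_mono[OF that] \<open>r (-X) < e\<close> by linarith
    then have "(r x)\<^sup>2 < e\<^sup>2" using r_pos[of x] by (intro power_strict_mono) auto
    then show ?thesis using assms by (simp add: e_def)
  qed
  then show ?thesis using X by blast
qed

text \<open>h is a continuous function of r^2 with values 1 at 0 and -K at 1, and r^2 tends to 0 and
  1 at the two ends; \<open>\<delta>\<close> is half the smaller of the two absolute values.\<close>

lemma tails: "\<exists>\<delta> X. \<delta> > 0 \<and> X > 0 \<and> (\<forall>x\<ge>X. n x - m x \<le> - \<delta>) \<and> (\<forall>x\<le>-X. n x - m x \<ge> \<delta>)"
proof -
  define H where "H \<sigma> = Nd 0 \<sigma> + Nd 1 \<sigma> * \<sigma>" for \<sigma>
  have Hc: "continuous_on {0..} H" unfolding H_def by (intro continuous_intros Nd_cont)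
  have H: "n x - m x = H ((r x)\<^sup>2)" for x by (simp add: H_def n_def m_def)
  define \<delta> where "\<delta> = min (1 / 2) (K / 2)"
  have \<delta>: "\<delta> > 0" "\<delta> \<le> 1 / 2" "\<delta> \<le> K / 2" using K_pos by (auto simp: \<delta>_def)
  have H01: "H 0 = 1" "H 1 = - K" by (auto simp: H_def N_0 N_1 K_def)
  obtain e1 where e1: "e1 > 0" "\<And>\<sigma>. \<sigma> \<ge> 0 \<Longrightarrow> dist \<sigma> 0 < e1 \<Longrightarrow> dist (H \<sigma>) (H 0) < 1 / 2"
    using Hc[unfolded continuous_on_iff, rule_format, of 0 "1 / 2"] by auto
  obtain e2 where e2: "e2 > 0" "\<And>\<sigma>. \<sigma> \<ge> 0 \<Longrightarrow> dist \<sigma> 1 < e2 \<Longrightarrow> dist (H \<sigma>) (H 1) < K / 2"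
    using Hc[unfolded continuous_on_iff, rule_format, of 1 "K / 2"] K_pos by auto
  obtain X1 where X1: "X1 > 0" "\<And>x. x \<le> -X1 \<Longrightarrow> (r x)\<^sup>2 < e1" using r_to_0[OF e1(1)] by blast
  obtain X2 where X2: "X2 > 0" "\<And>x. x \<ge> X2 \<Longrightarrow> 1 - e2 < (r x)\<^sup>2" using r_to_1[OF e2(1)] by blast
  have "n x - m x \<le> - \<delta>" if "x \<ge> max X1 X2" for x
  proof -
    have "dist (H ((r x)\<^sup>2)) (H 1) < K / 2"
      by (rule e2(2)) (use X2(2)[of x] that r2[of x] in \<open>auto simp: dist_real_def\<close>)
    then show ?thesis unfolding H H01 dist_real_def using \<delta> by linarith
  qed
  moreover have "n x - m x \<ge> \<delta>" if "x \<le> - max X1 X2" for x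
  proof -
    have "dist (H ((r x)\<^sup>2)) (H 0) < 1 / 2"
      by (rule e1(2)) (use X1(2)[of x] that r2[of x] in \<open>auto simp: dist_real_def\<close>)
    then show ?thesis unfolding H H01 dist_real_def using \<delta> by linarith
  qed
  ultimately show ?thesis using \<delta>(1) X1(1) by (intro exI[of _ \<delta>] exI[of _ "max X1 X2"]) auto
qed

section \<open>The logarithm of the conjugating factor\<close>

definition lam :: "real \<Rightarrow> real" where "lam x = wd 0 x + ln (n x) / 2"

text \<open>The factor sqrt n contributes -m / s. Conjugation by e^lam therefore cancels the
  prescribed drift w' and leaves the drift m / s for which the symmetric part is
  semidefinite.\<close>

lemma lam_deriv: "(lam has_real_derivative wd 1 x - m x / s) (at x)"
proof -
  have "((\<lambda>x. wd 0 x + ln (n x) / 2) has_real_derivative wd (Suc 0) x + (1 / n x * (- 2 * m x * n x / s)) / 2) (at x)"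
    by (intro DERIV_add DERIV_cdivide DERIV_chain2[OF DERIV_ln_divide] n_deriv w_smooth[rule_format] n_bounds)
  moreover have "wd (Suc 0) x + (1 / n x * (- 2 * m x * n x / s)) / 2 = wd 1 x - m x / s"
    using n_bounds(1)[of x] s_pos by (simp add: field_simps)
  ultimately show ?thesis unfolding lam_def[abs_def] by simp
qed

lemma lam_cont: "continuous_on UNIV lam"
  by (rule DERIV_continuous_on) (use lam_deriv has_field_derivative_at_within in blast)

lemma w1_cont: "continuous_on UNIV (wd 1)"
  by (rule DERIV_continuous_on) (use w_smooth has_field_derivative_at_within in blast)

lemma w1_left: "x < -1 \<Longrightarrow> wd 1 x = 0"
proof -
  assume x: "x < -1"
  have "((\<lambda>x. 0) has_real_derivative 0) (at x)" by simp
  then have "(wd 0 has_real_derivative 0) (at x)"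
    by (rule has_field_derivative_transform_within_open[of _ _ _ "{..<-1}"]) (use x w_left in auto)
  then show ?thesis using w_smooth DERIV_unique One_nat_def by metis
qed

lemma w1_right: "x > 1 \<Longrightarrow> wd 1 x = K / s"
proof -
  assume x: "x > 1"
  have "((\<lambda>x. K / s * x) has_real_derivative K / s) (at x)" by (rule DERIV_cmult_Id)
  then have "(wd 0 has_real_derivative K / s) (at x)"
    by (rule has_field_derivative_transform_within_open[of _ _ _ "{1<..}"]) (use x w_right in \<open>auto simp: s_def\<close>)
  then show ?thesis using w_smooth DERIV_unique One_nat_def by metis
qed

lemma w1_bounded: "\<exists>W. \<forall>x. \<bar>wd 1 x\<bar> \<le> W"
proof -
  obtain W where W: "\<forall>x\<in>{-1..1}. \<bar>wd 1 x\<bar> \<le> W"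
    using continuous_bounded_Icc[OF continuous_on_subset[OF w1_cont subset_UNIV]] ..
  have "\<bar>wd 1 x\<bar> \<le> max W \<bar>K / s\<bar>" for x
    using W[rule_format, of x] w1_left[of x] w1_right[of x] by (cases "x < -1"; cases "x > 1") (simp_all add: le_max_iff_disj)
  then show ?thesis by blast
qed

text \<open>On the right the drift of \<open>lam\<close> is dominated by that of a multiple of \<open>ln r\<close>, which is bounded.\<close>
lemma lam_bounded: "\<exists>\<Lambda>\<ge>0. \<forall>x. \<bar>lam x\<bar> \<le> \<Lambda>"
proof -
  obtain C where C: "C \<ge> 0" "\<And>x. \<bar>K - m x\<bar> \<le> C * n x" using m_near_K by blast
  have lnr: "((\<lambda>x. ln (r x)) has_real_derivative n x / s) (at x)" for x
  proof -
    have "((\<lambda>x. ln (r x)) has_real_derivative 1 / r x * (r x * n x / s)) (at x)"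
      by (intro DERIV_chain2[OF DERIV_ln_divide] r_deriv r_pos)
    then show ?thesis using r_pos[of x] by simp
  qed
  \<comment> \<open>Beyond 1 the weight has slope exactly K / s, and the majorant is C times the
    derivative of ln r. So lam - C ln r is nonincreasing and lam + C ln r nondecreasing.\<close>
  have dom: "\<bar>wd 1 x - m x / s\<bar> \<le> C * (n x / s)" if "x > 1" for x
  proof -
    have "wd 1 x - m x / s = (K - m x) / s" using w1_right[OF that] by (simp add: diff_divide_distrib)
    then show ?thesis using C(2)[of x] s_pos by (simp add: divide_right_mono)
  qed
  have R: "\<bar>lam x\<bar> \<le> \<bar>lam 2\<bar> + C * \<bar>ln (r 2)\<bar>" if "x \<ge> 2" for x
  proof -
    have up: "lam x - C * ln (r x) \<le> lam 2 - C * ln (r 2)"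
    proof (rule DERIV_nonpos_imp_nonincreasing[OF that])
      fix y assume y: "2 \<le> y" "y \<le> x"
      have "((\<lambda>x. lam x - C * ln (r x)) has_real_derivative (wd 1 y - m y / s) - C * (n y / s)) (at y)"
        by (intro DERIV_diff DERIV_cmult lam_deriv lnr)
      moreover have "(wd 1 y - m y / s) - C * (n y / s) \<le> 0" using dom[of y] y by linarith
      ultimately show "\<exists>z. ((\<lambda>x. lam x - C * ln (r x)) has_real_derivative z) (at y) \<and> z \<le> 0" by blast
    qed
    have dn: "lam 2 + C * ln (r 2) \<le> lam x + C * ln (r x)"
    proof (rule DERIV_nonneg_imp_nondecreasing[OF that])
      fix y assume y: "2 \<le> y" "y \<le> x"
      have "((\<lambda>x. lam x + C * ln (r x)) has_real_derivative (wd 1 y - m y / s) + C * (n y / s)) (at y)"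
        by (intro DERIV_add DERIV_cmult lam_deriv lnr)
      moreover have "(wd 1 y - m y / s) + C * (n y / s) \<ge> 0" using dom[of y] y by linarith
      ultimately show "\<exists>z. ((\<lambda>x. lam x + C * ln (r x)) has_real_derivative z) (at y) \<and> 0 \<le> z" by blast
    qed
    have l: "ln (r 2) \<le> ln (r x)" "ln (r x) \<le> 0"
      using r_mono[OF that] r_pos[of 2] r_pos[of x] r_less[of x] by auto
    then have "C * ln (r 2) \<le> C * ln (r x)" "C * ln (r x) \<le> 0" using C(1) by (auto intro: mult_left_mono simp: mult_nonneg_nonpos)
    moreover have "C * \<bar>ln (r 2)\<bar> = - (C * ln (r 2))" using l by simp
    ultimately show ?thesis using up dn by linarith
  qed
  have Lf: "\<bar>lam x\<bar> \<le> \<bar>ln (n (-1))\<bar>" if "x \<le> -1" for x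
  proof -
    have "ln (n (-1)) \<le> ln (n x)" "ln (n x) \<le> 0"
      using n_mono[OF that] n_bounds[of x] n_bounds[of "-1"] by auto
    then show ?thesis using w_left that by (simp add: lam_def)
  qed
  obtain W where W: "\<forall>x\<in>{-1..2}. \<bar>lam x\<bar> \<le> W"
    using continuous_bounded_Icc[OF continuous_on_subset[OF lam_cont subset_UNIV]] ..
  define \<Lambda> where "\<Lambda> = max \<bar>W\<bar> (max (\<bar>lam 2\<bar> + C * \<bar>ln (r 2)\<bar>) \<bar>ln (n (-1))\<bar>)"
  have "\<bar>lam x\<bar> \<le> \<Lambda>" for x
  proof -
    consider "x \<le> -1" | "x \<ge> 2" | "x \<in> {-1..2}" by fastforce
    then show ?thesis
    proof cases
      case 3
      then have "\<bar>lam x\<bar> \<le> W" by (rule W[rule_format])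
      then show ?thesis unfolding \<Lambda>_def by linarith
    next
      case 1
      then show ?thesis using Lf[of x] unfolding \<Lambda>_def by linarith
    next
      case 2
      then show ?thesis using R[of x] unfolding \<Lambda>_def by linarith
    qed
  qed
  moreover have "\<Lambda> \<ge> 0" by (simp add: \<Lambda>_def)
  ultimately show ?thesis by blast
qed

end

section \<open>Back to the original variables\<close>

definition joint :: "cfun2 \<Rightarrow> real \<Rightarrow> complex \<times> complex" where
  "joint \<Phi> x = (fst \<Phi> x, snd \<Phi> x)"

definition split_fun :: "(real \<Rightarrow> complex \<times> complex) \<Rightarrow> cfun2" where
  "split_fun f = ((\<lambda>x. fst (f x)), (\<lambda>x. snd (f x)))"

lemma joint_split [simp]: "joint (split_fun f) = f" by (simp add: joint_def split_fun_def fun_eq_iff)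

lemma split_joint [simp]: "split_fun (joint \<Phi>) = \<Phi>" by (simp add: joint_def split_fun_def)

lemma L2v_joint: "L2v \<Phi> \<longleftrightarrow> l2 (joint \<Phi>)"
proof
  assume "L2v \<Phi>"
  then have "l2 (fst \<Phi>)" "l2 (snd \<Phi>)" by (auto simp: L2v_def L2_def l2_def)
  from l2_Pair(1)[OF this] show "l2 (joint \<Phi>)" by (simp add: joint_def[abs_def])
next
  assume "l2 (joint \<Phi>)"
  from l2_component(1,3)[OF this] show "L2v \<Phi>" by (simp add: L2v_def L2_def l2_def joint_def)
qed

text \<open>A square integrable g is Lebesgue integrable on bounded intervals, where its Lebesgue
  and Henstock-Kurzweil integrals agree.\<close>

lemma weak_deriv_h1: "weak_deriv f g \<longleftrightarrow> h1 f g"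
proof -
  have L: "L2 f \<longleftrightarrow> l2 f" for f by (simp add: L2_def l2_def)
  have "(\<forall>a b. a \<le> b \<longrightarrow> (g has_integral (f b - f a)) {a..b}) \<longleftrightarrow> ac f g" if g: "l2 g"
  proof -
    note i = l2_set_integrable(1)[OF g]
    have "(g has_integral (f b - f a)) {a..b} \<longleftrightarrow> (LINT x:{a..b}|lborel. g x) = f b - f a" for a b
      unfolding set_borel_integral_eq_integral(2)[OF i]
      using set_borel_integral_eq_integral(1)[OF i, of a b] has_integral_iff by blast
    then show ?thesis unfolding ac_def using i by simp
  qed
  then show ?thesis unfolding weak_deriv_def h1_def L by blast
qed

lemma H1v_joint: "H1v \<Phi> G \<longleftrightarrow> h1 (joint \<Phi>) (joint G)"
proof
  assume "H1v \<Phi> G"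
  then have "h1 (fst \<Phi>) (fst G)" "h1 (snd \<Phi>) (snd G)" by (auto simp: H1v_def weak_deriv_h1)
  from h1_Pair[OF this] show "h1 (joint \<Phi>) (joint G)" by (simp add: joint_def[abs_def])
next
  assume "h1 (joint \<Phi>) (joint G)"
  from h1_linear[OF bounded_linear_fst this] h1_linear[OF bounded_linear_snd this]
  show "H1v \<Phi> G" by (simp add: H1v_def weak_deriv_h1 joint_def)
qed

lemma norm2_joint: "norm2 \<Phi> = l2norm (joint \<Phi>)"
  by (simp add: norm2_def l2norm_def joint_def norm_Pair)

lemma ae2_joint: "ae2 \<Phi> \<Psi> \<longleftrightarrow> (AE x in lborel. joint \<Phi> x = joint \<Psi> x)"
  by (simp add: ae2_def joint_def)

lemma joint_zero2: "joint zero2 x = 0" by (simp add: joint_def zero2_def zero_prod_def)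

lemma joint_scale2: "joint (scale2 a \<Phi>) x = cscale a (joint \<Phi> x)"
  by (simp add: joint_def scale2_def cscale_def)

lemma joint_shift2: "joint (shift2 Op z \<Phi> G) x = joint (Op \<Phi> G) x - cscale z (joint \<Phi> x)"
  by (simp add: joint_def shift2_def cscale_def)

text \<open>The algebra of the change of variables: C, S, H, \<nu> stand for c, s, h, m / s, and c
  m, s m are written as C S \<nu>, S S \<nu>. With S^2 = (1 - C)(1 + C) the drift and the entries of
  A recombine into the sum and the difference of the two characteristic components.\<close>

lemma characteristic_identity:
  fixes C S \<nu> H p q p1 q1 :: complex
  assumes "S * S = 1 - C * C"
  shows "C * ((p1 + q1) - \<nu> * (p + q)) + ((p1 - q1) - \<nu> * (p - q)) + C * (S * \<nu>) * (p + q) + (H + S * (S * \<nu>)) * (p - q)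
      = ((1 + C) * p1 - C * (1 + C) * \<nu> * p - (H - C * (S * \<nu>)) * q) + (- (1 - C) * q1 + (H + C * (S * \<nu>)) * p - C * (1 - C) * \<nu> * q)"
    "((p1 + q1) - \<nu> * (p + q)) + C * ((p1 - q1) - \<nu> * (p - q)) + (- H + S * (S * \<nu>)) * (p + q) - C * (S * \<nu>) * (p - q)
      = ((1 + C) * p1 - C * (1 + C) * \<nu> * p - (H - C * (S * \<nu>)) * q) - (- (1 - C) * q1 + (H + C * (S * \<nu>)) * p - C * (1 - C) * \<nu> * q)"
  using assms by algebra+

text \<open>Fixes the constants whose existence is proved for the profile, so that the abstract kink
  can be instantiated and its operator named.\<close>

locale kink_linearization = kink_profile +
  fixes \<delta> X \<mu> W \<Lambda> :: real
  assumes \<delta>: "\<delta> > 0" and X: "X > 0"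
    and right: "\<And>x. x \<ge> X \<Longrightarrow> n x - m x \<le> - \<delta>" and left: "\<And>x. x \<le> - X \<Longrightarrow> n x - m x \<ge> \<delta>"
    and \<mu>: "\<And>x. m x \<le> \<mu>" and W: "\<And>x. \<bar>wd 1 x\<bar> \<le> W"
    and \<Lambda>: "\<Lambda> \<ge> 0" "\<And>x. \<bar>lam x\<bar> \<le> \<Lambda>"
begin

sublocale k: kink s c r n m \<delta> X \<mu>
  by unfold_locales
    (use c_range s_def r_deriv n_deriv m_cont r_pos r_less n_bounds m_nonneg \<mu> \<delta> X right left in auto)

abbreviation Op where "Op \<equiv> k.M.Op"

section \<open>Conjugation to characteristic variables\<close>

definition L :: "cfun2 \<Rightarrow> cfun2 \<Rightarrow> cfun2" where "L = Lw c (Nd 0) (Nd 1) u v (wd 1)"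

definition lam' :: "real \<Rightarrow> real" where "lam' x = wd 1 x - m x / s"

lemma lam'_bound: "\<bar>lam' x\<bar> \<le> W + \<mu> / s"
proof -
  have "0 \<le> m x / s" "m x / s \<le> \<mu> / s" using m_nonneg[of x] \<mu>[of x] s_pos by (auto intro: divide_right_mono)
  then show ?thesis using W[of x] unfolding lam'_def by linarith
qed

lemma exp_lam_le: "\<bar>\<sigma>\<bar> = 1 \<Longrightarrow> exp (\<sigma> * lam x) \<le> exp \<Lambda>"
proof -
  assume "\<bar>\<sigma>\<bar> = 1"
  then have "\<bar>\<sigma> * lam x\<bar> \<le> \<Lambda>" using \<Lambda>(2)[of x] by (simp add: abs_mult)
  then show ?thesis by simp
qed

text \<open>The two signs of \<sigma> cover the conjugation and its inverse; both factors are
  bounded because \<open>lam\<close> is.\<close>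

lemma l2_exp_lam:
  fixes f :: "real \<Rightarrow> 'a::euclidean_space"
  assumes f: "l2 f" and \<sigma>: "\<bar>\<sigma>\<bar> = 1"
  shows "l2 (\<lambda>x. exp (\<sigma> * lam x) *\<^sub>R f x)" "l2norm (\<lambda>x. exp (\<sigma> * lam x) *\<^sub>R f x) \<le> exp \<Lambda> * l2norm f"
    "l2 (\<lambda>x. (\<sigma> * lam' x * exp (\<sigma> * lam x)) *\<^sub>R f x)"
proof -
  have c1: "continuous_on UNIV (\<lambda>x. exp (\<sigma> * lam x))" by (intro continuous_intros lam_cont)
  have c2: "continuous_on UNIV lam'" unfolding lam'_def by (intro continuous_intros w1_cont m_cont) (use s_pos in simp)
  note [measurable] = l2D(1)[OF f] borel_measurable_continuous_onI[OF c1] borel_measurable_continuous_onI[OF c2]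
  have m1: "(\<lambda>x. exp (\<sigma> * lam x) *\<^sub>R f x) \<in> borel_measurable borel" by measurable
  have m2: "(\<lambda>x. (\<sigma> * lam' x * exp (\<sigma> * lam x)) *\<^sub>R f x) \<in> borel_measurable borel" by measurable
  have a1: "AE x in lborel. norm (exp (\<sigma> * lam x) *\<^sub>R f x) \<le> exp \<Lambda> * norm (f x)"
    by (rule AE_I2) (unfold norm_scaleR abs_exp_cancel, rule mult_right_mono[OF exp_lam_le[OF \<sigma>]], simp)
  show "l2 (\<lambda>x. exp (\<sigma> * lam x) *\<^sub>R f x)" "l2norm (\<lambda>x. exp (\<sigma> * lam x) *\<^sub>R f x) \<le> exp \<Lambda> * l2norm f"
    by (rule l2_bound[OF f m1 a1], simp)+
  have a2: "AE x in lborel. norm ((\<sigma> * lam' x * exp (\<sigma> * lam x)) *\<^sub>R f x) \<le> ((W + \<mu> / s) * exp \<Lambda>) * norm (f x)"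
  proof (rule AE_I2)
    fix x
    have "\<bar>\<sigma> * lam' x * exp (\<sigma> * lam x)\<bar> = \<bar>lam' x\<bar> * exp (\<sigma> * lam x)" using \<sigma> by (simp add: abs_mult)
    also have "\<dots> \<le> (W + \<mu> / s) * exp \<Lambda>" using lam'_bound[of x] by (intro mult_mono exp_lam_le \<sigma>) auto
    finally show "norm ((\<sigma> * lam' x * exp (\<sigma> * lam x)) *\<^sub>R f x) \<le> ((W + \<mu> / s) * exp \<Lambda>) * norm (f x)"
      unfolding norm_scaleR by (rule mult_right_mono) simp
  qed
  have "0 \<le> W + \<mu> / s" using lam'_bound[of 0] by linarith
  then show "l2 (\<lambda>x. (\<sigma> * lam' x * exp (\<sigma> * lam x)) *\<^sub>R f x)"
    by (intro l2_bound(1)[OF f m2 a2]) simp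
qed

lemma h1_exp_lam:
  fixes f :: "real \<Rightarrow> 'a::euclidean_space"
  assumes f: "h1 f g" and \<sigma>: "\<bar>\<sigma>\<bar> = 1"
  shows "h1 (\<lambda>x. exp (\<sigma> * lam x) *\<^sub>R f x) (\<lambda>x. exp (\<sigma> * lam x) *\<^sub>R g x + (\<sigma> * lam' x * exp (\<sigma> * lam x)) *\<^sub>R f x)"
proof -
  have "ac (\<lambda>x. exp (\<sigma> * lam x)) (\<lambda>x. \<sigma> * lam' x * exp (\<sigma> * lam x))"
  proof (rule ac_C1)
    show "((\<lambda>x. exp (\<sigma> * lam x)) has_vector_derivative \<sigma> * lam' x * exp (\<sigma> * lam x)) (at x)" for x
      using DERIV_chain2[OF DERIV_exp DERIV_cmult[OF lam_deriv, of \<sigma> x]]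
      by (simp add: has_real_derivative_iff_has_vector_derivative lam'_def mult.commute)
    show "continuous_on UNIV (\<lambda>x. \<sigma> * lam' x * exp (\<sigma> * lam x))"
      unfolding lam'_def by (intro continuous_intros w1_cont m_cont lam_cont) (use s_pos in simp)
  qed
  from ac_scaleR[OF this h1D(3)[OF f]] show ?thesis
    unfolding h1_def using l2_exp_lam[OF h1D(1)[OF f] \<sigma>] l2_exp_lam[OF h1D(2)[OF f] \<sigma>] by (simp add: l2_plus)
qed

text \<open>The change to the eigenbasis of \<Sigma>. It is twice its own inverse, hence the factor
  1/2 in \<open>to_char\<close>.\<close>

definition R :: "complex \<times> complex \<Rightarrow> complex \<times> complex" where
  "R z = (fst z + snd z, fst z - snd z)"

lemma R_linear: "bounded_linear R"
  unfolding R_def by (intro bounded_linear_Pair bounded_linear_add bounded_linear_sub bounded_linear_fst bounded_linear_snd)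

lemma R_R: "R (R z) = 2 *\<^sub>R z" by (cases z) (simp add: R_def scaleR_2)

lemma R_simps: "R (a *\<^sub>R z) = a *\<^sub>R R z" "R (z + w) = R z + R w" "R (z - w) = R z - R w" "R (cscale b z) = cscale b (R z)" "R 0 = 0"
  by (auto simp: R_def cscale_def algebra_simps zero_prod_def)

lemma R_inj: "R z = R w \<longleftrightarrow> z = w"
proof
  assume "R z = R w"
  then have "2 *\<^sub>R z = 2 *\<^sub>R w" using R_R by metis
  then show "z = w" by simp
qed simp

lemma R_norm: "norm (R z) \<le> 2 * norm z"
proof (rule power2_le_imp_le)
  have "R z \<bullet> R z = 2 * (z \<bullet> z)"
    by (cases z) (simp add: R_def inner_add_left inner_add_right inner_diff_left inner_diff_right inner_commute)
  then have "(norm (R z))\<^sup>2 = 2 * (norm z)\<^sup>2" unfolding power2_norm_eq_inner .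
  then show "(norm (R z))\<^sup>2 \<le> (2 * norm z)\<^sup>2" by (simp add: power_mult_distrib)
qed simp

definition to_orig :: "(real \<Rightarrow> complex \<times> complex) \<Rightarrow> real \<Rightarrow> complex \<times> complex" where
  "to_orig f x = exp (lam x) *\<^sub>R R (f x)"

definition to_orig' :: "(real \<Rightarrow> complex \<times> complex) \<Rightarrow> (real \<Rightarrow> complex \<times> complex) \<Rightarrow> real \<Rightarrow> complex \<times> complex" where
  "to_orig' f g x = exp (lam x) *\<^sub>R R (g x) + (lam' x * exp (lam x)) *\<^sub>R R (f x)"

definition to_char :: "(real \<Rightarrow> complex \<times> complex) \<Rightarrow> real \<Rightarrow> complex \<times> complex" where
  "to_char f x = exp (- lam x) *\<^sub>R ((1 / 2) *\<^sub>R R (f x))"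

lemma to_orig_to_char: "to_orig (to_char f) = f" "to_char (to_orig f) = f"
  by (auto simp: to_orig_def to_char_def R_simps R_R fun_eq_iff exp_minus)

lemma l2_to_orig: assumes "l2 f" shows "l2 (to_orig f)" "l2norm (to_orig f) \<le> 2 * exp \<Lambda> * l2norm f"
proof -
  have r: "l2 (\<lambda>x. R (f x))" by (rule l2_linear[OF R_linear assms])
  have "l2norm (\<lambda>x. R (f x)) \<le> 2 * l2norm f"
    by (rule l2_bound(2)[OF assms l2D(1)[OF r]]) (auto intro: AE_I2 R_norm)
  then have "exp \<Lambda> * l2norm (\<lambda>x. R (f x)) \<le> exp \<Lambda> * (2 * l2norm f)" by (rule mult_left_mono) simp
  moreover have "l2norm (to_orig f) \<le> exp \<Lambda> * l2norm (\<lambda>x. R (f x))"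
    using l2_exp_lam(2)[OF r, of 1] by (simp add: to_orig_def[abs_def])
  ultimately show "l2norm (to_orig f) \<le> 2 * exp \<Lambda> * l2norm f" by linarith
  show "l2 (to_orig f)" using l2_exp_lam(1)[OF r, of 1] by (simp add: to_orig_def[abs_def])
qed

lemma l2_to_char: assumes "l2 f" shows "l2 (to_char f)" "l2norm (to_char f) \<le> exp \<Lambda> * l2norm f"
proof -
  have lin: "bounded_linear (\<lambda>z. (1 / 2) *\<^sub>R R z)"
    by (rule bounded_linear_compose[OF bounded_linear_scaleR_right R_linear])
  have r: "l2 (\<lambda>x. (1 / 2) *\<^sub>R R (f x))" by (rule l2_linear[OF lin assms])
  have "norm ((1 / 2) *\<^sub>R R z) \<le> 1 * norm z" for z using R_norm[of z] by simp
  then have "l2norm (\<lambda>x. (1 / 2) *\<^sub>R R (f x)) \<le> 1 * l2norm f"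
    by (intro l2_bound(2)[OF assms l2D(1)[OF r]] AE_I2) simp_all
  then have "exp \<Lambda> * l2norm (\<lambda>x. (1 / 2) *\<^sub>R R (f x)) \<le> exp \<Lambda> * (1 * l2norm f)" by (rule mult_left_mono) simp
  moreover have "l2norm (to_char f) \<le> exp \<Lambda> * l2norm (\<lambda>x. (1 / 2) *\<^sub>R R (f x))"
    using l2_exp_lam(2)[OF r, of "-1"] by (simp add: to_char_def[abs_def])
  ultimately show "l2norm (to_char f) \<le> exp \<Lambda> * l2norm f" by linarith
  show "l2 (to_char f)" using l2_exp_lam(1)[OF r, of "-1"] by (simp add: to_char_def[abs_def])
qed

lemma h1_to_orig: assumes "h1 f g" shows "h1 (to_orig f) (to_orig' f g)"
  using h1_exp_lam[OF h1_linear[OF R_linear assms], of 1] by (simp add: to_orig_def[abs_def] to_orig'_def[abs_def])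

lemma h1_from:
  assumes "h1 F G" obtains f g where "h1 f g" "to_orig f = F" "to_orig' f g = G"
proof -
  have lin: "bounded_linear (\<lambda>z. (1 / 2) *\<^sub>R R z)"
    by (rule bounded_linear_compose[OF bounded_linear_scaleR_right R_linear])
  define g where "g x = exp (- lam x) *\<^sub>R ((1 / 2) *\<^sub>R R (G x)) + (- lam' x * exp (- lam x)) *\<^sub>R ((1 / 2) *\<^sub>R R (F x))" for x
  have "h1 (to_char F) g"
    using h1_exp_lam[OF h1_linear[OF lin assms], of "-1"] by (simp add: to_char_def[abs_def] g_def[abs_def])
  moreover have "to_orig' (to_char F) g = G"
  proof
    fix x
    have "exp (lam x) *\<^sub>R R (g x) = G x - lam' x *\<^sub>R F x"
      by (simp add: g_def R_simps R_R exp_minus algebra_simps)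
    moreover have "(lam' x * exp (lam x)) *\<^sub>R R (to_char F x) = lam' x *\<^sub>R F x"
      by (simp add: to_char_def R_simps R_R exp_minus)
    ultimately show "to_orig' (to_char F) g x = G x" by (simp add: to_orig'_def)
  qed
  ultimately show ?thesis using to_orig_to_char(1) that by blast
qed

text \<open>The half-angle formulas for 2 \<theta> = -arcsin c turn the direction of the kink into c
  and s, and the two contributions of m separate into h and a symmetric part.\<close>

lemma A_entries:
  "A11 (Nd 0) (Nd 1) u v x = c * m x" "A12 (Nd 0) (Nd 1) u v x = k.h x + s * m x"
  "A21 (Nd 0) (Nd 1) u v x = - k.h x + s * m x" "A22 (Nd 0) (Nd 1) u v x = - (c * m x)"
proof -
  have sq: "(sin \<theta>)\<^sup>2 = (1 - s) / 2" "(cos \<theta>)\<^sup>2 = (1 + s) / 2"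
    using trig(3) sin_cos_squared_add[of \<theta>] by (auto simp: field_simps)
  have "2 * Nd 1 ((r x)\<^sup>2) * u x * v x = Nd 1 ((r x)\<^sup>2) * (r x)\<^sup>2 * (2 * (sin \<theta> * cos \<theta>))"
    by (simp add: uv(1,2) power2_eq_square)
  then have e1: "2 * Nd 1 ((r x)\<^sup>2) * u x * v x = c * m x" unfolding trig(2) by (simp add: m_def)
  then show "A11 (Nd 0) (Nd 1) u v x = c * m x" "A22 (Nd 0) (Nd 1) u v x = - (c * m x)"
    by (auto simp: A11_def A22_def uv(3))
  have "2 * Nd 1 ((r x)\<^sup>2) * (v x)\<^sup>2 = - m x * (1 - s)"
    by (simp add: uv(2) power_mult_distrib sq m_def)
  then show "A12 (Nd 0) (Nd 1) u v x = k.h x + s * m x"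
    by (simp add: A12_def uv(3) k.h_def n_def algebra_simps)
  have "2 * Nd 1 ((r x)\<^sup>2) * (u x)\<^sup>2 = - m x * (1 + s)"
    by (simp add: uv(1) power_mult_distrib sq m_def)
  then show "A21 (Nd 0) (Nd 1) u v x = - k.h x + s * m x"
    by (simp add: A21_def uv(3) k.h_def n_def algebra_simps)
qed

lemma L_to_orig: "joint (L (split_fun (to_orig f)) (split_fun (to_orig' f g))) x = to_orig (Op f g) x"
proof -
  obtain p q where pq: "f x = (p, q)" by (cases "f x")
  obtain p1 q1 where pq1: "g x = (p1, q1)" by (cases "g x")
  define C where "C = complex_of_real c"
  define S where "S = complex_of_real s"
  define H where "H = complex_of_real (k.h x)"
  define \<nu> where "\<nu> = complex_of_real (m x / s)"
  define e where "e = complex_of_real (exp (lam x))"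
  have SS: "S * S = 1 - C * C"
    using k.s2 unfolding S_def C_def by (simp add: power2_eq_square flip: of_real_mult)
  have mS: "complex_of_real (m x) = S * \<nu>" using s_pos by (simp add: S_def \<nu>_def)
  have ck: "c * m x / k.\<kappa> = c * (1 + c) * (m x / s)" "k.\<kappa> * c * m x = c * (1 - c) * (m x / s)"
    using k.\<kappa>(1) s_pos by (auto simp: k.\<kappa>(3) k.\<kappa>(4))
  define M1 where "M1 = (1 + C) * p1 - C * (1 + C) * \<nu> * p - (H - C * (S * \<nu>)) * q"
  define M2 where "M2 = - (1 - C) * q1 + (H + C * (S * \<nu>)) * p - C * (1 - C) * \<nu> * q"
  have O: "fst (Op f g x) = M1" "snd (Op f g x) = M2"
    unfolding k.Op_components ck pq pq1 M1_def M2_def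
    using s_pos by (simp_all add: scaleR_conv_of_real C_def H_def \<nu>_def S_def)
  \<comment> \<open>Here w' disappears: the derivative of e^lam produces w' - m / s, and subtracting
    w' leaves the drift -\<nu>.\<close>
  have G: "fst (to_orig' f g x) - complex_of_real (wd 1 x) * fst (to_orig f x) = e * ((p1 + q1) - \<nu> * (p + q))"
    "snd (to_orig' f g x) - complex_of_real (wd 1 x) * snd (to_orig f x) = e * ((p1 - q1) - \<nu> * (p - q))"
    unfolding to_orig_def to_orig'_def pq pq1 R_def lam'_def e_def \<nu>_def
    by (simp_all add: scaleR_conv_of_real algebra_simps)
  have F: "fst (to_orig f x) = e * (p + q)" "snd (to_orig f x) = e * (p - q)"
    by (simp_all add: to_orig_def pq R_def e_def scaleR_conv_of_real)
  have A: "complex_of_real (A11 (Nd 0) (Nd 1) u v x) = C * (S * \<nu>)"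
    "complex_of_real (A12 (Nd 0) (Nd 1) u v x) = H + S * (S * \<nu>)"
    "complex_of_real (A21 (Nd 0) (Nd 1) u v x) = - H + S * (S * \<nu>)"
    "complex_of_real (A22 (Nd 0) (Nd 1) u v x) = - (C * (S * \<nu>))"
    unfolding A_entries mS[symmetric] by (simp_all add: C_def S_def H_def)
  have "fst (joint (L (split_fun (to_orig f)) (split_fun (to_orig' f g))) x) =
    C * (e * ((p1 + q1) - \<nu> * (p + q))) + e * ((p1 - q1) - \<nu> * (p - q)) + C * (S * \<nu>) * (e * (p + q)) + (H + S * (S * \<nu>)) * (e * (p - q))"
    unfolding L_def joint_def Lw_def split_fun_def fst_conv snd_conv unfolding G unfolding A F C_def[symmetric] ..
  also have "\<dots> = e * (M1 + M2)"
    unfolding M1_def M2_def characteristic_identity(1)[OF SS, symmetric] by (simp add: algebra_simps)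
  finally have 1: "fst (joint (L (split_fun (to_orig f)) (split_fun (to_orig' f g))) x) = e * (M1 + M2)" .
  have "snd (joint (L (split_fun (to_orig f)) (split_fun (to_orig' f g))) x) =
    e * ((p1 + q1) - \<nu> * (p + q)) + C * (e * ((p1 - q1) - \<nu> * (p - q))) + (- H + S * (S * \<nu>)) * (e * (p + q)) + - (C * (S * \<nu>)) * (e * (p - q))"
    unfolding L_def joint_def Lw_def split_fun_def fst_conv snd_conv unfolding G unfolding A F C_def[symmetric] ..
  also have "\<dots> = e * (M1 - M2)"
    unfolding M1_def M2_def characteristic_identity(2)[OF SS, symmetric] by (simp add: algebra_simps)
  finally have 2: "snd (joint (L (split_fun (to_orig f)) (split_fun (to_orig' f g))) x) = e * (M1 - M2)" .
  show ?thesis by (rule prod_eqI) (simp_all add: 1 2 to_orig_def R_def O e_def scaleR_conv_of_real)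
qed

lemma to_orig_cscale: "to_orig (\<lambda>x. cscale z (f x)) x = cscale z (to_orig f x)"
  by (simp add: to_orig_def R_simps) (simp add: cscale_def)

lemma to_orig_diff: "to_orig (\<lambda>x. f x - g x) x = to_orig f x - to_orig g x"
  by (simp add: to_orig_def R_simps scaleR_diff_right)

lemma to_orig_eq_iff: "to_orig f x = to_orig g x \<longleftrightarrow> f x = g x"
  by (simp add: to_orig_def R_inj)

lemma shift_to_orig: "joint (shift2 L z (split_fun (to_orig f)) (split_fun (to_orig' f g))) = to_orig (\<lambda>x. Op f g x - cscale z (f x))"
  by (rule ext) (simp add: joint_shift2 L_to_orig to_orig_diff to_orig_cscale)

lemma in_resolvent_set:
  assumes "k.surjective_at z" "k.bounded_below_at z" shows "z \<in> resolvent_set L"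
  unfolding resolvent_set_def mem_Collect_eq
proof (intro conjI allI impI)
  fix F assume "L2v F"
  then have "l2 (to_char (joint F))" by (simp add: L2v_joint l2_to_char)
  then obtain f g where fg: "h1 f g" "AE x in lborel. Op f g x - cscale z (f x) = to_char (joint F) x"
    using assms(1) unfolding k.surjective_at_def by blast
  have "H1v (split_fun (to_orig f)) (split_fun (to_orig' f g))" by (simp add: H1v_joint h1_to_orig fg)
  moreover have "ae2 (shift2 L z (split_fun (to_orig f)) (split_fun (to_orig' f g))) F"
    unfolding ae2_joint shift_to_orig using fg(2)
  proof eventually_elim
    case (elim x)
    then have "to_orig (\<lambda>x. Op f g x - cscale z (f x)) x = to_orig (to_char (joint F)) x" by (simp add: to_orig_eq_iff)
    then show ?case by (simp add: to_orig_to_char)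
  qed
  ultimately show "\<exists>\<phi> g. H1v \<phi> g \<and> ae2 (shift2 L z \<phi> g) F" by blast
next
  obtain C where C: "C \<ge> 0 \<and> (\<forall>f g. h1 f g \<longrightarrow> l2norm f \<le> C * l2norm (\<lambda>x. Op f g x - cscale z (f x)))"
    using assms(2)[unfolded k.bounded_below_at_def] ..
  \<comment> \<open>The resolvent constant in characteristic variables, multiplied by the bounds for
    the change of variables and its inverse.\<close>
  have "norm2 \<Phi> \<le> (2 * exp \<Lambda> * C * exp \<Lambda>) * norm2 (shift2 L z \<Phi> G)" if HG: "H1v \<Phi> G" for \<Phi> G
  proof -
    obtain f g where fg: "h1 f g" "to_orig f = joint \<Phi>" "to_orig' f g = joint G"
      by (rule h1_from[OF HG[unfolded H1v_joint]])
    let ?d = "\<lambda>x. Op f g x - cscale z (f x)"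
    have e: "joint (shift2 L z \<Phi> G) = to_orig ?d"
      using shift_to_orig[of z f g] by (simp add: fg(2,3))
    have ld: "l2 ?d" by (rule k.l2_resolvent[OF fg(1)])
    have "norm2 \<Phi> \<le> 2 * exp \<Lambda> * l2norm f" unfolding norm2_joint fg(2)[symmetric] by (rule l2_to_orig(2)[OF h1D(1)[OF fg(1)]])
    also have "\<dots> \<le> 2 * exp \<Lambda> * (C * l2norm ?d)" 
      by (rule mult_left_mono[OF C[THEN conjunct2, rule_format, OF fg(1)]]) simp
    also have "\<dots> \<le> 2 * exp \<Lambda> * (C * (exp \<Lambda> * l2norm (to_orig ?d)))"
      using l2_to_char(2)[OF l2_to_orig(1)[OF ld]] C[THEN conjunct1] unfolding to_orig_to_char
      by (intro mult_left_mono) simp_all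
    finally show ?thesis unfolding norm2_joint e by (simp add: mult.assoc)
  qed
  then show "\<exists>C. \<forall>\<phi> g. H1v \<phi> g \<longrightarrow> norm2 \<phi> \<le> C * norm2 (shift2 L z \<phi> g)" by blast
qed

section \<open>The translation mode and the spectral conclusions\<close>

definition e :: cfun2 where
  "e = ((\<lambda>x. complex_of_real (exp (wd 0 x) * deriv u x)), (\<lambda>x. complex_of_real (exp (wd 0 x) * deriv v x)))"

text \<open>The common factor agrees because e^lam E = e^w r n. The directions agree because the
  constant direction (cos \<theta>, sin \<theta>) of the kink is proportional to (\<kappa> + 1,
  \<kappa> - 1).\<close>

lemma joint_e: obtains a where "a \<noteq> 0" "\<And>x. joint e x = cscale a (to_orig k.ev x)"
proof -
  \<comment> \<open>Determined by the first component, a (\<kappa> + 1) = cos \<theta> / s.\<close>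
  define a where "a = cos \<theta> / (s * (k.\<kappa> + 1))"
  have kp: "k.\<kappa> + 1 > 0" using k.\<kappa>(1) by simp
  have a: "a > 0" using trig(1) s_pos kp by (simp add: a_def)
  \<comment> \<open>The second component then requires tan \<theta> = (\<kappa> - 1) / (\<kappa> +
    1).\<close>
  have sn: "sin \<theta> / s = a * (k.\<kappa> - 1)"
  proof -
    have sq: "s = (cos \<theta>)\<^sup>2 - (sin \<theta>)\<^sup>2" "c = - 2 * (sin \<theta> * cos \<theta>)" "(cos \<theta>)\<^sup>2 + (sin \<theta>)\<^sup>2 = 1"
      using trig by auto
    have "sin \<theta> * (1 - c + s) = cos \<theta> * (1 - c - s)"
      using sq by algebra
    then have "sin \<theta> * (k.\<kappa> + 1) = cos \<theta> * (k.\<kappa> - 1)"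
      using s_pos by (simp add: k.\<kappa>_def field_simps)
    then have "sin \<theta> = cos \<theta> * (k.\<kappa> - 1) / (k.\<kappa> + 1)" using kp by (simp add: eq_divide_eq)
    then show ?thesis by (simp add: a_def)
  qed
  have cs: "cos \<theta> / s = a * (k.\<kappa> + 1)" using kp s_pos by (simp add: a_def)
  have du: "deriv u x = r x * n x * (cos \<theta> / s)" for x
    using DERIV_imp_deriv[OF u_deriv[of x]] by (simp add: uv(1))
  have dv: "deriv v x = r x * n x * (sin \<theta> / s)" for x
  proof -
    have "((\<lambda>x. r x * sin \<theta>) has_real_derivative r x * n x / s * sin \<theta>) (at x)"
      by (rule DERIV_cmult_right[OF r_deriv])
    moreover have "(\<lambda>x. r x * sin \<theta>) = v" using uv(2) by auto
    ultimately have "deriv v x = r x * n x / s * sin \<theta>" using DERIV_imp_deriv by metis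
    then show ?thesis by simp
  qed
  have ex: "exp (lam x) = exp (wd 0 x) * sqrt (n x)" for x
  proof -
    have "exp (lam x) = exp (wd 0 x) * exp (ln (sqrt (n x)))"
      using n_bounds(1)[of x] by (simp add: lam_def exp_add ln_sqrt)
    then show ?thesis using n_bounds(1)[of x] by simp
  qed
  have b: "exp (lam x) * k.E x = exp (wd 0 x) * (r x * n x)" for x
    using n_bounds(1)[of x] by (simp add: ex k.E_def)
  have "joint e x = cscale (complex_of_real a) (to_orig k.ev x)" for x
  proof (rule prod_eqI)
    have "fst (cscale (complex_of_real a) (to_orig k.ev x)) = complex_of_real ((exp (lam x) * k.E x) * (a * (k.\<kappa> + 1)))"
      by (simp add: cscale_def to_orig_def R_def k.ev_def scaleR_conv_of_real algebra_simps)
    then show "fst (joint e x) = fst (cscale (complex_of_real a) (to_orig k.ev x))"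
      by (simp add: joint_def e_def du b flip: cs)
    have "snd (cscale (complex_of_real a) (to_orig k.ev x)) = complex_of_real ((exp (lam x) * k.E x) * (a * (k.\<kappa> - 1)))"
      by (simp add: cscale_def to_orig_def R_def k.ev_def scaleR_conv_of_real algebra_simps)
    then show "snd (joint e x) = snd (cscale (complex_of_real a) (to_orig k.ev x))"
      by (simp add: joint_def e_def dv b flip: sn)
  qed
  then show ?thesis using a by (intro that[of "complex_of_real a"]) auto
qed

lemma generalized_eigenvectors:
  assumes "gen_eig L 0 j \<Phi>" shows "\<exists>a. ae2 \<Phi> (scale2 a e)"
  using assms
proof (induction j arbitrary: \<Phi>)
  case 0
  then have "ae2 \<Phi> (scale2 0 e)" by (simp add: ae2_joint joint_zero2 joint_scale2 cscale_simps)
  then show ?case by blast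
next
  case (Suc j)
  obtain a0 where a0: "a0 \<noteq> 0" "\<And>x. joint e x = cscale a0 (to_orig k.ev x)" by (rule joint_e) blast
  obtain \<Psi> G where \<Psi>: "H1v \<Psi> G" "ae2 \<Psi> \<Phi>" "gen_eig L 0 j (shift2 L 0 \<Psi> G)" using Suc.prems by auto
  obtain a where a: "ae2 (shift2 L 0 \<Psi> G) (scale2 a e)" using Suc.IH[OF \<Psi>(3)] by blast
  obtain f g where fg: "h1 f g" "to_orig f = joint \<Psi>" "to_orig' f g = joint G"
    by (rule h1_from[OF \<Psi>(1)[unfolded H1v_joint]])
  have "joint (shift2 L 0 \<Psi> G) = to_orig (Op f g)"
    using shift_to_orig[of 0 f g] by (simp add: fg(2,3) cscale_simps)
  then have "AE x in lborel. to_orig (Op f g) x = to_orig (\<lambda>x. cscale (a * a0) (k.ev x)) x"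
    using a by (simp add: ae2_joint joint_scale2 a0(2) to_orig_cscale cscale_simps)
  then have eq: "AE x in lborel. Op f g x = cscale (a * a0) (k.ev x)" by (simp add: to_orig_eq_iff)
  have "k.ell (Op f g) = k.ell (\<lambda>x. cscale (a * a0) (k.ev x))"
    by (rule k.ell_cong[OF k.M.l2_Op[OF fg(1)] l2_cscale(1)[OF k.l2_ev] eq])
  \<comment> \<open>The induction hypothesis makes the image a multiple of the zero mode; pairing
    with that mode annihilates the image but not the mode, so the multiple is 0 and the preimage
    already lies in the kernel.\<close>
  then have z: "a * a0 = 0" by (simp add: k.ell_Op[OF fg(1)] k.ell_cscale[OF k.l2_ev] k.ell_ev)
  have "AE x in lborel. Op f g x = 0" using eq unfolding z by (simp add: cscale_simps)
  then obtain b where b: "\<And>x. f x = cscale b (k.ev x)" using k.kernel[OF fg(1)] by blast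
  have "joint \<Psi> x = joint (scale2 (b / a0) e) x" for x
  proof -
    have "f = (\<lambda>x. cscale b (k.ev x))" using b by (rule ext)
    then have "joint \<Psi> x = cscale b (to_orig k.ev x)" using to_orig_cscale by (simp add: fg(2)[symmetric])
    then show ?thesis using a0(1) by (simp add: joint_scale2 a0(2) cscale_simps)
  qed
  then have "ae2 \<Phi> (scale2 (b / a0) e)" using \<Psi>(2) by (auto simp: ae2_joint elim!: eventually_mono)
  then show ?case by blast
qed

lemma e_eigvec: obtains G where "H1v e G" "ae2 (shift2 L 0 e G) zero2"
proof -
  obtain a0 where a0: "a0 \<noteq> 0" "\<And>x. joint e x = cscale a0 (to_orig k.ev x)" by (rule joint_e) blast
  let ?f = "\<lambda>x. cscale a0 (k.ev x)" and ?g = "\<lambda>x. cscale a0 (k.ev' x)"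
  have h: "h1 ?f ?g" by (rule h1_cscale[OF k.h1_ev])
  have "joint e = to_orig ?f" by (rule ext) (simp add: a0(2) to_orig_cscale)
  then have e: "e = split_fun (to_orig ?f)" by (metis split_joint)
  have "Op ?f ?g x = 0" for x
    using k.Op_cscale_ev[of "\<lambda>x. 0" "- a0" "\<lambda>x. 0" x]
    by (simp add: cscale_simps k.M.Op_def k.S_def k.B_def zero_prod_def)
  then have "joint (shift2 L 0 e (split_fun (to_orig' ?f ?g))) x = 0" for x
    unfolding e shift_to_orig by (simp add: to_orig_def cscale_simps R_simps)
  then have "ae2 (shift2 L 0 e (split_fun (to_orig' ?f ?g))) zero2" by (simp add: ae2_joint joint_zero2)
  moreover have "H1v e (split_fun (to_orig' ?f ?g))" by (simp add: H1v_joint e h1_to_orig[OF h])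
  ultimately show ?thesis using that by blast
qed

lemma e_nonzero: "\<not> ae2 e zero2"
proof
  assume "ae2 e zero2"
  obtain a0 where a0: "a0 \<noteq> 0" "\<And>x. joint e x = cscale a0 (to_orig k.ev x)" by (rule joint_e) blast
  have ev: "k.ev x \<noteq> 0" for x using k.E_pos[of x] by (simp add: k.ev_def zero_prod_def)
  have "joint e x \<noteq> 0" for x
  proof -
    have "norm (joint e x) = norm a0 * norm (to_orig k.ev x)" by (simp add: a0(2) norm_cscale)
    moreover have "to_orig k.ev x \<noteq> 0" using ev[of x] R_inj[of "k.ev x" 0] by (simp add: to_orig_def R_simps)
    ultimately show ?thesis using a0(1) by auto
  qed
  then have "AE x::real in lborel. False" using \<open>ae2 e zero2\<close> by (simp add: ae2_joint joint_zero2)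
  then show False by (simp add: eventually_False ae_filter_eq_bot_iff)
qed

lemma eigvec_e: "eigvec L 0 e"
proof -
  obtain G where "H1v e G" "ae2 (shift2 L 0 e G) zero2" by (rule e_eigvec) blast
  then show ?thesis unfolding eigvec_def One_nat_def gen_eig.simps by (intro exI[of _ e] exI[of _ G]) (simp add: ae2_def)
qed

lemma spectrum_left: assumes "z \<in> spectrum_op L" shows "Re z \<le> 0"
proof (rule ccontr)
  assume "\<not> Re z \<le> 0"
  then have "z \<in> resolvent_set L" using k.right_half_plane[of z] in_resolvent_set by simp
  then show False using assms by (simp add: spectrum_op_def)
qed

lemma zero_in_spectrum: "0 \<in> spectrum_op L"
proof (rule ccontr)
  assume "0 \<notin> spectrum_op L"
  then have "\<exists>C. \<forall>\<phi> g. H1v \<phi> g \<longrightarrow> norm2 \<phi> \<le> C * norm2 (shift2 L 0 \<phi> g)"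
    by (simp add: spectrum_op_def resolvent_set_def)
  then obtain C where C: "\<forall>\<phi> g. H1v \<phi> g \<longrightarrow> norm2 \<phi> \<le> C * norm2 (shift2 L 0 \<phi> g)" ..
  obtain G where G: "H1v e G" "ae2 (shift2 L 0 e G) zero2" by (rule e_eigvec) blast
  have le: "l2 (joint e)" using G(1) h1D(1) by (auto simp: H1v_joint)
  have "norm2 (shift2 L 0 e G) = sqrt (\<integral>x. (norm (joint (shift2 L 0 e G) x))\<^sup>2 \<partial>lborel)"
    by (simp add: norm2_joint l2norm_def)
  also have "(\<integral>x. (norm (joint (shift2 L 0 e G) x))\<^sup>2 \<partial>lborel) = 0"
    by (rule integral_eq_zero_AE) (use G(2) in \<open>auto simp: ae2_joint joint_zero2 elim!: eventually_mono\<close>)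
  finally have "norm2 (shift2 L 0 e G) = 0" by simp
  then have "l2norm (joint e) \<le> 0" using C[rule_format, OF G(1)] by (simp add: norm2_joint)
  then have "l2norm (joint e) = 0" using l2norm_nonneg[of "joint e"] by linarith
  then have "ae2 e zero2" using l2norm_eq_0_iff[OF le] by (simp add: ae2_joint joint_zero2)
  then show False using e_nonzero by simp
qed

lemma zero_isolated: "\<not> 0 islimpt spectrum_op L"
proof -
  obtain \<epsilon> where \<epsilon>: "\<epsilon> > 0" "\<forall>z. z \<noteq> 0 \<longrightarrow> norm z < \<epsilon> \<longrightarrow> k.surjective_at z \<and> k.bounded_below_at z"
    using k.punctured_neighbourhood by (elim exE conjE)
  have "z \<notin> spectrum_op L" if "z \<noteq> 0" "norm z < \<epsilon>" for z
    using \<epsilon>(2) that in_resolvent_set by (simp add: spectrum_op_def)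
  then show ?thesis unfolding islimpt_approachable using \<epsilon>(1) by (auto simp: dist_norm)
qed

lemma zero_in_disc_spectrum: "0 \<in> disc_spectrum L"
proof -
  have "\<exists>a. ae2 \<Phi> (comb2 a {e})" if g: "gen_eig L 0 j \<Phi>" for j \<Phi>
  proof -
    obtain a where "ae2 \<Phi> (scale2 a e)" using generalized_eigenvectors[OF g] by blast
    then have "ae2 \<Phi> (comb2 (\<lambda>_. a) {e})" by (simp add: comb2_def scale2_def)
    then show ?thesis by blast
  qed
  then have "\<exists>B. finite B \<and> (\<forall>\<phi>. (\<exists>k. gen_eig L 0 k \<phi>) \<longrightarrow> (\<exists>a. ae2 \<phi> (comb2 a B)))"
    by (intro exI[of _ "{e}"]) blast
  then show ?thesis unfolding disc_spectrum_def
    using zero_in_spectrum zero_isolated eigvec_e e_nonzero by blast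
qed

lemma eigenspace: "eigvec L 0 \<Phi> \<Longrightarrow> \<exists>a. ae2 \<Phi> (scale2 a e)"
  unfolding eigvec_def by (rule generalized_eigenvectors)

end

theorem theorem8p6:
  fixes Nd :: "nat \<Rightarrow> real \<Rightarrow> real" and c \<theta> K :: real
    and u v :: "real \<Rightarrow> real" and wd :: "nat \<Rightarrow> real \<Rightarrow> real"
  assumes N_smooth: "\<forall>k. \<forall>s\<ge>0. (Nd k has_real_derivative Nd (Suc k) s) (at s within {0..})"
    and N_decr: "\<forall>s>0. Nd 1 s < 0"
    and N_0: "Nd 0 0 = 1" and N_1: "Nd 0 1 = 0"
    and N_lim: "(\<exists>l<0. (Nd 0 \<longlongrightarrow> l) at_top) \<or> filterlim (Nd 0) at_bot at_top"
    and K_def: "K = - Nd 1 1"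
    and N_concave: "\<forall>s\<in>{0..1}. Nd 2 s \<le> 0"
    and c_range: "0 \<le> c" "c < 1"
    and theta_def: "\<theta> = - arcsin c / 2"
    and u_ode: "\<forall>x. (u has_real_derivative u x * Nd 0 ((u x)\<^sup>2 + (v x)\<^sup>2) / sqrt (1 - c\<^sup>2)) (at x)"
    and v_def: "\<forall>x. v x = u x * tan \<theta>"
    and u_pos: "\<forall>x. u x > 0"
    and u_norm: "(u 0)\<^sup>2 + (v 0)\<^sup>2 = 1/4"
    and w_smooth: "\<forall>k x. (wd k has_real_derivative wd (Suc k) x) (at x)"
    and w_left: "\<forall>x\<le>-1. wd 0 x = 0"
    and w_right: "\<forall>x\<ge>1. wd 0 x = K / sqrt (1 - c\<^sup>2) * x"
  shows "(\<forall>z\<in>spectrum_op (Lw c (Nd 0) (Nd 1) u v (wd 1)). Re z \<le> 0)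
       \<and> 0 \<in> disc_spectrum (Lw c (Nd 0) (Nd 1) u v (wd 1))
       \<and> (let e = ((\<lambda>x. complex_of_real (exp (wd 0 x) * deriv u x)),
                   (\<lambda>x. complex_of_real (exp (wd 0 x) * deriv v x)))
          in eigvec (Lw c (Nd 0) (Nd 1) u v (wd 1)) 0 e \<and> \<not> ae2 e zero2
             \<and> (\<forall>\<phi>. eigvec (Lw c (Nd 0) (Nd 1) u v (wd 1)) 0 \<phi> \<longrightarrow> (\<exists>a. ae2 \<phi> (scale2 a e))))"
proof -
  interpret P: kink_profile Nd c \<theta> K u v wd
    by (rule kink_profile.intro) (fact assms)+
  obtain \<delta> X where t: "\<delta> > 0" "X > 0" "\<forall>x\<ge>X. P.n x - P.m x \<le> - \<delta>" "\<forall>x\<le>-X. P.n x - P.m x \<ge> \<delta>"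
    using P.tails by blast
  obtain \<mu> where \<mu>: "\<forall>x. P.m x \<le> \<mu>" using P.m_bounded by blast
  obtain W where W: "\<forall>x. \<bar>wd 1 x\<bar> \<le> W" using P.w1_bounded by blast
  obtain \<Lambda> where \<Lambda>: "\<Lambda> \<ge> 0" "\<forall>x. \<bar>P.lam x\<bar> \<le> \<Lambda>" using P.lam_bounded by blast
  interpret Q: kink_linearization Nd c \<theta> K u v wd \<delta> X \<mu> W \<Lambda>
    by unfold_locales (use t \<mu> W \<Lambda> in auto)
  show ?thesis
    unfolding Let_def Q.e_def[symmetric] Q.L_def[symmetric]
    using Q.spectrum_left Q.zero_in_disc_spectrum Q.eigvec_e Q.e_nonzero Q.eigenspace by blast
qed

end
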